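(* Let $(X_i)_{i\ge1}$ be i.i.d. real random variables on $(\Omega,\mathcal F,\mathbb P)$, $S_0:=0$, $S_n:=X_1+\cdots+X_n$, with $(S_n)$ recurrent and $S_n/A_n\to X$ in distribution for some positive reals $A_n$, where $X$ is a stable random variable of index $\alpha\in(1,2]$ with density $f_X$. Assume the Cramér condition $\limsup_{|t|\to\infty}|\mathbb E[e^{itX_1}]|<1$, and let $\frac1\alpha+\frac1\beta=1$. For each $\varepsilon>0$ let $M_0^\varepsilon$ be uniformly distributed on $(-\varepsilon,\varepsilon)$ and independent of $(S_n)_{n\ge0}$, let $M_n^\varepsilon:=M_0^\varepsilon+S_n$ and $\tau_\varepsilon:=\min\{n\ge1:|M_n^\varepsilon|<\varepsilon\}$. Let $\Omega^*:=\{S_n\ne0\ \forall n\ge1\}$, $\gamma:=2f_X(0)\mathbb P(\Omega^* )$, and let $G:[0,\infty)\to[0,\infty)$ be continuous with $G(0)=0$, $G(n)=\sum_{k=1}^n\frac1{A_k}$ for integers $n\ge1$, affine on each $[n,n+1]$, with inverse $G^{-1}$. Let $\mathcal E,\mathcal G_{1/\beta}$ be independent with $\Pr(\mathcal E>t)=e^{-t}$ and $\mathbb E[e^{-s\mathcal G_{1/\beta}}]=e^{-s^{1/\beta}}$ ($s>0$). Then for every $t>0$, \[ \lim_{\varepsilon\to0}\mathbb P\left(\Gamma\!\left(\tfrac1\beta\right)\frac\gamma\beta\,\varepsilon\,G(\tau_\varepsilon)\le t\ \middle|\ \Omega^*\right)=\Pr\left(\mathcal E\,\mathcal G_{1/\beta}^{1/\beta}\le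 t\right), \] equivalently \[ \lim_{\varepsilon\to0}\mathbb P\left(\left(\Gamma\!\left(\tfrac1\beta\right)\frac\gamma\beta\right)^\beta\frac{\tau_\varepsilon}{G^{-1}(1/\varepsilon)}\le t\ \middle|\ \Omega^*\right)=\Pr\left(\mathcal E^\beta\,\mathcal G_{1/\beta}\le t\right). \]
   Context: $\Gamma(\cdot)$ is Euler's Gamma function. *)

theory Defs
  imports "HOL-Probability.Probability"
begin

text \<open>Random walk: S 0 = 0, S n = X_1 + ... + X_n; here the i.i.d. steps are indexed
  from 0, i.e. X_1,...,X_n of the paper are X 0, ..., X (n-1).\<close>
definition walk :: "(nat \<Rightarrow> 'a \<Rightarrow> real) \<Rightarrow> nat \<Rightarrow> 'a \<Rightarrow> real" where
  "walk X n \<omega> = (\<Sum>i<n. X i \<omega>)"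

definition recurrent_walk :: "'a measure \<Rightarrow> (nat \<Rightarrow> 'a \<Rightarrow> real) \<Rightarrow> bool" where
  "recurrent_walk M S \<longleftrightarrow> (\<forall>\<delta>>0. AE \<omega> in M. \<exists>\<^sub>\<infinity>n. \<bar>S n \<omega>\<bar> < \<delta>)"

text \<open>Stable law of index alpha (alpha \<noteq> 1, which is all we need since alpha \<in> (1,2]),
  via its characteristic function: location m, scale sigma > 0, skewness b \<in> [-1,1].\<close>
definition stable_law :: "real measure \<Rightarrow> real \<Rightarrow> bool" where
  "stable_law \<mu> \<alpha> \<longleftrightarrow> real_distribution \<mu> \<and> 0 < \<alpha> \<and> \<alpha> \<le> 2 \<and> \<alpha> \<noteq> 1 \<and>
     (\<exists>\<sigma>>0. \<exists>b\<in>{-1..1}. \<exists>m::real. \<forall>t::real.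
        char \<mu> t = exp (\<i> * of_real (m * t)
                         - of_real (\<sigma> powr \<alpha> * \<bar>t\<bar> powr \<alpha>)
                           * (1 - \<i> * of_real (b * sgn t * tan (pi * \<alpha> / 2)))))"

definition Gsum :: "(nat \<Rightarrow> real) \<Rightarrow> nat \<Rightarrow> real" where
  "Gsum A n = (\<Sum>k=1..n. 1 / A k)"

definition Gfun :: "(nat \<Rightarrow> real) \<Rightarrow> real \<Rightarrow> real" where
  "Gfun A x = Gsum A (nat \<lfloor>x\<rfloor>) + (x - of_int \<lfloor>x\<rfloor>) / A (nat \<lfloor>x\<rfloor> + 1)"

definition Ginv :: "(nat \<Rightarrow> real) \<Rightarrow> real \<Rightarrow> real" where
  "Ginv A = inv_into {0..} (Gfun A)"

definition first_hit :: "(nat \<Rightarrow> bool) \<Rightarrow> enat" where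
  "first_hit P = (if \<exists>n\<ge>1. P n then enat (LEAST n. 1 \<le> n \<and> P n) else \<infinity>)"

end

theory Submission
  imports Defs "HOL-Real_Asymp.Real_Asymp"
begin

text \<open>
  Let \<open>q\<^sub>m\<close> be the probability that the walk started uniformly in \<open>I = {-\<epsilon><..<\<epsilon>}\<close> avoids \<open>I\<close> at times
  \<open>1, ..., m\<close>. Decomposing at the last visit to \<open>I\<close> before time \<open>n\<close> gives a renewal identity in which
  time \<open>k\<close> carries the weight \<open>P(S\<^sub>k \<in> {y-\<epsilon><..<y+\<epsilon>})\<close>, with \<open>y\<close> the position at that visit. For bounded
  \<open>k\<close> this weight tends to \<open>P(S\<^sub>k = 0)\<close>, and these masses add up to \<open>1 / P(\<Omega>\<^sup>*)\<close> by the same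
  decomposition at the point \<open>0\<close>. For large \<open>k\<close> it is \<open>2 \<epsilon> fX(0) / A\<^sub>k\<close> up to a factor close to \<open>1\<close>, by a
  local limit theorem which the Cramer condition makes valid on shrinking windows. Hence, with
  \<open>z = exp (- s / n)\<close> and \<open>\<epsilon> G(n)\<close> convergent, the Abelian theorem for the regularly varying sequence
  \<open>1 / A\<^sub>k\<close> gives the limit of \<open>(1 - z) \<Sum> z\<^sup>m q\<^sub>m\<close>, that is, of \<open>E(z\<^sup>\<tau>)\<close>. Off \<open>\<Omega>\<^sup>*\<close> the time \<open>\<tau>\<close> is bounded by
  the first return to \<open>0\<close>, so the limit conditional on \<open>\<Omega>\<^sup>*\<close> follows; it is the Laplace transform
  \<open>1 / (1 + s powr (1 / \<beta>))\<close> of \<open>E powr \<beta> * Gs\<close>, up to scaling. Convergence of these transforms at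
  integers \<open>s\<close> is convergence of the moments of \<open>exp (- \<tau> / n)\<close>, which determine the limit law.
\<close>

text \<open>The uniform start closes the renewal identity: integrated over the start, the last-visit
  decomposition carries Lebesgue measure, and translation invariance turns the position at the last
  visit into the integration variable, so the averaged survival probability reappears. The obstacle
  is that the weights mix two regimes whose border moves with \<epsilon>. The border is put at
  \<epsilon> * k^2 = 1. Below it a concentration bound of order \<epsilon> + \<rho>^k, hence 1 / k^2
  + \<rho>^k, is a summable majorant; above it the local limit theorem has to hold for windows as
  short as 1 / k^2. Regular variation of \<open>A\<close> is not an assumption: it is read off from
  - ln (cmod (char D t)), whose behaviour on the scale 1 / A k is dictated by the limit law. The
  level t is put into the time scale n, so that the event always reads exp (- \<tau> / n) \<ge> exp
  (- 1) for a variable in [0, 1]; its moments are generating functions, which takes the place of a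
  Tauberian argument for q.\<close>

section \<open>Moment convergence on the unit interval\<close>

text \<open>All laws live on one compact interval, where polynomials are uniformly dense, so moments
  control every continuous test function. It will serve for the laws of exp (- \<tau> / n), whose
  k-th moment is a Laplace transform at k / n.\<close>

lemma moments_imp_weak_conv:
  fixes \<mu> :: "nat \<Rightarrow> real measure"
  assumes \<mu>: "\<And>n. real_distribution (\<mu> n)" and M: "real_distribution M"
    and supp: "\<And>n. AE x in \<mu> n. x \<in> {0..1}" "AE x in M. x \<in> {0..1}"
    and moments: "\<And>k. (\<lambda>n. \<integral>x. x ^ k \<partial>\<mu> n) \<longlonglongrightarrow> (\<integral>x. x ^ k \<partial>M)"
  shows "weak_conv_m \<mu> M"
proof (rule integral_bdd_continuous_conv_imp_weak_conv[OF \<mu> M])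
  fix f :: "real \<Rightarrow> real"
  assume cont: "\<And>x. isCont f x" and bdd: "\<And>x. \<bar>f x\<bar> \<le> 1"
  have cf: "continuous_on UNIV f" using cont by (simp add: continuous_at_imp_continuous_on)
  have [measurable]: "f \<in> borel_measurable borel" using cf by (rule borel_measurable_continuous_onI)
  show "(\<lambda>n. integral\<^sup>L (\<mu> n) f) \<longlonglongrightarrow> integral\<^sup>L M f"
  proof (rule LIMSEQ_I)
    fix e :: real assume e: "0 < e"
    obtain p where p: "real_polynomial_function p" "\<And>x. x \<in> {0..1} \<Longrightarrow> \<bar>f x - p x\<bar> < e / 3"
      using Stone_Weierstrass_real_polynomial_function[of "{0..1::real}" f "e / 3"] e cf
      by (auto intro: continuous_on_subset)
    obtain a m where pa: "p = (\<lambda>x. \<Sum>i\<le>m. a i * x ^ i)"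
      using p(1) real_polynomial_function_iff_sum by blast
    have close: "\<bar>integral\<^sup>L N f - integral\<^sup>L N p\<bar> \<le> e / 3"
      and poly: "integral\<^sup>L N p = (\<Sum>i\<le>m. a i * (\<integral>x. x ^ i \<partial>N))"
      if N: "real_distribution N" and s: "AE x in N. x \<in> {0..1}" for N
    proof -
      interpret real_distribution N by (rule N)
      have int_pow: "integrable N (\<lambda>x. x ^ i)" for i :: nat
      proof (rule integrable_const_bound[where B=1])
        show "AE x in N. norm (x ^ i) \<le> 1" using s by eventually_elim (auto simp: power_le_one)
      qed simp
      then have int_p: "integrable N p" unfolding pa by (intro Bochner_Integration.integrable_sum integrable_mult_right)
      have int_f: "integrable N f" by (rule integrable_const_bound[where B=1]) (use bdd in auto)
      show "integral\<^sup>L N p = (\<Sum>i\<le>m. a i * (\<integral>x. x ^ i \<partial>N))"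
        unfolding pa using int_pow by (subst Bochner_Integration.integral_sum) auto
      have "integral\<^sup>L N f - integral\<^sup>L N p = (\<integral>x. f x - p x \<partial>N)" using int_f int_p by simp
      moreover have "\<bar>\<integral>x. f x - p x \<partial>N\<bar> \<le> (\<integral>x. \<bar>f x - p x\<bar> \<partial>N)" by (rule integral_abs_bound)
      moreover have "\<dots> \<le> (\<integral>x. e / 3 \<partial>N)"
      proof (rule integral_mono_AE)
        show "AE x in N. \<bar>f x - p x\<bar> \<le> e / 3" using s by eventually_elim (use p(2) in \<open>auto intro: less_imp_le\<close>)
      qed (use int_f int_p in auto)
      moreover have "(\<integral>x. e / 3 \<partial>N) = e / 3" using prob_space by simp
      ultimately show "\<bar>integral\<^sup>L N f - integral\<^sup>L N p\<bar> \<le> e / 3" by linarith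
    qed
    have "(\<lambda>n. \<Sum>i\<le>m. a i * (\<integral>x. x ^ i \<partial>\<mu> n)) \<longlonglongrightarrow> (\<Sum>i\<le>m. a i * (\<integral>x. x ^ i \<partial>M))"
      by (intro tendsto_intros moments)
    then have "(\<lambda>n. integral\<^sup>L (\<mu> n) p) \<longlonglongrightarrow> integral\<^sup>L M p"
      using poly[OF \<mu> supp(1)] poly[OF M supp(2)] by simp
    then obtain n0 where n0: "\<And>n. n0 \<le> n \<Longrightarrow> \<bar>integral\<^sup>L (\<mu> n) p - integral\<^sup>L M p\<bar> < e / 3"
      using LIMSEQ_D[of _ _ "e / 3"] e by fastforce
    have "norm (integral\<^sup>L (\<mu> n) f - integral\<^sup>L M f) < e" if "n0 \<le> n" for n
      using n0[OF that] close[OF \<mu> supp(1), of n] close[OF M supp(2)] unfolding real_norm_def by linarith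
    then show "\<exists>no. \<forall>n\<ge>no. norm (integral\<^sup>L (\<mu> n) f - integral\<^sup>L M f) < e" by blast
  qed
qed

section \<open>Regular variation of the norming sequence\<close>

text \<open>Splits off a power of two so that the remaining factor of r lies in [1, 2]: the power is
  handled by iterated doubling, the factor by a limit uniform on compact sets.\<close>

lemma dyadic_floor:
  fixes r :: real
  assumes "1 \<le> r"
  obtains i :: nat where "2 ^ i \<le> r" "r < 2 * 2 ^ i"
proof (rule that[of "nat \<lfloor>log 2 r\<rfloor>"])
  define i where "i = nat \<lfloor>log 2 r\<rfloor>"
  have i: "real i \<le> log 2 r" "log 2 r < real i + 1" using assms by (auto simp: i_def)
  have "2 powr real i \<le> 2 powr log 2 r" "2 powr log 2 r < 2 powr (real i + 1)" using i by simp_all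
  then have "2 ^ i \<le> r" "r < 2 * 2 ^ i" using assms by (simp_all add: powr_realpow powr_add)
  then show "2 ^ nat \<lfloor>log 2 r\<rfloor> \<le> r" "r < 2 * 2 ^ nat \<lfloor>log 2 r\<rfloor>" by (simp_all only: i_def)
qed

text \<open>\<psi> will be - ln (cmod (char D t)). \<open>scaling\<close> ties it to the norming
  sequence for v in compact sets, and this makes \<open>A\<close> regularly varying of index 1 /
  \<alpha>.\<close>

locale regular_scale =
  fixes \<psi> :: "real \<Rightarrow> real" and A :: "nat \<Rightarrow> real" and c \<alpha> :: real
  assumes A_pos: "\<And>n. 1 \<le> n \<Longrightarrow> 0 < A n"
    and c_pos: "0 < c"
    and alpha: "1 < \<alpha>"
    and scaling: "\<And>V. 0 < V \<Longrightarrow>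
        uniform_limit {0..V} (\<lambda>k v. real k * \<psi> (v / A k)) (\<lambda>v. c * v powr \<alpha>) sequentially"
    and A_top: "filterlim A at_top sequentially"
begin

lemma scaling_eventually:
  assumes "0 < V" "0 < e"
  shows "\<forall>\<^sub>F k in sequentially. \<forall>v\<in>{0..V}. \<bar>real k * \<psi> (v / A k) - c * v powr \<alpha>\<bar> < e"
  using scaling[OF assms(1)] assms(2) unfolding uniform_limit_iff dist_real_def by blast

text \<open>A jump by more than a factor 2 would give the number \<psi> (1 / A (Suc k)) two
  incompatible sizes: about c / k on the scale of Suc k, but at most about c (1/2)^\<alpha> / k on
  the scale of k.\<close>

lemma eventually_A_Suc_le: "\<forall>\<^sub>F k in sequentially. A (Suc k) \<le> 2 * A k"
proof -
  \<comment> \<open>The gap between c and c (1/2)^\<alpha> is 4 e; the two limits and the factor k /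
    Suc k together spend only 3 e.\<close>
  define e where "e = c * (1 - (1/2) powr \<alpha>) / 4"
  have half: "(1/2) powr \<alpha> < 1" using powr_less_mono2[of \<alpha> "1/2" 1] alpha by simp
  have e: "0 < e" using c_pos half by (simp add: e_def)
  have e_eq: "c * (1/2) powr \<alpha> = c - 4 * e" by (simp add: e_def right_diff_distrib diff_divide_distrib)
  have "(\<lambda>k. c / real (Suc k)) \<longlonglongrightarrow> 0" by real_asymp
  then have ev0: "\<forall>\<^sub>F k in sequentially. c / real (Suc k) < e"
    using e by (rule order_tendstoD)
  have ev1: "\<forall>\<^sub>F k in sequentially. \<forall>v\<in>{0..1}. \<bar>real k * \<psi> (v / A k) - c * v powr \<alpha>\<bar> < e"
    by (rule scaling_eventually) (use e in auto)
  have ev2: "\<forall>\<^sub>F k in sequentially. \<forall>v\<in>{0..1}. \<bar>real (Suc k) * \<psi> (v / A (Suc k)) - c * v powr \<alpha>\<bar> < e"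
    using ev1 by (subst eventually_sequentially_Suc)
  show ?thesis
    using ev0 ev1 ev2 eventually_ge_at_top[of 1]
  proof eventually_elim
    case (elim k)
    show ?case
    proof (rule ccontr)
      assume "\<not> ?thesis"
      then have lt: "2 * A k < A (Suc k)" by simp
      define r where "r = A k / A (Suc k)"
      have pos: "0 < A k" "0 < A (Suc k)" using A_pos elim by auto
      have r: "0 < r" "r < 1/2" using lt pos by (auto simp: r_def field_simps)
      have "r / A k = 1 / A (Suc k)" using pos by (simp add: r_def)
      then have *: "\<bar>real k * \<psi> (1 / A (Suc k)) - c * r powr \<alpha>\<bar> < e"
        using elim(2)[rule_format, of r] r by auto
      have **: "\<bar>real (Suc k) * \<psi> (1 / A (Suc k)) - c\<bar> < e"
        using elim(3)[rule_format, of 1] by auto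
      have "r powr \<alpha> \<le> (1/2) powr \<alpha>" using r alpha by (intro powr_mono2) auto
      then have "c * r powr \<alpha> \<le> c * (1/2) powr \<alpha>" using c_pos by simp
      then have 1: "real k * \<psi> (1 / A (Suc k)) < c - 3 * e"
        using * e_eq by linarith
      have "c - e < real (Suc k) * \<psi> (1 / A (Suc k))" using ** by linarith
      then have "(c - e) * (real k / real (Suc k)) \<le> real (Suc k) * \<psi> (1 / A (Suc k)) * (real k / real (Suc k))"
        by (intro mult_right_mono) auto
      also have "\<dots> = real k * \<psi> (1 / A (Suc k))" by (simp add: field_simps)
      finally have 2: "(c - e) * (real k / real (Suc k)) \<le> real k * \<psi> (1 / A (Suc k))" .
      have "(c - e) * (real k / real (Suc k)) = (c - e) - (c - e) / real (Suc k)"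
        by (simp add: field_simps)
      moreover have "(c - e) / real (Suc k) \<le> c / real (Suc k)"
        using e by (intro divide_right_mono) auto
      ultimately show False using 1 2 elim(1) e by linarith
    qed
  qed
qed

text \<open>\<psi> is asymptotically a power \<alpha>, and any smaller exponent a absorbs the error
  for small t. The first k with 1 / t \<le> A k has v = t * A k in [1, 2], since jumps of
  \<open>A\<close> are at most a factor 2; then the limits at v and at 2 v are compared.\<close>

lemma doubling:
  assumes "0 < a" "a < \<alpha>"
  obtains \<delta> where "0 < \<delta>" "\<And>t. 0 < t \<Longrightarrow> t \<le> \<delta> \<Longrightarrow> 2 powr a * \<psi> t \<le> \<psi> (2 * t)"
proof -
  \<comment> \<open>Solved so that the two errors, e at 2 v and 2^a e at v, use up exactly the
    surplus c (2^\<alpha> - 2^a) available at v = 1; larger v only helps.\<close>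
  define e where "e = c * (2 powr \<alpha> - 2 powr a) / (1 + 2 powr a)"
  have pw: "2 powr a < 2 powr \<alpha>" using assms by simp
  have e: "0 < e" using c_pos pw by (auto simp: e_def intro!: divide_pos_pos add_pos_pos)
  have e_eq: "c * (2 powr \<alpha> - 2 powr a) = e * (1 + 2 powr a)"
  proof -
    have "1 + 2 powr a \<noteq> 0" using powr_gt_zero[of 2 a] by linarith
    then show ?thesis by (simp add: e_def)
  qed
  have "\<forall>\<^sub>F k in sequentially. 1 \<le> k \<and> A (Suc k) \<le> 2 * A k \<and>
      (\<forall>v\<in>{0..4}. \<bar>real k * \<psi> (v / A k) - c * v powr \<alpha>\<bar> < e)"
    using eventually_ge_at_top[of 1] eventually_A_Suc_le scaling_eventually[of 4 e] e
    by (auto elim: eventually_elim2 intro!: eventually_conj)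
  then obtain K where K: "\<And>k. K \<le> k \<Longrightarrow> 1 \<le> k"
    "\<And>k. K \<le> k \<Longrightarrow> A (Suc k) \<le> 2 * A k"
    "\<And>k v. K \<le> k \<Longrightarrow> v \<in> {0..4} \<Longrightarrow> \<bar>real k * \<psi> (v / A k) - c * v powr \<alpha>\<bar> < e"
    unfolding eventually_sequentially by blast
  have AK: "0 < A K" using K(1)[of K] A_pos by auto
  show ?thesis
  \<comment> \<open>For such t one has A K < 1 / t, so the least k exceeds K and its predecessor is
    still in the range where jumps are controlled.\<close>
  proof (rule that[of "1 / (2 * A K)"])
    show "0 < 1 / (2 * A K)" using AK by simp
    fix t :: real assume t: "0 < t" "t \<le> 1 / (2 * A K)"
    have "\<forall>\<^sub>F k in sequentially. K \<le> k \<and> 1 / t \<le> A k"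
      using A_top eventually_ge_at_top[of K] by (auto simp: filterlim_at_top intro: eventually_conj)
    then obtain k' where k': "K \<le> k'" "1 / t \<le> A k'"
      by (auto simp: eventually_sequentially)
    define k where "k = (LEAST k. K \<le> k \<and> 1 / t \<le> A k)"
    have k: "K \<le> k" "1 / t \<le> A k"
      using LeastI[of "\<lambda>k. K \<le> k \<and> 1 / t \<le> A k" k'] k' by (auto simp: k_def)
    have "k \<noteq> K"
    proof
      assume "k = K"
      then have "1 / t \<le> A K" using k by simp
      moreover have "A K < 1 / t" using t AK by (simp add: field_simps)
      ultimately show False by simp
    qed
    then obtain j where j: "k = Suc j" "K \<le> j" using k(1) by (cases k) auto
    have "\<not> (K \<le> j \<and> 1 / t \<le> A j)"
      using not_less_Least[of j "\<lambda>k. K \<le> k \<and> 1 / t \<le> A k"] j by (auto simp: k_def)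
    then have "A j < 1 / t" using j by auto
    then have "A k \<le> 2 / t" using K(2)[OF j(2)] j by auto
    then have v: "1 \<le> t * A k" "t * A k \<le> 2" using k(2) t by (auto simp: field_simps)
    define v where "v = t * A k"
    have Ak: "0 < A k" "0 < real k" using A_pos K(1)[OF k(1)] by auto
    have tv: "t = v / A k" "2 * t = (2 * v) / A k" using Ak by (auto simp: v_def)
    have v1: "1 \<le> v" "v \<le> 2" using v by (auto simp: v_def)
    have 1: "real k * \<psi> t < c * v powr \<alpha> + e" using K(3)[OF k(1), of v] v1 unfolding tv(1)[symmetric] by auto
    have "c * (2 * v) powr \<alpha> - e < real k * \<psi> (2 * t)"
      using K(3)[OF k(1), of "2 * v"] v1 unfolding tv(2)[symmetric] by auto
    then have 2: "c * 2 powr \<alpha> * v powr \<alpha> - e < real k * \<psi> (2 * t)"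
      using v1 by (simp add: powr_mult mult.assoc)
    have "1 \<le> v powr \<alpha>" using v1 alpha by (simp add: ge_one_powr_ge_zero)
    then have "e * (1 + 2 powr a) * 1 \<le> c * (2 powr \<alpha> - 2 powr a) * v powr \<alpha>"
      unfolding e_eq using e by (intro mult_left_mono) auto
    then have "2 powr a * (c * v powr \<alpha> + e) \<le> c * 2 powr \<alpha> * v powr \<alpha> - e"
      by (simp add: algebra_simps)
    moreover have "2 powr a * (real k * \<psi> t) \<le> 2 powr a * (c * v powr \<alpha> + e)"
      using 1 by (intro mult_left_mono) auto
    ultimately have "real k * (2 powr a * \<psi> t) \<le> real k * \<psi> (2 * t)"
      using 2 unfolding mult.left_commute[of "real k"] by linarith
    then show "2 powr a * \<psi> t \<le> \<psi> (2 * t)" using Ak by simp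
  qed
qed

text \<open>The bound is 2 * \<delta> because only the starting point of the last doubling has to be
  at most \<delta>.\<close>

lemma doubling_iterate:
  assumes "\<And>t. 0 < t \<Longrightarrow> t \<le> \<delta> \<Longrightarrow> 2 powr a * \<psi> t \<le> \<psi> (2 * t)" "0 < t" "2 ^ i * t \<le> 2 * \<delta>"
  shows "2 powr (a * real i) * \<psi> t \<le> \<psi> (2 ^ i * t)"
  using assms(3)
proof (induction i)
  case (Suc i)
  have pos: "0 < 2 ^ i * t" using assms by simp
  have le: "2 ^ i * t \<le> \<delta>" using Suc.prems by simp
  have "2 powr (a * real (Suc i)) * \<psi> t = 2 powr a * (2 powr (a * real i) * \<psi> t)"
    by (simp add: powr_add algebra_simps)
  also have "\<dots> \<le> 2 powr a * \<psi> (2 ^ i * t)" using Suc.IH pos le by (intro mult_left_mono) auto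
  also have "\<dots> \<le> \<psi> (2 * (2 ^ i * t))" using pos le by (rule assms(1))
  finally show ?case by (simp add: mult.assoc)
qed simp

text \<open>A Potter bound. With A n / A k = v * 2^i, doubling i times from v / A n to 1 / A k
  yields 2^(a i) c / (2 n) \<le> \<psi> (1 / A k) < 2 c / k. Solving for 2^i gives the constant 4,
  and v \<le> 2 the outer factor 2.\<close>

lemma potter:
  assumes "0 < a" "a < \<alpha>"
  obtains k0 where "1 \<le> k0"
    "\<And>n k. k0 \<le> n \<Longrightarrow> k0 \<le> k \<Longrightarrow> A n / A k \<le> max 1 (2 * (4 * real n / real k) powr (1 / a))"
proof -
  obtain \<delta> where \<delta>: "0 < \<delta>" "\<And>t. 0 < t \<Longrightarrow> t \<le> \<delta> \<Longrightarrow> 2 powr a * \<psi> t \<le> \<psi> (2 * t)"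
    using doubling[OF assms] by blast
  have "\<forall>\<^sub>F k in sequentially. 1 \<le> k \<and> 1 / \<delta> \<le> A k \<and>
      (\<forall>v\<in>{0..2}. \<bar>real k * \<psi> (v / A k) - c * v powr \<alpha>\<bar> < c / 2)"
    using eventually_ge_at_top[of 1] A_top scaling_eventually[of 2 "c / 2"] c_pos
    by (auto simp: filterlim_at_top intro!: eventually_conj)
  then obtain K where K: "\<And>k. K \<le> k \<Longrightarrow> 1 \<le> k" "\<And>k. K \<le> k \<Longrightarrow> 1 / \<delta> \<le> A k"
    "\<And>k v. K \<le> k \<Longrightarrow> v \<in> {0..2} \<Longrightarrow> \<bar>real k * \<psi> (v / A k) - c * v powr \<alpha>\<bar> < c / 2"
    unfolding eventually_sequentially by blast
  show ?thesis
  proof (rule that[of K])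
    show "1 \<le> K" using K(1) by auto
    fix n k :: nat assume nk: "K \<le> n" "K \<le> k"
    define r where "r = A n / A k"
    have pos: "0 < A n" "0 < A k" "0 < real n" "0 < real k" using K(1) nk A_pos by fastforce+
    show "A n / A k \<le> max 1 (2 * (4 * real n / real k) powr (1 / a))"
    proof (cases "r \<le> 1")
      case True then show ?thesis by (simp add: r_def)
    next
      case False
      then obtain i where ri: "2 ^ i \<le> r" "r < 2 * 2 ^ i" using dyadic_floor[of r] by auto
      define v where "v = r / 2 ^ i"
      have v: "1 \<le> v" "v \<le> 2" using ri by (auto simp: v_def field_simps)
      have eq: "1 / A k = 2 ^ i * (v / A n)" using pos by (simp add: v_def r_def)
      have "1 / A k \<le> \<delta>" using K(2)[OF nk(2)] pos \<delta>(1) by (simp add: field_simps)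
      then have "2 powr (a * real i) * \<psi> (v / A n) \<le> \<psi> (1 / A k)"
        unfolding eq by (intro doubling_iterate[OF \<delta>(2)]) (use \<delta>(1) v pos in auto)
      moreover have "c * 1 - c / 2 < real n * \<psi> (v / A n)"
      proof -
        have "c * 1 \<le> c * v powr \<alpha>"
          using v alpha c_pos by (intro mult_left_mono) (auto simp: ge_one_powr_ge_zero)
        moreover have "\<bar>real n * \<psi> (v / A n) - c * v powr \<alpha>\<bar> < c / 2"
          using K(3)[OF nk(1), of v] v by simp
        ultimately show ?thesis by linarith
      qed
      then have "c / (2 * real n) \<le> \<psi> (v / A n)" using pos by (simp add: field_simps)
      then have "2 powr (a * real i) * (c / (2 * real n)) \<le> 2 powr (a * real i) * \<psi> (v / A n)"
        by (intro mult_left_mono) auto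
      moreover have "real k * \<psi> (1 / A k) < 2 * c"
      proof -
        have "\<bar>real k * \<psi> (1 / A k) - c\<bar> < c / 2" using K(3)[OF nk(2), of 1] by simp
        then show ?thesis using c_pos by linarith
      qed
      then have "\<psi> (1 / A k) < 2 * c / real k" using pos by (simp add: field_simps)
      ultimately have "2 powr (a * real i) * (c / (2 * real n)) < 2 * c / real k" by linarith
      then have "c * (2 powr (a * real i)) < c * (4 * real n / real k)" using pos by (simp add: field_simps)
      then have "2 powr (a * real i) < 4 * real n / real k"
        unfolding mult_less_cancel_left_pos[OF c_pos] .
      then have "(2 powr (a * real i)) powr (1 / a) \<le> (4 * real n / real k) powr (1 / a)"
        using assms by (intro powr_mono2) auto
      then have "2 ^ i \<le> (4 * real n / real k) powr (1 / a)"
        using assms by (simp add: powr_powr powr_realpow)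
      then show ?thesis using ri by (simp add: r_def)
    qed
  qed
qed

text \<open>The source of the integrable majorant for the Riemann sums below: x powr (- 1 / a) is
  integrable at 0 when 1 < a. The finitely many k below the Potter range are reached through A n / A
  k0 * (A k0 / A k), which costs the constant D.\<close>

lemma ratio_bound:
  assumes "0 < a" "a < \<alpha>"
  obtains C k0 where "0 < C" "1 \<le> k0"
    "\<And>n k. k0 \<le> n \<Longrightarrow> 1 \<le> k \<Longrightarrow> A n / A k \<le> C * (1 + (real n / real k) powr (1 / a))"
proof -
  obtain k0 where k0: "1 \<le> k0"
    "\<And>n k. k0 \<le> n \<Longrightarrow> k0 \<le> k \<Longrightarrow> A n / A k \<le> max 1 (2 * (4 * real n / real k) powr (1 / a))"
    using potter[OF assms] by blast
  define B where "B = 1 + 2 * 4 powr (1 / a)"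
  have B: "1 \<le> B" by (simp add: B_def)
  have base: "A n / A k \<le> B * (1 + (real n / real k) powr (1 / a))" if "k0 \<le> n" "k0 \<le> k" for n k :: nat
  proof -
    have "(4 * real n / real k) powr (1 / a) = 4 powr (1 / a) * (real n / real k) powr (1 / a)"
      by (subst powr_mult [symmetric]) auto
    moreover have "0 \<le> (real n / real k) powr (1 / a)" "0 \<le> 4 powr (1/a)" by auto
    ultimately have "max 1 (2 * (4 * real n / real k) powr (1 / a)) \<le> B * (1 + (real n / real k) powr (1 / a))"
      by (auto simp: B_def algebra_simps)
    then show ?thesis using k0(2)[OF that] by linarith
  qed
  define D where "D = 1 + (\<Sum>k=1..k0. A k0 / A k)"
  have D: "1 \<le> D" unfolding D_def using A_pos by (auto intro!: sum_nonneg simp: less_imp_le)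
  show ?thesis
  proof (rule that[of "B * D" k0])
    show "0 < B * D" using B D by simp
    fix n k :: nat assume nk: "k0 \<le> n" "1 \<le> k"
    have Ap: "0 < A n" "0 < A k" "0 < A k0" using nk k0 A_pos by auto
    show "A n / A k \<le> B * D * (1 + (real n / real k) powr (1 / a))"
    proof (cases "k0 \<le> k")
      case True
      have "B * (1 + (real n / real k) powr (1 / a)) \<le> B * D * (1 + (real n / real k) powr (1 / a))"
        using B D by (intro mult_right_mono) (auto simp: add_nonneg_nonneg)
      then show ?thesis using base[OF nk(1) True] by linarith
    next
      case False
      have "A k0 / A k \<le> (\<Sum>k=1..k0. A k0 / A k)"
        using False nk A_pos k0(1) by (intro member_le_sum) (auto simp: less_imp_le)
      then have 1: "A k0 / A k \<le> D" by (simp add: D_def)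
      have "A n / A k0 \<le> B * (1 + (real n / real k0) powr (1 / a))" using base[OF nk(1)] by simp
      also have "\<dots> \<le> B * (1 + (real n / real k) powr (1 / a))"
        using B False nk assms
        by (intro mult_left_mono add_left_mono powr_mono2 divide_left_mono) auto
      finally have 2: "A n / A k0 \<le> B * (1 + (real n / real k) powr (1 / a))" .
      have "A n / A k = (A n / A k0) * (A k0 / A k)" using Ap by simp
      also have "\<dots> \<le> (B * (1 + (real n / real k) powr (1 / a))) * D"
        using 1 2 Ap B by (intro mult_mono) (auto simp: add_nonneg_nonneg)
      finally show ?thesis by (simp add: mult_ac)
    qed
  qed (use k0 in auto)
qed

text \<open>The ratios r n stay in a compact set by \<open>ratio_bound\<close>, where the limit of n
  * \<psi> is uniform and may be evaluated at the moving point r n. As r n / A n = 1 / A (k n),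
  comparison with k n * \<psi> (1 / A (k n)), which tends to c, forces r n powr \<alpha> to tend to
  1 / x.\<close>

lemma ratio_tendsto:
  assumes lim: "(\<lambda>n. real (k n) / real n) \<longlonglongrightarrow> x" and x: "0 < x"
  shows "(\<lambda>n. A n / A (k n)) \<longlonglongrightarrow> x powr (- 1 / \<alpha>)"
proof -
  obtain C k0 where C: "0 < C" "1 \<le> k0"
    "\<And>n k. k0 \<le> n \<Longrightarrow> 1 \<le> k \<Longrightarrow> A n / A k \<le> C * (1 + (real n / real k) powr (1 / 1))"
    using ratio_bound[of 1] alpha by auto
  define V where "V = C * (1 + 2 / x)"
  have V: "0 < V" using C x by (simp add: V_def add_pos_pos)
  have ev: "\<forall>\<^sub>F n in sequentially. x / 2 < real (k n) / real n"
    using lim x by (intro order_tendstoD) auto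
  have ktop: "filterlim k at_top sequentially"
  proof -
    have "filterlim (\<lambda>n. x / 2 * real n) at_top sequentially" using x by real_asymp
    moreover have "\<forall>\<^sub>F n in sequentially. x / 2 * real n \<le> real (k n)"
      using ev eventually_gt_at_top[of 0] by eventually_elim (simp add: field_simps)
    ultimately have "filterlim (\<lambda>n. real (k n)) at_top sequentially"
      by (rule filterlim_at_top_mono)
    then show ?thesis by (simp add: filterlim_real_sequentially filterlim_at_top_imp_at_infinity filterlim_sequentially_iff_filterlim_real)
  qed
  define r where "r n = A n / A (k n)" for n
  have rV: "\<forall>\<^sub>F n in sequentially. r n \<in> {0..V} \<and> 0 < r n \<and> r n / A n = 1 / A (k n)"
    using ev eventually_ge_at_top[of k0]
  proof eventually_elim
    case (elim n)
    have n: "1 \<le> n" using elim C by auto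
    have "0 < real (k n) / real n" using elim(1) x by linarith
    then have kp: "1 \<le> k n" using n by (auto simp: zero_less_divide_iff)
    have pos: "0 < A n" "0 < A (k n)" using A_pos n kp by auto
    have "real n / real (k n) \<le> 2 / x" using elim(1) n kp x by (simp add: field_simps)
    then have "C * (1 + (real n / real (k n)) powr (1 / 1)) \<le> V"
      unfolding V_def using C by (intro mult_left_mono) auto
    then have "r n \<le> V" using C(3)[of n "k n"] elim kp by (auto simp: r_def)
    then show ?case using pos by (auto simp: r_def)
  qed
  have A1: "(\<lambda>n. real n * \<psi> (r n / A n) - c * r n powr \<alpha>) \<longlonglongrightarrow> 0"
  proof (rule tendstoI)
    fix e :: real assume "0 < e"
    show "\<forall>\<^sub>F n in sequentially. dist (real n * \<psi> (r n / A n) - c * r n powr \<alpha>) 0 < e"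
      using scaling_eventually[OF V \<open>0 < e\<close>] rV
    proof eventually_elim
      case (elim n)
      then show ?case unfolding dist_real_def diff_0_right by blast
    qed
  qed
  have "(\<lambda>j. real j * \<psi> (1 / A j)) \<longlonglongrightarrow> c * 1 powr \<alpha>"
    using tendsto_uniform_limitI[OF scaling[of 1], of 1] by simp
  then have "(\<lambda>n. real (k n) * \<psi> (1 / A (k n))) \<longlonglongrightarrow> c"
    using ktop by (auto dest: filterlim_compose)
  then have "(\<lambda>n. real (k n) * \<psi> (1 / A (k n)) / (real (k n) / real n)) \<longlonglongrightarrow> c / x"
    using lim x by (intro tendsto_divide) auto
  moreover have "\<forall>\<^sub>F n in sequentially. real (k n) * \<psi> (1 / A (k n)) / (real (k n) / real n) = real n * \<psi> (r n / A n)"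
    using rV ev eventually_gt_at_top[of 0]
  proof eventually_elim
    case (elim n)
    have "0 < real (k n) / real n" using elim(2) x by linarith
    then have "0 < real (k n)" using elim by (auto simp: zero_less_divide_iff)
    then show ?case using elim by auto
  qed
  ultimately have "(\<lambda>n. real n * \<psi> (r n / A n)) \<longlonglongrightarrow> c / x"
    by (simp add: tendsto_cong)
  from tendsto_diff[OF this A1] have "(\<lambda>n. c * r n powr \<alpha>) \<longlonglongrightarrow> c / x" by simp
  then have "(\<lambda>n. (c * r n powr \<alpha>) / c) \<longlonglongrightarrow> (c / x) / c" using c_pos by (intro tendsto_divide) auto
  then have "(\<lambda>n. r n powr \<alpha>) \<longlonglongrightarrow> 1 / x" using c_pos by simp
  then have "(\<lambda>n. (r n powr \<alpha>) powr (1 / \<alpha>)) \<longlonglongrightarrow> (1 / x) powr (1 / \<alpha>)"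
    using x by (intro tendsto_powr) auto
  moreover have "\<forall>\<^sub>F n in sequentially. (r n powr \<alpha>) powr (1 / \<alpha>) = r n"
    using rV by eventually_elim (use alpha in \<open>auto simp: powr_powr\<close>)
  ultimately have "r \<longlonglongrightarrow> (1 / x) powr (1 / \<alpha>)" by (simp add: tendsto_cong)
  moreover have "(1 / x) powr (1 / \<alpha>) = x powr (- 1 / \<alpha>)"
    using x powr_divide[of 1 x "1/\<alpha>"] by (simp add: powr_minus divide_inverse)
  ultimately show ?thesis by (simp add: r_def[abs_def])
qed

end

section \<open>Karamata-type limits\<close>

lemma has_bochner_integral_Gamma_scaled:
  fixes p s :: real
  assumes "0 < p" "0 < s"
  shows "has_bochner_integral lborel (\<lambda>x. indicator {0<..} x * (exp (- s * x) * x powr (p - 1))) (Gamma p * s powr (- p))"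
proof -
  have "has_bochner_integral lborel (\<lambda>t. indicator {0..} t * t powr (p - 1) / exp t) (Gamma p)"
    using Gamma_conv_nn_integral_real[OF assms(1)] Gamma_real_pos[OF assms(1)]
    by (intro has_bochner_integral_nn_integral) auto
  then have "has_bochner_integral lborel (\<lambda>x. indicator {0..} (s * x) * (s * x) powr (p - 1) / exp (s * x)) (Gamma p / s)"
    using lborel_has_bochner_integral_real_affine_iff[of s "\<lambda>t. indicator {0..} t * t powr (p - 1) / exp t" "Gamma p" 0] assms
    by (simp add: divide_inverse mult.commute)
  then have "has_bochner_integral lborel (\<lambda>x. s powr (1 - p) * (indicator {0..} (s * x) * (s * x) powr (p - 1) / exp (s * x))) (s powr (1 - p) * (Gamma p / s))"
    by (intro has_bochner_integral_mult_right) auto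
  moreover have "s powr (1 - p) * (indicator {0..} (s * x) * (s * x) powr (p - 1) / exp (s * x))
     = indicator {0<..} x * (exp (- s * x) * x powr (p - 1))" for x
  proof (cases "0 < x")
    case True
    have "s powr (1 - p) * s powr (p - 1) = 1" using assms by (simp add: powr_add[symmetric])
    then show ?thesis using True assms
      by (simp add: powr_mult exp_minus divide_inverse mult.assoc[symmetric])
  next
    case False
    \<comment> \<open>At x = 0 the two indicators differ, but 0 powr (p - 1) = 0 for every
      p.\<close>
    then show ?thesis using assms by (cases "x = 0") (auto simp: indicator_def zero_le_mult_iff)
  qed
  moreover have "s powr (1 - p) * (Gamma p / s) = Gamma p * s powr (- p)"
    using assms by (simp add: powr_diff powr_minus field_simps)
  ultimately show ?thesis by simp
qed

lemma has_bochner_integral_powr_unit: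
  fixes p :: real
  assumes "0 < p"
  shows "has_bochner_integral lborel (\<lambda>x. indicator {0<..} x * (indicator {..1} x * x powr (p - 1))) (1 / p)"
proof -
  have "((\<lambda>x. x powr (p - 1)) has_integral 1 / p) {0..1}"
    using has_integral_powr_from_0[of "p - 1" 1] assms by simp
  then have "(\<integral>\<^sup>+x. ennreal (indicator {0..1} x * x powr (p - 1)) \<partial>lborel) = ennreal (1 / p)"
    using assms by (intro nn_integral_has_integral_lebesgue) auto
  moreover have "indicator {0..1} x * x powr (p - 1) = indicator {0<..} x * (indicator {..1} x * x powr (p - 1))" for x :: real
    by (auto simp: indicator_def)
  ultimately show ?thesis using assms
    by (intro has_bochner_integral_nn_integral) auto
qed

text \<open>A series is the integral of its step function, constant on the cells (i / n, (i + 1) /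
  n]; limits of weighted sums can then be taken by dominated convergence.\<close>

lemma integral_ceiling_step:
  fixes b :: "nat \<Rightarrow> real" and n :: nat
  assumes "0 < n" "summable (\<lambda>i. \<bar>b (Suc i)\<bar>)"
  shows "(\<integral>x. indicator {0<..} x * b (nat \<lceil>real n * x\<rceil>) \<partial>lborel) = (\<Sum>i. b (Suc i)) / real n"
proof -
  define f where "f i x = b (Suc i) * indicator {real i / real n<..real (Suc i) / real n} x" for i x
  have f_eq: "(\<lambda>i. f i x) sums (indicator {0<..} x * b (nat \<lceil>real n * x\<rceil>))"
    and abs_sums: "summable (\<lambda>i. norm (f i x))" for x
  proof -
    define k where "k = nat \<lceil>real n * x\<rceil>"
    have iff: "x \<in> {real i / real n<..real (Suc i) / real n} \<longleftrightarrow> 0 < x \<and> k = Suc i" for i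
    proof -
      have "x \<in> {real i / real n<..real (Suc i) / real n} \<longleftrightarrow> real i < real n * x \<and> real n * x \<le> real (Suc i)"
        using assms(1) by (auto simp: field_simps)
      also have "\<dots> \<longleftrightarrow> \<lceil>real n * x\<rceil> = int (Suc i)"
        by (subst ceiling_eq_iff) auto
      also have "\<dots> \<longleftrightarrow> 0 < x \<and> k = Suc i"
      proof
        assume a: "\<lceil>real n * x\<rceil> = int (Suc i)"
        then have "0 < \<lceil>real n * x\<rceil>" by simp
        then have "0 < x" using assms(1) by (simp add: zero_less_mult_iff)
        then show "0 < x \<and> k = Suc i" using a by (simp add: k_def)
      qed (auto simp: k_def)
      finally show ?thesis .
    qed
    have z: "f i x = 0" if "i \<notin> {k - 1}" for i using that iff[of i] by (auto simp: f_def)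
    have "(\<lambda>i. f i x) sums (\<Sum>i\<in>{k - 1}. f i x)" by (rule sums_finite) (use z in auto)
    \<comment> \<open>For x \<le> 0 one has k = 0 and the truncated k - 1 is again 0; the cell of
      index 0 does not contain x, and both sides vanish.\<close>
    moreover have "f (k - 1) x = indicator {0<..} x * b k"
    proof (cases "0 < x")
      case True
      then have "0 < real n * x" using assms(1) by simp
      then have "0 < k" by (simp add: k_def)
      then show ?thesis using True iff[of "k - 1"] by (simp add: f_def)
    next
      case False then show ?thesis using iff[of "k - 1"] by (simp add: f_def)
    qed
    ultimately show "(\<lambda>i. f i x) sums (indicator {0<..} x * b (nat \<lceil>real n * x\<rceil>))" by (simp add: k_def)
    show "summable (\<lambda>i. norm (f i x))" by (rule summable_finite[of "{k - 1}"]) (use z in auto)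
  qed
  have int: "integrable lborel (f i)" "(\<integral>x. f i x \<partial>lborel) = b (Suc i) / real n"
     "(\<integral>x. norm (f i x) \<partial>lborel) = \<bar>b (Suc i)\<bar> / real n" for i
    using assms(1) by (auto simp: f_def[abs_def] abs_mult integrable_real_mult_indicator measure_lborel_Ioc divide_right_mono
        diff_divide_distrib[symmetric])
  have "(\<integral>x. (\<Sum>i. f i x) \<partial>lborel) = (\<Sum>i. \<integral>x. f i x \<partial>lborel)"
    by (rule integral_suminf) (use int abs_sums assms in \<open>auto intro: summable_divide\<close>)
  also have "\<dots> = (\<Sum>i. b (Suc i)) / real n"
    unfolding int using suminf_divide[OF summable_rabs_cancel[OF assms(2)], of "real n"] by simp
  finally show ?thesis using f_eq by (simp add: sums_iff)
qed

section \<open>Abelian and Karamata asymptotics for the sequence 1 / A k\<close>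

context regular_scale
begin

text \<open>Karamata's argument as dominated convergence: the ratios A n / A k tend to x powr (- 1 /
  \<alpha>) under the majorant of \<open>ratio_bound\<close>, and w at the right end of a cell is at
  most w x by monotonicity. Continuity is asked off 1 only, so that both exp (- s x) and the
  indicator of {..1} are admissible weights.\<close>

lemma riemann_sum_tendsto:
  assumes a: "0 < a" "a < \<alpha>"
    and w_meas [measurable]: "w \<in> borel_measurable borel"
    and w_nonneg: "\<And>x. 0 \<le> w x"
    and w_mono: "\<And>x y. 0 < x \<Longrightarrow> x \<le> y \<Longrightarrow> w y \<le> w x"
    and w_cont: "\<And>x. 0 < x \<Longrightarrow> x \<noteq> 1 \<Longrightarrow> isCont w x"
    and w_int: "integrable lborel (\<lambda>x. indicator {0<..} x * (w x * (1 + x powr (- 1 / a))))"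
    and w_sum: "\<And>n. 0 < n \<Longrightarrow> summable (\<lambda>i. w (real (Suc i) / real n) / A (Suc i))"
  shows "(\<lambda>n. A n / real n * (\<Sum>i. w (real (Suc i) / real n) / A (Suc i)))
     \<longlonglongrightarrow> (\<integral>x. indicator {0<..} x * (w x * x powr (- 1 / \<alpha>)) \<partial>lborel)"
proof -
  obtain C k0 where C: "0 < C" "1 \<le> k0"
    "\<And>n k. k0 \<le> n \<Longrightarrow> 1 \<le> k \<Longrightarrow> A n / A k \<le> C * (1 + (real n / real k) powr (1 / a))"
    using ratio_bound[OF a] by blast
  define k where "k n x = nat \<lceil>real n * x\<rceil>" for n :: nat and x :: real
  define F where "F n x = indicator {0<..} x * (A n / A (k n x) * w (real (k n x) / real n))" for n x
  have [measurable]: "(\<lambda>x. k n x) \<in> measurable borel (count_space UNIV)" for n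
    unfolding k_def by measurable
  have [measurable]: "F n \<in> borel_measurable borel" for n
    unfolding F_def by measurable
  have kpos: "1 \<le> k n x" "x \<le> real (k n x) / real n" "real n / real (k n x) \<le> 1 / x" if "0 < x" "0 < n" for n x
  proof -
    have "0 < real n * x" using that by simp
    then show k1: "1 \<le> k n x" unfolding k_def by linarith
    have "real n * x \<le> real (k n x)" unfolding k_def by (rule of_nat_ceiling)
    then show "x \<le> real (k n x) / real n" "real n / real (k n x) \<le> 1 / x"
      using that k1 by (auto simp: field_simps)
  qed
  have int_eq: "(\<integral>x. F n x \<partial>lborel) = A n / real n * (\<Sum>i. w (real (Suc i) / real n) / A (Suc i))" if "0 < n" for n
  proof -
    define b where "b j = A n / A j * w (real j / real n)" for j
    have b_eq: "(\<lambda>i. b (Suc i)) = (\<lambda>i. A n * (w (real (Suc i) / real n) / A (Suc i)))"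
      by (auto simp: b_def)
    have "b (Suc i) \<ge> 0" for i using w_nonneg A_pos[of n] A_pos[of "Suc i"] that by (auto simp: b_def less_imp_le)
    then have "(\<lambda>i. \<bar>b (Suc i)\<bar>) = (\<lambda>i. b (Suc i))" by auto
    then have "summable (\<lambda>i. \<bar>b (Suc i)\<bar>)"
      using summable_mult[OF w_sum[OF that], of "A n"] by (simp only: b_eq)
    from integral_ceiling_step[OF that this] show ?thesis
      using suminf_mult[OF w_sum[OF that], of "A n"] by (simp add: F_def k_def b_def[abs_def])
  qed
  \<comment> \<open>The shift by k0 starts the sequence where \<open>ratio_bound\<close> applies,
    and makes n + k0 positive.\<close>
  have "(\<lambda>n. \<integral>x. F (n + k0) x \<partial>lborel) \<longlonglongrightarrow> (\<integral>x. indicator {0<..} x * (w x * x powr (- 1 / \<alpha>)) \<partial>lborel)"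
  proof (rule integral_dominated_convergence[where w = "\<lambda>x. C * (indicator {0<..} x * (w x * (1 + x powr (- 1 / a))))"])
    show "integrable lborel (\<lambda>x. C * (indicator {0<..} x * (w x * (1 + x powr (- 1 / a)))))"
      using w_int by (rule integrable_mult_right)
    show "AE x in lborel. (\<lambda>n. F (n + k0) x) \<longlonglongrightarrow> indicator {0<..} x * (w x * x powr (- 1 / \<alpha>))"
      using AE_lborel_singleton[of 1]
    proof eventually_elim
      case (elim x)
      show ?case
      proof (cases "0 < x")
        case True
        have "(\<lambda>n. real_of_int \<lceil>real n * x\<rceil> / real n) \<longlonglongrightarrow> x" by real_asymp
        moreover have "real_of_int \<lceil>real n * x\<rceil> = real (k n x)" for n
          using True by (simp add: k_def)
        ultimately have kx: "(\<lambda>n. real (k n x) / real n) \<longlonglongrightarrow> x" by simp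
        have "(\<lambda>n. A n / A (k n x) * w (real (k n x) / real n)) \<longlonglongrightarrow> x powr (- 1 / \<alpha>) * w x"
          using ratio_tendsto[OF kx True] isCont_tendsto_compose[OF w_cont[OF True elim] kx]
          by (intro tendsto_mult)
        then have "(\<lambda>n. F n x) \<longlonglongrightarrow> indicator {0<..} x * (w x * x powr (- 1 / \<alpha>))"
          using True by (simp add: F_def mult.commute)
        then show ?thesis by (rule LIMSEQ_ignore_initial_segment)
      next
        case False then show ?thesis by (simp add: F_def)
      qed
    qed
    show "AE x in lborel. norm (F (n + k0) x) \<le> C * (indicator {0<..} x * (w x * (1 + x powr (- 1 / a))))" for n
    proof (intro AE_I2)
      fix x :: real
      define m where "m = n + k0"
      have m: "0 < m" "k0 \<le> m" using C by (auto simp: m_def)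
      show "norm (F (n + k0) x) \<le> C * (indicator {0<..} x * (w x * (1 + x powr (- 1 / a))))"
      proof (cases "0 < x")
        case True
        note kp = kpos[OF True m(1)]
        have "(real m / real (k m x)) powr (1 / a) \<le> (1 / x) powr (1 / a)"
          using kp a by (intro powr_mono2) auto
        also have "(1 / x) powr (1 / a) = x powr (- 1 / a)"
          using True powr_divide[of 1 x "1/a"] by (simp add: powr_minus divide_inverse)
        finally have "C * (1 + (real m / real (k m x)) powr (1 / a)) \<le> C * (1 + x powr (- 1 / a))"
          using C by (intro mult_left_mono) auto
        then have 1: "A m / A (k m x) \<le> C * (1 + x powr (- 1 / a))"
          using C(3)[OF m(2) kp(1)] by linarith
        have 2: "w (real (k m x) / real m) \<le> w x" using True kp by (intro w_mono) auto
        have pos: "0 < A m" "0 < A (k m x)" using A_pos[of m] A_pos[of "k m x"] m kp by auto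
        have "A m / A (k m x) * w (real (k m x) / real m) \<le> C * (1 + x powr (- 1 / a)) * w x"
          using 1 2 pos w_nonneg C by (intro mult_mono) (auto simp: add_nonneg_nonneg)
        then show ?thesis using True pos w_nonneg by (simp add: F_def m_def[symmetric] abs_mult mult_ac)
      next
        case False then show ?thesis by (simp add: F_def)
      qed
    qed
  qed (measurable)
  then have "(\<lambda>n. \<integral>x. F n x \<partial>lborel) \<longlonglongrightarrow> (\<integral>x. indicator {0<..} x * (w x * x powr (- 1 / \<alpha>)) \<partial>lborel)"
    by (rule LIMSEQ_offset)
  moreover have "\<forall>\<^sub>F n in sequentially. (\<integral>x. F n x \<partial>lborel) = A n / real n * (\<Sum>i. w (real (Suc i) / real n) / A (Suc i))"
    using eventually_gt_at_top[of 0] by eventually_elim (rule int_eq)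
  ultimately show ?thesis by (simp add: tendsto_cong)
qed

lemma inverse_A_bounded: obtains B where "0 < B" "\<And>k. 1 \<le> k \<Longrightarrow> 1 / A k \<le> B"
proof -
  have "\<forall>\<^sub>F k in sequentially. 1 \<le> A k" using A_top by (simp add: filterlim_at_top)
  then obtain K where K: "\<And>k. K \<le> k \<Longrightarrow> 1 \<le> A k" by (auto simp: eventually_sequentially)
  define B where "B = 1 + (\<Sum>k=1..K. 1 / A k)"
  have nn: "0 \<le> (\<Sum>k=1..K. 1 / A k)" using A_pos by (intro sum_nonneg) (auto simp: less_imp_le)
  have "1 / A k \<le> B" if "1 \<le> k" for k
  proof (cases "k \<le> K")
    case True
    have "1 / A k \<le> (\<Sum>k=1..K. 1 / A k)" using True that A_pos by (intro member_le_sum) (auto simp: less_imp_le)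
    then show ?thesis by (simp add: B_def)
  next
    case False
    then have "1 / A k \<le> 1" using K[of k] by auto
    then show ?thesis using nn by (simp add: B_def)
  qed
  moreover have "0 < B" using nn by (simp add: B_def)
  ultimately show ?thesis using that by blast
qed

lemma summable_power_div_A:
  assumes "0 \<le> z" "z < 1"
  shows "summable (\<lambda>k. z ^ Suc k / A (Suc k))"
proof -
  obtain B where B: "0 < B" "\<And>k. 1 \<le> k \<Longrightarrow> 1 / A k \<le> B" using inverse_A_bounded by blast
  show ?thesis
  proof (rule summable_comparison_test_ev)
    show "summable (\<lambda>k. B * z ^ Suc k)"
      using assms by (intro summable_mult) (simp add: summable_geometric)
    show "\<forall>\<^sub>F k in sequentially. norm (z ^ Suc k / A (Suc k)) \<le> B * z ^ Suc k"
    proof (intro always_eventually allI)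
      fix k
      have "1 / A (Suc k) * z ^ Suc k \<le> B * z ^ Suc k" using B(2)[of "Suc k"] assms by (intro mult_right_mono) auto
      then show "norm (z ^ Suc k / A (Suc k)) \<le> B * z ^ Suc k"
        using A_pos[of "Suc k"] assms by simp
    qed
  qed
qed

text \<open>An exponent above 1 keeps x powr (- 1 / a) integrable at 0; one below \<alpha> keeps
  \<open>ratio_bound\<close> available.\<close>

lemma exists_exponent: obtains a where "1 < a" "a < \<alpha>" "0 < 1 - 1 / a"
  using that[of "(1 + \<alpha>) / 2"] alpha by simp

text \<open>The Abelian half of Karamata's theorem at z = exp (- s / n), from the weight exp (- s
  x).\<close>

lemma abel_sum_tendsto:
  assumes s: "0 < s"
  shows "(\<lambda>n. A n / real n * (\<Sum>i. exp (- s / real n) ^ Suc i / A (Suc i)))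
     \<longlonglongrightarrow> Gamma (1 - 1 / \<alpha>) * s powr (- (1 - 1 / \<alpha>))"
proof -
  obtain a where a: "1 < a" "a < \<alpha>" "0 < 1 - 1 / a" by (rule exists_exponent)
  have hb: "has_bochner_integral lborel (\<lambda>x. indicator {0<..} x * (exp (- s * x) * x powr (- 1 / q))) (Gamma (1 - 1 / q) * s powr (- (1 - 1 / q)))"
    if "1 < q" for q
    using has_bochner_integral_Gamma_scaled[of "1 - 1 / q" s] s that by simp
  have h1: "has_bochner_integral lborel (\<lambda>x. indicator {0<..} x * (exp (- s * x) * x powr (1 - 1))) (Gamma 1 * s powr (- 1))"
    using has_bochner_integral_Gamma_scaled[of 1 s] s by simp
  have w_sum: "summable (\<lambda>i. exp (- s * (real (Suc i) / real n)) / A (Suc i))" if "0 < n" for n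
  proof -
    have "exp (- s * (real (Suc i) / real n)) = exp (- s / real n) ^ Suc i" for i
      by (simp only: exp_of_nat_mult[symmetric]) (simp add: mult.commute)
    then show ?thesis using summable_power_div_A[of "exp (- s / real n)"] s that by simp
  qed
  have "(\<lambda>n. A n / real n * (\<Sum>i. exp (- s * (real (Suc i) / real n)) / A (Suc i)))
     \<longlonglongrightarrow> (\<integral>x. indicator {0<..} x * (exp (- s * x) * x powr (- 1 / \<alpha>)) \<partial>lborel)"
  proof (rule riemann_sum_tendsto[of a])
    have "integrable lborel (\<lambda>x. indicator {0<..} x * (exp (- s * x) * x powr (1 - 1)) + indicator {0<..} x * (exp (- s * x) * x powr (- 1 / a)))"
      using h1 hb[OF a(1)] by (intro Bochner_Integration.integrable_add) (auto simp: has_bochner_integral_iff)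
    also have "(\<lambda>x. indicator {0<..} x * (exp (- s * x) * x powr (1 - 1)) + indicator {0<..} x * (exp (- s * x) * x powr (- 1 / a)))
      = (\<lambda>x. indicator {0<..} x * (exp (- s * x) * (1 + x powr (- 1 / a))))"
      by (auto simp: indicator_def algebra_simps)
    finally show "integrable lborel (\<lambda>x. indicator {0<..} x * (exp (- s * x) * (1 + x powr (- 1 / a))))" .
  qed (use a s w_sum in auto)
  moreover have "exp (- s * (real (Suc i) / real n)) = exp (- s / real n) ^ Suc i" for i n
    by (simp only: exp_of_nat_mult[symmetric]) (simp add: mult.commute)
  ultimately show ?thesis using hb[OF alpha] by (simp add: has_bochner_integral_iff)
qed

text \<open>The same Riemann sum with the weight cut off at 1, whose one discontinuity is a null
  set.\<close>

lemma Gsum_tendsto: "(\<lambda>n. A n / real n * Gsum A n) \<longlonglongrightarrow> 1 / (1 - 1 / \<alpha>)"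
proof -
  obtain a where a: "1 < a" "a < \<alpha>" "0 < 1 - 1 / a" by (rule exists_exponent)
  have hb: "has_bochner_integral lborel (\<lambda>x. indicator {0<..} x * (indicator {..1} x * x powr (- 1 / q))) (1 / (1 - 1 / q))"
    if "1 < q" for q :: real
    using has_bochner_integral_powr_unit[of "1 - 1 / q"] that by simp
  have h1: "has_bochner_integral lborel (\<lambda>x. indicator {0<..} x * (indicator {..1} x * x powr (1 - 1))) (1 / 1 :: real)"
    by (rule has_bochner_integral_powr_unit) simp
  have zero: "indicator {..1} (real (Suc i) / real n) / A (Suc i) = 0" if "0 < n" "i \<notin> {..<n}" for n i
    using that by (auto simp: indicator_def field_simps)
  have "(\<lambda>n. A n / real n * (\<Sum>i. indicator {..1} (real (Suc i) / real n) / A (Suc i)))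
     \<longlonglongrightarrow> (\<integral>x. indicator {0<..} x * (indicator {..1} x * x powr (- 1 / \<alpha>)) \<partial>lborel)"
  proof (rule riemann_sum_tendsto[of a])
    show "isCont (indicator {..1} :: real \<Rightarrow> real) x" if "0 < x" "x \<noteq> 1" for x :: real
      using that by (simp add: isCont_indicator frontier_real_atMost)
    have "integrable lborel (\<lambda>x. indicator {0<..} x * (indicator {..1} x * x powr (1 - 1)) + indicator {0<..} x * (indicator {..1} x * x powr (- 1 / a)) :: real)"
      using h1 hb[OF a(1)] by (intro Bochner_Integration.integrable_add) (auto simp: has_bochner_integral_iff)
    also have "(\<lambda>x. indicator {0<..} x * (indicator {..1} x * x powr (1 - 1)) + indicator {0<..} x * (indicator {..1} x * x powr (- 1 / a)) :: real)
      = (\<lambda>x. indicator {0<..} x * (indicator {..1} x * (1 + x powr (- 1 / a))))"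
      by (auto simp: indicator_def algebra_simps)
    finally show "integrable lborel (\<lambda>x. indicator {0<..} x * (indicator {..1} x * (1 + x powr (- 1 / a))) :: real)" .
    show "summable (\<lambda>i. indicator {..1} (real (Suc i) / real n) / A (Suc i))" if "0 < n" for n
      by (rule summable_finite[of "{..<n}"]) (use zero[OF that] in auto)
  qed (use a in \<open>auto simp: indicator_def\<close>)
  moreover have "\<forall>\<^sub>F n in sequentially. (\<Sum>i. indicator {..1} (real (Suc i) / real n) / A (Suc i)) = Gsum A n"
    using eventually_gt_at_top[of 0]
  proof eventually_elim
    case (elim n)
    have "(\<Sum>i. indicator {..1} (real (Suc i) / real n) / A (Suc i)) = (\<Sum>i<n. indicator {..1} (real (Suc i) / real n) / A (Suc i))"
      by (rule suminf_finite) (use zero[OF elim] in auto)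
    also have "\<dots> = (\<Sum>i<n. 1 / A (Suc i))"
      by (intro sum.cong) (auto simp: indicator_def)
    also have "\<dots> = Gsum A n"
      unfolding Gsum_def by (rule sum.reindex_bij_witness[of _ "\<lambda>k. k - 1" Suc]) auto
    finally show ?case .
  qed
  then have "\<forall>\<^sub>F n in sequentially. A n / real n * (\<Sum>i. indicator {..1} (real (Suc i) / real n) / A (Suc i)) = A n / real n * Gsum A n"
    by eventually_elim simp
  ultimately have "(\<lambda>n. A n / real n * Gsum A n)
     \<longlonglongrightarrow> (\<integral>x. indicator {0<..} x * (indicator {..1} x * x powr (- 1 / \<alpha>)) \<partial>lborel)"
    by (rule Lim_transform_eventually)
  then show ?thesis using hb[OF alpha] by (simp add: has_bochner_integral_iff)
qed

lemma Gsum_ratio_tendsto: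
  assumes kn: "(\<lambda>n. real (k n) / real n) \<longlonglongrightarrow> x" and x: "0 < x"
    and ktop: "filterlim k at_top sequentially"
  shows "(\<lambda>n. Gsum A (k n) / Gsum A n) \<longlonglongrightarrow> x powr (1 - 1 / \<alpha>)"
proof -
  let ?b = "1 / (1 - 1 / \<alpha>)"
  have b: "0 < ?b" using alpha by simp
  have 1: "(\<lambda>n. A (k n) / real (k n) * Gsum A (k n)) \<longlonglongrightarrow> ?b"
    by (rule filterlim_compose[OF Gsum_tendsto ktop])
  have "(\<lambda>n. (A (k n) / real (k n) * Gsum A (k n)) / (A n / real n * Gsum A n) * (real (k n) / real n) * (A n / A (k n)))
     \<longlonglongrightarrow> ?b / ?b * x * x powr (- 1 / \<alpha>)"
    using b by (intro tendsto_mult tendsto_divide 1 Gsum_tendsto kn ratio_tendsto x) auto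
  moreover have "?b / ?b * x * x powr (- 1 / \<alpha>) = x powr (1 - 1 / \<alpha>)"
    using b x alpha powr_add[of x 1 "- 1 / \<alpha>"] by simp
  moreover have "\<forall>\<^sub>F n in sequentially. (A (k n) / real (k n) * Gsum A (k n)) / (A n / real n * Gsum A n) * (real (k n) / real n) * (A n / A (k n)) = Gsum A (k n) / Gsum A n"
    using eventually_gt_at_top[of 0] filterlim_at_top[THEN iffD1, OF ktop, rule_format, of 1]
  proof eventually_elim
    case (elim n)
    then show ?case using A_pos[of n] A_pos[of "k n"] by (auto simp: field_simps)
  qed
  ultimately show ?thesis by (simp add: tendsto_cong)
qed

text \<open>Gsum A n is of order n / A n, and A n grows at most like n powr (1 / a) with 1 <
  a.\<close>

lemma Gsum_at_top: "filterlim (Gsum A) at_top sequentially"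
proof -
  obtain a where a: "1 < a" "a < \<alpha>" "0 < 1 - 1 / a" by (rule exists_exponent)
  obtain C k0 where C: "0 < C" "1 \<le> k0"
    "\<And>n k. k0 \<le> n \<Longrightarrow> 1 \<le> k \<Longrightarrow> A n / A k \<le> C * (1 + (real n / real k) powr (1 / a))"
    using ratio_bound[of a] a by auto
  define D where "D = C * A 1"
  have D: "0 < D" using C A_pos[of 1] by (simp add: D_def)
  have bound: "A n \<le> D * (1 + real n powr (1 / a))" if "k0 \<le> n" for n
    using C(3)[OF that, of 1] A_pos[of 1] by (simp add: D_def field_simps)
  let ?b = "1 / (1 - 1 / \<alpha>)"
  have b: "0 < ?b" using alpha by simp
  have half: "y / 2 < y" if "0 < y" for y :: real using that by simp
  have ev: "\<forall>\<^sub>F n in sequentially. ?b / 2 < A n / real n * Gsum A n"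
    using order_tendstoD(1)[OF Gsum_tendsto half[OF b]] .
  have "\<forall>\<^sub>F n in sequentially. ?b / 2 * (real n / (D * (1 + real n powr (1 / a)))) \<le> Gsum A n"
    using ev eventually_ge_at_top[of k0] eventually_gt_at_top[of 0]
  proof eventually_elim
    case (elim n)
    have An: "0 < A n" using A_pos elim by auto
    have "?b / 2 * (real n / (D * (1 + real n powr (1 / a)))) \<le> ?b / 2 * (real n / A n)"
      using bound[OF elim(2)] An b D elim by (intro mult_left_mono divide_left_mono mult_pos_pos) (auto simp: add_pos_nonneg)
    also have "\<dots> \<le> (A n / real n * Gsum A n) * (real n / A n)"
      using elim An by (intro mult_right_mono) auto
    also have "\<dots> = Gsum A n" using elim An by simp
    finally show ?case .
  qed
  moreover have "filterlim (\<lambda>n. ?b / 2 * (real n / (D * (1 + real n powr (1 / a))))) at_top sequentially"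
  proof -
    have "0 < 1 / a" "1 / a < 1" using a by auto
    then have "filterlim (\<lambda>n. real n / (1 + real n powr (1 / a))) at_top sequentially" by real_asymp
    then have "filterlim (\<lambda>n. (?b / 2 / D) * (real n / (1 + real n powr (1 / a)))) at_top sequentially"
      using b D by (intro filterlim_tendsto_pos_mult_at_top[OF tendsto_const]) auto
    then show ?thesis by (simp add: mult_ac)
  qed
  ultimately show ?thesis by (rule filterlim_at_top_mono[rotated])
qed

end

section \<open>Gaussian smoothing\<close>

lemma cmod_iexp_diff_le: "cmod (iexp x - iexp y) \<le> min 2 \<bar>x - y\<bar>"
proof -
  have "iexp x - iexp y = iexp y * (iexp (x - y) - 1)"
    by (simp add: algebra_simps exp_add[symmetric])
  then have "cmod (iexp x - iexp y) = cmod (iexp (x - y) - 1)" by (simp add: norm_mult)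
  moreover have "cmod (iexp (x - y) - 1) \<le> \<bar>x - y\<bar>" using iexp_approx1[of "x - y" 0] by simp
  moreover have "cmod (iexp x - iexp y) \<le> cmod (iexp x) + cmod (iexp y)" by (rule norm_triangle_ineq4)
  ultimately show ?thesis by simp
qed

text \<open>Uniformity in t comes from a Skorohod coupling: under it the characteristic functions
  differ by at most the mean of min 2 (\<bar>T\<bar> * \<bar>Z n - Y\<bar>), a bound free of t that
  tends to 0.\<close>

lemma weak_conv_imp_char_uniform_limit:
  fixes \<mu> :: "nat \<Rightarrow> real measure"
  assumes \<mu>: "\<And>n. real_distribution (\<mu> n)" and M: "real_distribution M"
    and conv: "weak_conv_m \<mu> M"
  shows "uniform_limit {-T..T} (\<lambda>n. char (\<mu> n)) (char M) sequentially"
proof -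
  obtain \<Omega> :: "real measure" and Z :: "nat \<Rightarrow> real \<Rightarrow> real" and Y where
    "prob_space \<Omega>" and Z [measurable]: "\<And>n. Z n \<in> borel_measurable \<Omega>"
    and dZ: "\<And>n. distr \<Omega> borel (Z n) = \<mu> n"
    and Y: "Y \<in> measurable \<Omega> lborel" and dY: "distr \<Omega> borel Y = M"
    and lim: "\<And>x. x \<in> space \<Omega> \<Longrightarrow> (\<lambda>n. Z n x) \<longlonglongrightarrow> Y x"
    using Skorohod[OF \<mu> M conv] by blast
  interpret prob_space \<Omega> by fact
  have [measurable]: "Y \<in> borel_measurable \<Omega>" using Y by simp
  define D where "D n = (\<integral>x. min 2 (\<bar>T\<bar> * \<bar>Z n x - Y x\<bar>) \<partial>\<Omega>)" for n
  have "D \<longlonglongrightarrow> (\<integral>x. 0 \<partial>\<Omega>)" unfolding D_def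
  proof (rule integral_dominated_convergence[where w="\<lambda>_. 2"])
    show "AE x in \<Omega>. (\<lambda>n. min 2 (\<bar>T\<bar> * \<bar>Z n x - Y x\<bar>)) \<longlonglongrightarrow> 0"
    proof (rule AE_I2)
      fix x assume "x \<in> space \<Omega>"
      then have "(\<lambda>n. min 2 (\<bar>T\<bar> * \<bar>Z n x - Y x\<bar>)) \<longlonglongrightarrow> min 2 (\<bar>T\<bar> * \<bar>Y x - Y x\<bar>)"
        by (intro tendsto_intros lim)
      then show "(\<lambda>n. min 2 (\<bar>T\<bar> * \<bar>Z n x - Y x\<bar>)) \<longlonglongrightarrow> 0" by simp
    qed
  qed auto
  then have D0: "D \<longlonglongrightarrow> 0" by simp
  have bound: "dist (char (\<mu> n) t) (char M t) \<le> D n" if "t \<in> {-T..T}" for n t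
  proof -
    have "char (\<mu> n) t - char M t = (\<integral>x. iexp (t * Z n x) - iexp (t * Y x) \<partial>\<Omega>)"
      unfolding dZ[symmetric] dY[symmetric] char_def
      by (subst (1 2) integral_distr) (auto intro!: Bochner_Integration.integral_diff[symmetric] integrable_iexp)
    also have "cmod \<dots> \<le> (\<integral>x. cmod (iexp (t * Z n x) - iexp (t * Y x)) \<partial>\<Omega>)" by (rule integral_norm_bound)
    also have "\<dots> \<le> D n" unfolding D_def
    proof (rule integral_mono)
      show "integrable \<Omega> (\<lambda>x. cmod (iexp (t * Z n x) - iexp (t * Y x)))"
        by (intro integrable_norm Bochner_Integration.integrable_diff integrable_iexp) auto
      show "integrable \<Omega> (\<lambda>x. min 2 (\<bar>T\<bar> * \<bar>Z n x - Y x\<bar>))"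
        by (rule integrable_const_bound[where B=2]) auto
      fix x
      have "cmod (iexp (t * Z n x) - iexp (t * Y x)) \<le> min 2 \<bar>t * Z n x - t * Y x\<bar>" by (rule cmod_iexp_diff_le)
      also have "\<bar>t * Z n x - t * Y x\<bar> = \<bar>t\<bar> * \<bar>Z n x - Y x\<bar>"
        by (simp add: abs_mult[symmetric] right_diff_distrib)
      also have "min 2 \<dots> \<le> min 2 (\<bar>T\<bar> * \<bar>Z n x - Y x\<bar>)"
        using that by (intro min.mono mult_right_mono) auto
      finally show "cmod (iexp (t * Z n x) - iexp (t * Y x)) \<le> min 2 (\<bar>T\<bar> * \<bar>Z n x - Y x\<bar>)" .
    qed
    finally show ?thesis by (simp add: dist_norm)
  qed
  show ?thesis
  proof (rule uniform_limitI)
    fix e :: real assume "0 < e"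
    then have "\<forall>\<^sub>F n in sequentially. D n < e" using D0 by (simp add: order_tendstoD)
    then show "\<forall>\<^sub>F n in sequentially. \<forall>x\<in>{-T..T}. dist (char (\<mu> n) x) (char M x) < e"
      by eventually_elim (use bound in \<open>meson le_less_trans\<close>)
  qed
qed

text \<open>The density of the convolution of \<open>\<mu>\<close> with a centred normal law of standard deviation \<open>h\<close>.\<close>
definition gauss_smooth :: "real measure \<Rightarrow> real \<Rightarrow> real \<Rightarrow> real" where
  "gauss_smooth \<mu> h y = (\<integral>x. normal_density y h x \<partial>\<mu>)"

lemma normal_density_sym: "normal_density y h x = normal_density x h y"
  by (simp add: normal_density_def power2_commute)

text \<open>The Gaussian is its own characteristic function up to scale; this turns the smoothing
  kernel into an average of exponentials, ready for Fubini.\<close>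

lemma normal_density_eq_char:
  assumes "0 < h"
  shows "complex_of_real (normal_density y h x) = 1 / (h * sqrt (2 * pi)) * char std_normal_distribution ((x - y) / h)"
proof -
  have "(x - y)\<^sup>2 / (2 * h\<^sup>2) = ((x - y) / h)\<^sup>2 / 2" by (simp add: power_divide)
  moreover have "sqrt (2 * pi * h\<^sup>2) = h * sqrt (2 * pi)" using assms by (simp add: real_sqrt_mult)
  ultimately show ?thesis
    unfolding char_std_normal_distribution by (simp add: normal_density_def exp_of_real)
qed

lemma normal_density_le: "0 < h \<Longrightarrow> normal_density y h x \<le> 1 / h"
proof -
  assume h: "0 < h"
  have s: "sqrt (2 * pi * h\<^sup>2) = sqrt (2 * pi) * h" using h by (simp add: real_sqrt_mult)
  have "1 \<le> sqrt (2 * pi)" using pi_gt3 by simp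
  then have "1 * h \<le> sqrt (2 * pi) * h" using h by (intro mult_right_mono) auto
  then have "1 / sqrt (2 * pi * h\<^sup>2) \<le> 1 / h" unfolding s using h by (intro divide_left_mono) auto
  moreover have "exp (- (x - y)\<^sup>2 / (2 * h\<^sup>2)) \<le> 1" by simp
  ultimately have "1 / sqrt (2 * pi * h\<^sup>2) * exp (- (x - y)\<^sup>2 / (2 * h\<^sup>2)) \<le> 1 / h * 1"
    using h by (intro mult_mono) auto
  then show ?thesis by (simp add: normal_density_def)
qed

context real_distribution
begin

lemma integrable_normal_density_mean: "0 < h \<Longrightarrow> integrable M (\<lambda>x. normal_density y h x)"
  by (rule integrable_const_bound[where B="1 / h"]) (auto intro: normal_density_le)

lemma gauss_smooth_nonneg: "0 \<le> gauss_smooth M h y"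
  unfolding gauss_smooth_def by (intro integral_nonneg_AE) auto

text \<open>Write the kernel by \<open>normal_density_eq_char\<close>, exchange the two integrals
  and rescale v = h t. The Gaussian damping makes the frequency integral absolutely convergent
  whatever the law is.\<close>

lemma gauss_smooth_fourier:
  assumes h: "0 < h"
  shows "complex_of_real (gauss_smooth M h y)
     = 1 / (2 * pi) * (CLBINT t. exp (- (h * t)\<^sup>2 / 2) *\<^sub>R (iexp (- t * y) * char M t))" (is ?eq)
    and "integrable lborel (\<lambda>t. exp (- (h * t)\<^sup>2 / 2) *\<^sub>R (iexp (- t * y) * char M t))" (is ?int)
proof -
  let ?N = "std_normal_distribution"
  interpret N: real_distribution ?N by (rule real_dist_normal_dist)
  interpret P: pair_prob_space M ?N ..
  let ?f = "\<lambda>(x, v). iexp (v * ((x - y) / h)) :: complex"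
  have meas: "?f \<in> borel_measurable (M \<Otimes>\<^sub>M ?N)"
    by measurable
  have intf: "integrable (M \<Otimes>\<^sub>M ?N) ?f"
    by (rule P.integrable_const_bound[where B=1]) (use meas in \<open>auto simp: split_beta\<close>)
  have "complex_of_real (gauss_smooth M h y) = (\<integral>x. complex_of_real (normal_density y h x) \<partial>M)"
    by (simp add: gauss_smooth_def)
  also have "\<dots> = 1 / (h * sqrt (2 * pi)) * (\<integral>x. char ?N ((x - y) / h) \<partial>M)"
    unfolding normal_density_eq_char[OF h] by simp
  also have "(\<integral>x. char ?N ((x - y) / h) \<partial>M) = (\<integral>x. (\<integral>v. ?f (x, v) \<partial>?N) \<partial>M)"
    by (simp add: char_def mult.commute)
  also have "\<dots> = (\<integral>v. (\<integral>x. ?f (x, v) \<partial>M) \<partial>?N)"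
    by (rule P.Fubini_integral[symmetric]) (use intf in \<open>simp add: split_beta\<close>)
  also have "\<dots> = (\<integral>v. iexp (- (v / h) * y) * char M (v / h) \<partial>?N)"
  proof (intro Bochner_Integration.integral_cong refl)
    fix v
    have "(\<integral>x. ?f (x, v) \<partial>M) = (\<integral>x. iexp (- (v / h) * y) * iexp (v / h * x) \<partial>M)"
    proof (intro Bochner_Integration.integral_cong refl)
      fix x
      have "v * ((x - y) / h) = - (v / h) * y + v / h * x" by (simp add: diff_divide_distrib algebra_simps)
      then show "?f (x, v) = iexp (- (v / h) * y) * iexp (v / h * x)"
        by (simp only: prod.case of_real_add distrib_left exp_add)
    qed
    then show "(\<integral>x. ?f (x, v) \<partial>M) = iexp (- (v / h) * y) * char M (v / h)"
      by (simp add: char_def)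
  qed
  also have "\<dots> = (CLBINT v. std_normal_density v *\<^sub>R (iexp (- (v / h) * y) * char M (v / h)))"
    by (intro integral_density) auto
  also have "\<dots> = \<bar>h\<bar> *\<^sub>R (CLBINT t. std_normal_density (0 + h * t) *\<^sub>R (iexp (- ((0 + h * t) / h) * y) * char M ((0 + h * t) / h)))"
    using h by (intro lborel_integral_real_affine) auto
  also have "\<dots> = h *\<^sub>R (CLBINT t. std_normal_density (h * t) *\<^sub>R (iexp (- t * y) * char M t))"
    using h by simp
  also have "\<dots> = h *\<^sub>R (CLBINT t. (1 / sqrt (2 * pi)) *\<^sub>R (exp (- (h * t)\<^sup>2 / 2) *\<^sub>R (iexp (- t * y) * char M t)))"
    by (simp add: std_normal_density_def)
  also have "\<dots> = (h / sqrt (2 * pi)) *\<^sub>R (CLBINT t. exp (- (h * t)\<^sup>2 / 2) *\<^sub>R (iexp (- t * y) * char M t))"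
    by (subst integral_scaleR_right) simp
  also have "1 / (h * sqrt (2 * pi)) * \<dots> = 1 / (2 * pi) * (CLBINT t. exp (- (h * t)\<^sup>2 / 2) *\<^sub>R (iexp (- t * y) * char M t))"
  proof -
    have "1 / (h * sqrt (2 * pi)) * (h / sqrt (2 * pi)) = 1 / (2 * pi)" using h by simp
    then have "complex_of_real (1 / (h * sqrt (2 * pi))) * complex_of_real (h / sqrt (2 * pi)) = complex_of_real (1 / (2 * pi))"
      by (metis of_real_mult)
    then have "complex_of_real (1 / (h * sqrt (2 * pi))) * (complex_of_real (h / sqrt (2 * pi)) * z) = complex_of_real (1 / (2 * pi)) * z" for z
      by (simp only: mult.assoc[symmetric])
    then show ?thesis unfolding scaleR_conv_of_real by simp
  qed
  finally show ?eq by simp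
  have "integrable lborel (\<lambda>t. (sqrt (2 * pi)) * std_normal_density (0 + h * t))"
    using h by (intro integrable_mult_right lborel_integrable_real_affine) auto
  then show ?int
  proof (rule Bochner_Integration.integrable_bound)
    show "AE t in lborel. norm (exp (- (h * t)\<^sup>2 / 2) *\<^sub>R (iexp (- t * y) * char M t)) \<le> norm (sqrt (2 * pi) * std_normal_density (0 + h * t))"
    proof (intro AE_I2)
      fix t
      have "norm (exp (- (h * t)\<^sup>2 / 2) *\<^sub>R (iexp (- t * y) * char M t)) \<le> exp (- (h * t)\<^sup>2 / 2)"
        using cmod_char_le_1[of t] by (simp add: norm_mult mult_left_le del: of_real_mult of_real_minus)
      then show "norm (exp (- (h * t)\<^sup>2 / 2) *\<^sub>R (iexp (- t * y) * char M t)) \<le> norm (sqrt (2 * pi) * std_normal_density (0 + h * t))"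
        by (simp add: std_normal_density_def abs_mult)
    qed
  qed auto
qed

end

lemma gaussian_integral:
  assumes "0 < h"
  shows "has_bochner_integral lborel (\<lambda>t. exp (- (h * t)\<^sup>2 / 2)) (sqrt (2 * pi) / h)"
proof -
  have "has_bochner_integral lborel std_normal_density 1" by (simp add: has_bochner_integral_iff)
  then have "has_bochner_integral lborel (\<lambda>t. std_normal_density (0 + h * t)) (1 /\<^sub>R \<bar>h\<bar>)"
    using assms lborel_has_bochner_integral_real_affine_iff[of h std_normal_density 1 0] by simp
  then have "has_bochner_integral lborel (\<lambda>t. sqrt (2 * pi) * std_normal_density (0 + h * t)) (sqrt (2 * pi) * (1 /\<^sub>R \<bar>h\<bar>))"
    by (intro has_bochner_integral_mult_right) auto
  moreover have "sqrt (2 * pi) * std_normal_density (0 + h * t) = exp (- (h * t)\<^sup>2 / 2)" for t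
    by (simp add: std_normal_density_def)
  moreover have "sqrt (2 * pi) * (1 /\<^sub>R \<bar>h\<bar>) = sqrt (2 * pi) / h" using assms by (simp add: field_simps)
  ultimately show ?thesis by (simp only:)
qed

context real_distribution
begin

text \<open>Frequencies beyond \<delta> contribute at most \<rho> times the integral of the Gaussian
  damping, which is of order 1 / h: smoothing on a finer scale h costs the factor 1 / h.\<close>

lemma gauss_smooth_split:
  assumes h: "0 < h" and \<rho>: "\<And>t. \<delta> \<le> \<bar>t\<bar> \<Longrightarrow> cmod (char M t) \<le> \<rho>"
  shows "cmod (complex_of_real (gauss_smooth M h y)
     - 1 / (2 * pi) * (CLBINT t. indicator {-\<delta><..<\<delta>} t *\<^sub>R (exp (- (h * t)\<^sup>2 / 2) *\<^sub>R (iexp (- t * y) * char M t)))) \<le> \<rho> / h"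
proof -
  let ?g = "\<lambda>t. exp (- (h * t)\<^sup>2 / 2) *\<^sub>R (iexp (- t * y) * char M t)"
  note int = gauss_smooth_fourier(2)[OF h, of y]
  have int1: "integrable lborel (\<lambda>t. indicator {-\<delta><..<\<delta>} t *\<^sub>R ?g t)"
    using int by (rule integrable_mult_indicator[rotated]) simp
  have G: "has_bochner_integral lborel (\<lambda>t. \<rho> * exp (- (h * t)\<^sup>2 / 2)) (\<rho> * (sqrt (2 * pi) / h))"
    by (intro has_bochner_integral_mult_right gaussian_integral h)
  have \<rho>0: "0 \<le> \<rho>" by (rule order_trans[OF norm_ge_zero \<rho>[of "\<bar>\<delta>\<bar>"]]) simp
  have diff: "(CLBINT t. ?g t) - (CLBINT t. indicator {-\<delta><..<\<delta>} t *\<^sub>R ?g t) = (CLBINT t. ?g t - indicator {-\<delta><..<\<delta>} t *\<^sub>R ?g t)"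
    by (rule Bochner_Integration.integral_diff[OF int int1, symmetric])
  have "cmod ((CLBINT t. ?g t) - (CLBINT t. indicator {-\<delta><..<\<delta>} t *\<^sub>R ?g t))
      \<le> (LBINT t. cmod (?g t - indicator {-\<delta><..<\<delta>} t *\<^sub>R ?g t))"
    unfolding diff by (rule integral_norm_bound)
  also have "\<dots> \<le> (LBINT t. \<rho> * exp (- (h * t)\<^sup>2 / 2))"
  proof (rule integral_mono)
    show "integrable lborel (\<lambda>t. cmod (?g t - indicator {-\<delta><..<\<delta>} t *\<^sub>R ?g t))"
      by (intro integrable_norm Bochner_Integration.integrable_diff int int1)
    show "integrable lborel (\<lambda>t. \<rho> * exp (- (h * t)\<^sup>2 / 2))" by (rule integrable.intros[OF G])
    fix t
    show "cmod (?g t - indicator {-\<delta><..<\<delta>} t *\<^sub>R ?g t) \<le> \<rho> * exp (- (h * t)\<^sup>2 / 2)"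
    proof (cases "t \<in> {-\<delta><..<\<delta>}")
      case True
      then have "?g t - indicator {-\<delta><..<\<delta>} t *\<^sub>R ?g t = 0" by (simp only: indicator_simps scaleR_one diff_self)
      then show ?thesis using \<rho>0 by (simp only: norm_zero) simp
    next
      case False
      then have eq: "?g t - indicator {-\<delta><..<\<delta>} t *\<^sub>R ?g t = ?g t" by simp
      have "cmod (char M t) \<le> \<rho>" using False by (intro \<rho>) auto
      moreover have "cmod (?g t) = cmod (char M t) * exp (- (h * t)\<^sup>2 / 2)"
        by (simp only: norm_scaleR norm_mult norm_exp_i_times) simp
      ultimately show ?thesis unfolding eq by (simp only: mult_right_mono exp_ge_zero)
    qed
  qed
  also have "\<dots> = \<rho> * (sqrt (2 * pi) / h)" by (rule has_bochner_integral_integral_eq[OF G])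
  finally have *: "cmod ((CLBINT t. ?g t) - (CLBINT t. indicator {-\<delta><..<\<delta>} t *\<^sub>R ?g t)) \<le> \<rho> * (sqrt (2 * pi) / h)" .
  have scale: "cmod (1 / (2 * pi) * z - 1 / (2 * pi) * w) = 1 / (2 * pi) * cmod (z - w)" for z w :: complex
  proof -
    have "1 / (2 * pi) * z - 1 / (2 * pi) * w = complex_of_real (1 / (2 * pi)) * (z - w)"
      by (simp add: diff_divide_distrib)
    then show ?thesis by (simp only: norm_mult norm_of_real) simp
  qed
  have "cmod (complex_of_real (gauss_smooth M h y) - 1 / (2 * pi) * (CLBINT t. indicator {-\<delta><..<\<delta>} t *\<^sub>R ?g t))
      = 1 / (2 * pi) * cmod ((CLBINT t. ?g t) - (CLBINT t. indicator {-\<delta><..<\<delta>} t *\<^sub>R ?g t))"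
    unfolding gauss_smooth_fourier(1)[OF h, of y] by (rule scale)
  also have "\<dots> \<le> 1 / (2 * pi) * (\<rho> * (sqrt (2 * pi) / h))" using * by (intro mult_left_mono) auto
  also have "\<dots> = \<rho> / h * (1 / sqrt (2 * pi))"
  proof -
    have "sqrt (2 * pi) / (2 * pi) = 1 / sqrt (2 * pi)" by (subst sqrt_divide_self_eq) (auto simp: inverse_eq_divide)
    moreover have "1 / (2 * pi) * (\<rho> * (sqrt (2 * pi) / h)) = \<rho> / h * (sqrt (2 * pi) / (2 * pi))" by simp
    ultimately show ?thesis by (simp only:)
  qed
  also have "\<dots> \<le> \<rho> / h * 1"
  proof (rule mult_left_mono)
    have "1 \<le> sqrt (2 * pi)" using pi_gt3 by simp
    then show "1 / sqrt (2 * pi) \<le> 1" by simp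
  qed (use \<rho>0 h in auto)
  finally show ?thesis unfolding mult_1_right .
qed

lemma gauss_smooth_le:
  assumes h: "0 < h" and \<rho>: "\<And>t. \<delta> \<le> \<bar>t\<bar> \<Longrightarrow> cmod (char M t) \<le> \<rho>"
  shows "gauss_smooth M h y \<le> (LBINT t. indicator {-\<delta><..<\<delta>} t * cmod (char M t)) + \<rho> / h"
proof -
  let ?g = "\<lambda>t. exp (- (h * t)\<^sup>2 / 2) *\<^sub>R (iexp (- t * y) * char M t)"
  have intc: "integrable lborel (\<lambda>t. indicator {-\<delta><..<\<delta>} t * cmod (char M t))"
    by (rule integrableI_bounded_set[where A="{-\<delta><..<\<delta>}" and B=1]) (use emeasure_lborel_box_finite[of "-\<delta>" \<delta>] in \<open>auto simp: cmod_char_le_1 indicator_def less_top\<close>)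
  have int1: "integrable lborel (\<lambda>t. indicator {-\<delta><..<\<delta>} t *\<^sub>R ?g t)"
    using gauss_smooth_fourier(2)[OF h, of y] by (rule integrable_mult_indicator[rotated]) simp
  let ?I = "CLBINT t. indicator {-\<delta><..<\<delta>} t *\<^sub>R ?g t"
  have "cmod ?I \<le> (LBINT t. cmod (indicator {-\<delta><..<\<delta>} t *\<^sub>R ?g t))" by (rule integral_norm_bound)
  also have "\<dots> \<le> (LBINT t. indicator {-\<delta><..<\<delta>} t * cmod (char M t))"
  proof (rule integral_mono)
    show "integrable lborel (\<lambda>t. cmod (indicator {-\<delta><..<\<delta>} t *\<^sub>R ?g t))" using int1 by (rule integrable_norm)
    show "cmod (indicator {-\<delta><..<\<delta>} t *\<^sub>R ?g t) \<le> indicator {-\<delta><..<\<delta>} t * cmod (char M t)" for t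
      by (auto simp: norm_mult indicator_def intro!: mult_left_le_one_le simp del: of_real_mult of_real_minus)
  qed (rule intc)
  finally have 1: "cmod ?I \<le> (LBINT t. indicator {-\<delta><..<\<delta>} t * cmod (char M t))" .
  have "gauss_smooth M h y = cmod (complex_of_real (gauss_smooth M h y))" using gauss_smooth_nonneg by simp
  also have "\<dots> \<le> cmod (complex_of_real (gauss_smooth M h y) - 1 / (2 * pi) * ?I) + cmod (1 / (2 * pi) * ?I)"
    using norm_triangle_sub[of "complex_of_real (gauss_smooth M h y)" "1 / (2 * pi) * ?I"] by (simp only: add.commute)
  also have "cmod (1 / (2 * pi) * ?I) = 1 / (2 * pi) * cmod ?I"
    by (simp add: norm_mult norm_divide)
  also have "\<dots> \<le> 1 * cmod ?I" using pi_gt3 by (intro mult_right_mono) auto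
  finally show ?thesis using 1 gauss_smooth_split[where y=y and \<delta>=\<delta> and \<rho>=\<rho>, OF h \<rho>] by simp
qed

text \<open>An Esseen-type inequality: the indicator of a window of half-width e is at most 5 e
  times the Gaussian density of standard deviation e, so the mass of the window is controlled by
  \<open>gauss_smooth_le\<close>.\<close>

lemma concentration:
  assumes e: "0 < e" and \<rho>: "\<And>t. \<delta> \<le> \<bar>t\<bar> \<Longrightarrow> cmod (char M t) \<le> \<rho>"
  shows "measure M {y-e..y+e} \<le> 5 * (e * (LBINT t. indicator {-\<delta><..<\<delta>} t * cmod (char M t)) + \<rho>)"
proof -
  \<comment> \<open>On the window the density is at least exp (- 1/2) / (sqrt (2 pi) e). From exp 1
    \<le> 3 comes exp (- 1) \<ge> 8/25, from pi < 4 comes sqrt (2 pi) \<le> sqrt 8, and sqrt (8/25)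
    / sqrt 8 = 1/5.\<close>
  have lower: "1 / (5 * e) \<le> normal_density y e x" if "x \<in> {y-e..y+e}" for x
  proof -
    have "\<bar>x - y\<bar> \<le> \<bar>e\<bar>" using that e by auto
    then have "(x - y)\<^sup>2 \<le> e\<^sup>2" by (simp add: abs_le_square_iff)
    then have "(x - y)\<^sup>2 / (2 * e\<^sup>2) \<le> 1 / 2" using e by (simp add: divide_simps)
    then have "exp (- (1 / 2)) \<le> exp (- (x - y)\<^sup>2 / (2 * e\<^sup>2))" by simp
    moreover have "sqrt (exp (- 1 :: real)) = exp (- (1 / 2))"
      by (rule real_sqrt_unique) (simp_all add: power2_eq_square exp_add[symmetric])
    moreover have "sqrt (8 / 25) \<le> sqrt (exp (- 1 :: real))"
      using exp_le by (simp add: exp_minus divide_simps)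
    ultimately have ex: "sqrt (8 / 25) \<le> exp (- (x - y)\<^sup>2 / (2 * e\<^sup>2))" by linarith
    have s: "sqrt (2 * pi * e\<^sup>2) \<le> sqrt 8 * e"
    proof -
      have "sqrt (2 * pi) \<le> sqrt 8" using pi_less_4 by (subst real_sqrt_le_iff) simp
      then show ?thesis using e by (simp add: real_sqrt_mult[of "2 * pi" "e\<^sup>2"] mult_right_mono del: real_sqrt_le_iff)
    qed
    have "1 / (5 * e) = 1 / (sqrt 8 * e) * sqrt (8 / 25)" using e by (simp add: real_sqrt_divide)
    also have "\<dots> \<le> 1 / sqrt (2 * pi * e\<^sup>2) * exp (- (x - y)\<^sup>2 / (2 * e\<^sup>2))"
      using ex s e by (intro mult_mono divide_left_mono) auto
    finally show ?thesis by (simp add: normal_density_def)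
  qed
  have "measure M {y-e..y+e} / (5 * e) = (\<integral>x. 1 / (5 * e) * indicator {y-e..y+e} x \<partial>M)" by simp
  also have "\<dots> \<le> gauss_smooth M e y" unfolding gauss_smooth_def
    using lower e by (intro integral_mono integrable_normal_density_mean integrable_real_mult_indicator)
      (auto simp: indicator_def less_top[symmetric])
  also have "\<dots> \<le> (LBINT t. indicator {-\<delta><..<\<delta>} t * cmod (char M t)) + \<rho> / e"
    by (rule gauss_smooth_le[OF e \<rho>])
  finally show ?thesis using e by (simp add: field_simps)
qed

text \<open>Lets the smoothed mass be followed point by point: by symmetry of the kernel, each x
  spreads a unit mass as a normal law centred at x.\<close>

lemma gauss_smooth_integral:
  assumes h: "0 < h"
  shows "integrable lborel (\<lambda>y. indicator {a..b} y * gauss_smooth M h y)"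
    and "integrable M (\<lambda>x. LBINT y. indicator {a..b} y * normal_density x h y)"
    and "(LBINT y. indicator {a..b} y * gauss_smooth M h y)
       = (\<integral>x. (LBINT y. indicator {a..b} y * normal_density x h y) \<partial>M)"
proof -
  interpret P: pair_sigma_finite lborel M ..
  let ?f = "\<lambda>(y, x). indicator {a..b} y * normal_density x h y"
  have meas: "?f \<in> borel_measurable (lborel \<Otimes>\<^sub>M M)"
    unfolding normal_density_def by measurable
  have int: "integrable (lborel \<Otimes>\<^sub>M M) ?f"
  proof (rule integrableI_bounded_set[where A="{a..b} \<times> UNIV" and B="1 / h"])
    show "{a..b} \<times> UNIV \<in> sets (lborel \<Otimes>\<^sub>M M)" by (intro pair_measureI) auto
    have "emeasure (lborel \<Otimes>\<^sub>M M) ({a..b} \<times> UNIV) = emeasure lborel {a..b} * emeasure M UNIV"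
      by (intro emeasure_pair_measure_Times) auto
    then show "emeasure (lborel \<Otimes>\<^sub>M M) ({a..b} \<times> UNIV) < \<infinity>"
      using emeasure_space_1 by (simp add: emeasure_lborel_Icc_eq)
    show "AE p in lborel \<Otimes>\<^sub>M M. p \<in> {a..b} \<times> UNIV \<longrightarrow> norm (?f p) \<le> 1 / h"
      using normal_density_le[OF h] h by (intro AE_I2) (auto simp: indicator_def)
    show "AE p in lborel \<Otimes>\<^sub>M M. p \<notin> {a..b} \<times> UNIV \<longrightarrow> ?f p = 0"
      by (intro AE_I2) (auto simp: indicator_def)
  qed (rule meas)
  have eq: "(\<lambda>y. \<integral>x. ?f (y, x) \<partial>M) = (\<lambda>y. indicator {a..b} y * gauss_smooth M h y)"
    by (auto simp: gauss_smooth_def normal_density_sym[of _ h])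
  show "integrable lborel (\<lambda>y. indicator {a..b} y * gauss_smooth M h y)"
    using P.integrable_fst'[OF int] eq by simp
  show "integrable M (\<lambda>x. LBINT y. indicator {a..b} y * normal_density x h y)"
    using P.integrable_snd[of "\<lambda>y x. indicator {a..b} y * normal_density x h y"] int by simp
  show "(LBINT y. indicator {a..b} y * gauss_smooth M h y)
       = (\<integral>x. (LBINT y. indicator {a..b} y * normal_density x h y) \<partial>M)"
    using P.Fubini_integral[of "\<lambda>y x. indicator {a..b} y * normal_density x h y"] int eq by simp
qed

end

text \<open>Half of the exponent is spent on the tail factor, the other half remains as the Gaussian
  with doubled variance. The tail of the kernel is thus a small multiple of another probability
  density.\<close>

lemma normal_density_tail_le:
  assumes h: "0 < h" and R: "0 \<le> R" "h * R \<le> \<bar>x - y\<bar>"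
  shows "normal_density y h x \<le> sqrt 2 * exp (- (R\<^sup>2) / 4) * normal_density y (sqrt 2 * h) x"
proof -
  define u where "u = (x - y) / h"
  have "R \<le> \<bar>u\<bar>" using R h by (simp add: u_def field_simps)
  then have u: "R\<^sup>2 \<le> u\<^sup>2" using R(1) by (metis abs_le_square_iff abs_of_nonneg)
  have e1: "- (x - y)\<^sup>2 / (2 * h\<^sup>2) = - (u\<^sup>2) / 2" using h by (simp add: u_def power_divide)
  have e2: "- (x - y)\<^sup>2 / (2 * (sqrt 2 * h)\<^sup>2) = - (u\<^sup>2) / 4" using h by (simp add: u_def power_divide power_mult_distrib)
  have s: "sqrt (2 * pi * (sqrt 2 * h)\<^sup>2) = sqrt 2 * sqrt (2 * pi * h\<^sup>2)"
    by (simp add: real_sqrt_mult power_mult_distrib)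
  have "exp (- (u\<^sup>2) / 2) = exp (- (u\<^sup>2) / 4) * exp (- (u\<^sup>2) / 4)" by (simp add: exp_add[symmetric])
  also have "\<dots> \<le> exp (- (R\<^sup>2) / 4) * exp (- (u\<^sup>2) / 4)" using u by (intro mult_right_mono) auto
  finally have "1 / sqrt (2 * pi * h\<^sup>2) * exp (- (u\<^sup>2) / 2) \<le> 1 / sqrt (2 * pi * h\<^sup>2) * (exp (- (R\<^sup>2) / 4) * exp (- (u\<^sup>2) / 4))"
    by (intro mult_left_mono) auto
  also have "\<dots> = sqrt 2 * exp (- (R\<^sup>2) / 4) * (1 / sqrt (2 * pi * (sqrt 2 * h)\<^sup>2) * exp (- (u\<^sup>2) / 4))"
    unfolding s by simp
  finally show ?thesis unfolding normal_density_def e1 e2 .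
qed

lemma integrable_indicator_normal_density: "0 < h \<Longrightarrow> integrable lborel (\<lambda>y. indicator {a..b} y * normal_density x h y :: real)"
  using integrable_mult_indicator[OF _ integrable_normal_density, of "{a..b}"] by simp

section \<open>Masses of windows recovered from smoothed densities\<close>

context real_distribution
begin

text \<open>A point of the window keeps at least the part 1 - \<open>?\<tau>\<close> of its smoothed
  mass within distance h * R of the window.\<close>

lemma desmooth_upper:
  assumes h: "0 < h" and R: "0 \<le> R" and e: "0 < e"
    and L: "\<And>y'. y' \<in> {y-e-h*R..y+e+h*R} \<Longrightarrow> gauss_smooth M h y' \<le> L"
  shows "(1 - sqrt 2 * exp (- (R\<^sup>2) / 4)) * measure M {y-e<..<y+e} \<le> L * (2 * (e + h * R))"
proof -
  let ?\<tau> = "sqrt 2 * exp (- (R\<^sup>2) / 4)" and ?J = "{y-e-h*R..y+e+h*R}"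
  let ?k = "\<lambda>x. LBINT y'. indicator ?J y' * normal_density x h y'"
  have hR: "0 \<le> h * R" using h R by simp
  have k: "1 - ?\<tau> \<le> ?k x" if x: "x \<in> {y-e<..<y+e}" for x
  proof -
    have "1 - ?k x = (LBINT y'. normal_density x h y' - indicator ?J y' * normal_density x h y')"
      using h by (simp add: integrable_indicator_normal_density)
    also have "\<dots> \<le> (LBINT y'. ?\<tau> * normal_density x (sqrt 2 * h) y')"
    proof (rule integral_mono)
      fix y'
      show "normal_density x h y' - indicator ?J y' * normal_density x h y' \<le> ?\<tau> * normal_density x (sqrt 2 * h) y'"
        using normal_density_tail_le[OF h R, of y' x] x hR by (auto simp: indicator_def)
    qed (use h in \<open>auto intro!: integrable_indicator_normal_density\<close>)
    also have "\<dots> = ?\<tau>" using h by simp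
    finally show ?thesis by linarith
  qed
  have "(1 - ?\<tau>) * measure M {y-e<..<y+e} = (\<integral>x. (1 - ?\<tau>) * indicator {y-e<..<y+e} x \<partial>M)" by simp
  also have "\<dots> \<le> (\<integral>x. ?k x \<partial>M)"
  proof (rule integral_mono)
    fix x
    have "0 \<le> ?k x" by (intro integral_nonneg_AE) auto
    then show "(1 - ?\<tau>) * indicator {y-e<..<y+e} x \<le> ?k x" using k[of x] by (auto simp: indicator_def)
  qed (auto intro!: gauss_smooth_integral h simp: less_top[symmetric])
  also have "\<dots> = (LBINT y'. indicator ?J y' * gauss_smooth M h y')" by (rule gauss_smooth_integral(3)[OF h, symmetric])
  also have "\<dots> \<le> (LBINT y'. L * indicator ?J y')"
    using L by (intro integral_mono gauss_smooth_integral h) (auto split: split_indicator intro: integrable_real_indicator simp: emeasure_lborel_Icc_eq)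
  also have "\<dots> = L * (2 * (e + h * R))"
  proof -
    have "y - e - h * R \<le> y + e + h * R" using e hR by linarith
    then show ?thesis by simp
  qed
  finally show ?thesis .
qed

text \<open>On the window shrunk by h * R the smoothed mass comes from the window itself, up to a
  leak from points at distance at least h * R. The leak is measured with the wider kernel, hence the
  upper bound at the scale sqrt 2 * h.\<close>

lemma desmooth_lower:
  assumes h: "0 < h" and R: "0 \<le> R" and hR: "h * R < e"
    and l: "\<And>y'. y' \<in> {y-e+h*R..y+e-h*R} \<Longrightarrow> l \<le> gauss_smooth M h y'"
    and L: "\<And>y'. y' \<in> {y-e+h*R..y+e-h*R} \<Longrightarrow> gauss_smooth M (sqrt 2 * h) y' \<le> L"
  shows "l * (2 * (e - h * R)) \<le> measure M {y-e<..<y+e} + sqrt 2 * exp (- (R\<^sup>2) / 4) * (L * (2 * (e - h * R)))"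
proof -
  let ?\<tau> = "sqrt 2 * exp (- (R\<^sup>2) / 4)" and ?J = "{y-e+h*R..y+e-h*R}" and ?B = "{y-e<..<y+e}"
  let ?k = "\<lambda>h x. LBINT y'. indicator ?J y' * normal_density x h y'"
  have h2: "0 < sqrt 2 * h" using h by simp
  have k: "?k h x \<le> indicator ?B x + ?\<tau> * ?k (sqrt 2 * h) x" for x
  proof (cases "x \<in> ?B")
    case True
    have "?k h x \<le> (LBINT y'. normal_density x h y')"
      using h by (intro integral_mono integrable_indicator_normal_density) (auto simp: indicator_def)
    then have "?k h x \<le> 1" using h by simp
    moreover have "0 \<le> ?\<tau> * ?k (sqrt 2 * h) x" by (intro mult_nonneg_nonneg integral_nonneg_AE) auto
    ultimately have "?k h x \<le> 1 + ?\<tau> * ?k (sqrt 2 * h) x" by linarith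
    then show ?thesis using True by simp
  next
    case False
    have "?k h x \<le> (LBINT y'. ?\<tau> * (indicator ?J y' * normal_density x (sqrt 2 * h) y'))"
    proof (rule integral_mono)
      fix y'
      show "indicator ?J y' * normal_density x h y' \<le> ?\<tau> * (indicator ?J y' * normal_density x (sqrt 2 * h) y')"
      proof (cases "y' \<in> ?J")
        case True
        then have "h * R \<le> \<bar>y' - x\<bar>" using False by auto
        then show ?thesis using normal_density_tail_le[OF h R, of y' x] True by simp
      qed simp
    qed (use h h2 in \<open>auto intro!: integrable_indicator_normal_density\<close>)
    then show ?thesis using False by simp
  qed
  have "l * (2 * (e - h * R)) = (LBINT y'. l * indicator ?J y')" using hR by (simp add: mult.commute)
  also have "\<dots> \<le> (LBINT y'. indicator ?J y' * gauss_smooth M h y')"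
    using l by (intro integral_mono gauss_smooth_integral h) (auto split: split_indicator intro: integrable_real_indicator simp: emeasure_lborel_Icc_eq)
  also have "\<dots> = (\<integral>x. ?k h x \<partial>M)" by (rule gauss_smooth_integral(3)[OF h])
  also have "\<dots> \<le> (\<integral>x. indicator ?B x + ?\<tau> * ?k (sqrt 2 * h) x \<partial>M)"
    by (intro integral_mono Bochner_Integration.integrable_add integrable_mult_right gauss_smooth_integral h h2 k)
       (auto simp: less_top[symmetric])
  also have "\<dots> = measure M ?B + ?\<tau> * (\<integral>x. ?k (sqrt 2 * h) x \<partial>M)"
    by (subst Bochner_Integration.integral_add) (auto intro!: integrable_mult_right gauss_smooth_integral h2 simp: less_top[symmetric])
  also have "(\<integral>x. ?k (sqrt 2 * h) x \<partial>M) = (LBINT y'. indicator ?J y' * gauss_smooth M (sqrt 2 * h) y')"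
    by (rule gauss_smooth_integral(3)[OF h2, symmetric])
  also have "?\<tau> * \<dots> \<le> ?\<tau> * (LBINT y'. L * indicator ?J y')"
    using L by (intro mult_left_mono integral_mono gauss_smooth_integral h2) (auto split: split_indicator intro: integrable_real_indicator simp: emeasure_lborel_Icc_eq)
  also have "(LBINT y'. L * indicator ?J y') = L * (2 * (e - h * R))" using hR by (simp add: mult.commute)
  finally show ?thesis by simp
qed

end

section \<open>Characteristic functions under the Cramer condition\<close>

context real_distribution
begin

text \<open>Modulus 1 forces exp (i t x) to be almost surely the constant z = char M t, because 1 -
  Re (cnj z * exp (i t x)) is nonnegative with mean 0. For t \<noteq> 0 the multiples of t then
  carry modulus 1 to infinity, against the Cramer condition.\<close>

lemma cmod_char_eq_1_power:
  assumes "cmod (char M t) = 1"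
  shows "cmod (char M (real n * t)) = 1"
proof -
  define z where "z = char M t"
  have z: "cnj z * z = 1" using assms complex_norm_square[of z] by (simp add: z_def mult.commute)
  have int: "integrable M (\<lambda>x. iexp (t * x))" by (rule integrable_iexp) auto
  have "(\<integral>x. 1 - Re (cnj z * iexp (t * x)) \<partial>M) = 1 - Re (\<integral>x. cnj z * iexp (t * x) \<partial>M)"
    using int prob_space by (subst Bochner_Integration.integral_diff) (auto simp del: times_complex.simps)
  also have "(\<integral>x. cnj z * iexp (t * x) \<partial>M) = 1" using z int by (simp add: z_def char_def)
  finally have zero: "(\<integral>x. 1 - Re (cnj z * iexp (t * x)) \<partial>M) = 0" by simp
  have norm1: "cmod (cnj z * iexp (t * x)) = 1" for x using assms by (simp add: norm_mult z_def del: of_real_mult)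
  have nn: "0 \<le> 1 - Re (cnj z * iexp (t * x))" for x using complex_Re_le_cmod[of "cnj z * iexp (t * x)"] norm1[of x] by linarith
  have "integrable M (\<lambda>x. 1 - Re (cnj z * iexp (t * x)))"
    using int by (intro Bochner_Integration.integrable_diff integrable_Re integrable_mult_right) auto
  then have "AE x in M. 1 - Re (cnj z * iexp (t * x)) = 0"
    using zero nn by (subst (asm) integral_nonneg_eq_0_iff_AE) auto
  then have ae: "AE x in M. iexp (t * x) = z"
  proof eventually_elim
    case (elim x)
    have Re1: "Re (cnj z * iexp (t * x)) = 1" using elim by linarith
    then have "Im (cnj z * iexp (t * x)) = 0" using norm1[of x] cmod_power2[of "cnj z * iexp (t * x)"]
      by (simp only: one_power2 power_eq_0_iff) simp
    then have "cnj z * iexp (t * x) = 1" using Re1 by (simp only: complex_eq_iff one_complex.simps)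
    then have "(z * cnj z) * iexp (t * x) = z" by (simp only: mult.assoc mult_1_right)
    then show ?case using z by (metis mult.commute mult_1_left)
  qed
  have "char M (real n * t) = (\<integral>x. z ^ n \<partial>M)"
    unfolding char_def
  proof (rule integral_cong_AE)
    show "AE x in M. iexp (real n * t * x) = z ^ n"
      using ae
    proof eventually_elim
      case (elim x)
      have "iexp (real n * t * x) = exp (of_nat n * (\<i> * complex_of_real (t * x)))" by (simp add: mult_ac)
      also have "\<dots> = iexp (t * x) ^ n" by (rule exp_of_nat_mult)
      finally show ?case using elim by simp
    qed
  qed auto
  then have "char M (real n * t) = z ^ n" using prob_space by simp
  then show ?thesis using assms by (simp add: z_def norm_power)
qed

text \<open>The limsup handles large t. On the compact remainder the maximum is below 1, since
  modulus 1 at some t \<noteq> 0 would propagate along its multiples into the range of the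
  limsup.\<close>

lemma cramer_bound:
  assumes cramer: "Limsup at_infinity (\<lambda>s::real. ereal (cmod (char M s))) < 1" and \<delta>: "0 < \<delta>"
  obtains \<rho> where "0 < \<rho>" "\<rho> < 1" "\<And>t. \<delta> \<le> \<bar>t\<bar> \<Longrightarrow> cmod (char M t) \<le> \<rho>"
proof -
  obtain r where r: "Limsup at_infinity (\<lambda>s::real. ereal (cmod (char M s))) < r" "r < 1"
    using dense[OF cramer] by blast
  have "\<forall>\<^sub>F s in at_infinity. ereal (cmod (char M s)) < r" using r(1) by (rule Limsup_lessD)
  then obtain b where b: "\<And>s. b \<le> \<bar>s\<bar> \<Longrightarrow> ereal (cmod (char M s)) < r"
    by (auto simp: eventually_at_infinity)
  have "ereal (cmod (char M \<bar>b\<bar>)) < r" by (rule b) simp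
  then have "0 < r" using norm_ge_zero[of "char M \<bar>b\<bar>"] le_less_trans[of 0 "ereal (cmod (char M \<bar>b\<bar>))" r] by simp
  then obtain r' where r': "r = ereal r'" "0 < r'" "r' < 1" using r(2) by (cases r) auto
  have lt1: "cmod (char M t) < 1" if "t \<noteq> 0" for t
  proof (rule ccontr)
    assume "\<not> cmod (char M t) < 1"
    then have one: "cmod (char M t) = 1" using cmod_char_le_1[of t] by simp
    obtain n :: nat where n: "b / \<bar>t\<bar> < real n" using reals_Archimedean2 by blast
    then have "b \<le> \<bar>real n * t\<bar>" using that by (simp add: abs_mult field_simps)
    then have "cmod (char M (real n * t)) < r'" using b[of "real n * t"] r' by simp
    then show False using cmod_char_eq_1_power[OF one, of n] r' by simp
  qed
  define S where "S = {t. \<delta> \<le> \<bar>t\<bar> \<and> \<bar>t\<bar> \<le> max b \<delta>}"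
  have "compact S"
  proof -
    have "S = {- max b \<delta>..-\<delta>} \<union> {\<delta>..max b \<delta>}" using \<delta> by (auto simp: S_def max_def abs_if split: if_splits)
    then show ?thesis by auto
  qed
  moreover have "S \<noteq> {}" using \<delta> by (auto simp: S_def intro!: exI[of _ \<delta>])
  moreover have "continuous_on S (\<lambda>t. cmod (char M t))"
    by (intro continuous_at_imp_continuous_on ballI continuous_norm isCont_char)
  ultimately obtain s where s: "s \<in> S" "\<And>t. t \<in> S \<Longrightarrow> cmod (char M t) \<le> cmod (char M s)"
    using continuous_attains_sup[of S "\<lambda>t. cmod (char M t)"] by blast
  have "cmod (char M s) < 1" using s(1) \<delta> by (intro lt1) (auto simp: S_def)
  show ?thesis
  proof (rule that[of "max r' (cmod (char M s))"])
    fix t assume t: "\<delta> \<le> \<bar>t\<bar>"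
    show "cmod (char M t) \<le> max r' (cmod (char M s))"
    proof (cases "b \<le> \<bar>t\<bar>")
      case True then show ?thesis using b[of t] r' by simp
    next
      case False then show ?thesis using s(2)[of t] t by (auto simp: S_def)
    qed
  qed (use r' \<open>cmod (char M s) < 1\<close> in auto)
qed

end

lemma ln_diff_abs_le:
  fixes x y m :: real
  assumes "0 < m" "m \<le> x" "m \<le> y"
  shows "\<bar>ln x - ln y\<bar> \<le> \<bar>x - y\<bar> / m"
proof -
  have *: "ln a - ln b \<le> \<bar>a - b\<bar> / m" if "m \<le> a" "m \<le> b" for a b
  proof -
    have "ln a - ln b \<le> (a - b) / b" using that assms(1) by (intro ln_diff_le) auto
    also have "\<dots> \<le> \<bar>a - b\<bar> / m" using that assms(1) by (intro frac_le) auto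
    finally show ?thesis .
  qed
  show ?thesis using *[of x y] *[of y x] assms by (auto simp: abs_le_iff abs_minus_commute)
qed

text \<open>\<open>\<nu>\<close> n is the law of the walk at time n. Of the explicit stable
  characteristic function only the modulus is kept, in which location and skewness cancel; c is the
  scale to the power \<alpha>.\<close>

locale attracted_walk = D: real_distribution D
  for D :: "real measure" +
  fixes \<nu> :: "nat \<Rightarrow> real measure" and A :: "nat \<Rightarrow> real" and \<mu>X :: "real measure" and c \<alpha> :: real
  assumes \<nu>: "\<And>n. real_distribution (\<nu> n)"
    and char_\<nu>: "\<And>n t. char (\<nu> n) t = char D t ^ n"
    and A_pos: "\<And>n. 1 \<le> n \<Longrightarrow> 0 < A n"
    and \<mu>X: "real_distribution \<mu>X"
    and ulim: "\<And>T. uniform_limit {-T..T} (\<lambda>n t. char D (t / A n) ^ n) (char \<mu>X) sequentially"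
    and cmod_char_\<mu>X: "\<And>t. cmod (char \<mu>X t) = exp (- c * \<bar>t\<bar> powr \<alpha>)"
    and c_pos: "0 < c" and alpha: "1 < \<alpha>"
    and cramer: "Limsup at_infinity (\<lambda>s::real. ereal (cmod (char D s))) < 1"
begin

text \<open>At a zero of the characteristic function the convention ln 0 = 0 gives the value 0 in
  place of infinity; \<open>char_power_majorant\<close> therefore treats zeros separately.\<close>

definition \<psi> :: "real \<Rightarrow> real" where "\<psi> t = - ln (cmod (char D t))"

text \<open>If A n < Z for arbitrarily large n, the argument Z / A n would stay at distance at least
  1 from 0 there, and the Cramer bound would make the n-th power exponentially small, although it
  converges to the nonzero number char \<mu>X Z.\<close>

lemma A_at_top: "filterlim A at_top sequentially"
proof -
  obtain \<rho> where \<rho>: "0 < \<rho>" "\<rho> < 1" "\<And>t. 1 \<le> \<bar>t\<bar> \<Longrightarrow> cmod (char D t) \<le> \<rho>"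
    using D.cramer_bound[OF cramer, of 1] by auto
  show ?thesis unfolding filterlim_at_top_gt[where c = 0]
  proof safe
    fix Z :: real assume Z: "0 < Z"
    have "(\<lambda>n. cmod (char D (Z / A n) ^ n)) \<longlonglongrightarrow> cmod (char \<mu>X Z)"
      using tendsto_uniform_limitI[OF ulim[of Z], of Z] Z by (intro tendsto_norm) auto
    moreover define e where "e = cmod (char \<mu>X Z) / 2"
    have e: "0 < e" "e < cmod (char \<mu>X Z)" by (auto simp: e_def cmod_char_\<mu>X)
    ultimately have "\<forall>\<^sub>F n in sequentially. e < cmod (char D (Z / A n) ^ n)"
      by (intro order_tendstoD) auto
    moreover have "(\<lambda>n. \<rho> ^ n) \<longlonglongrightarrow> 0" using \<rho> by (intro LIMSEQ_power_zero) auto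
    then have "\<forall>\<^sub>F n in sequentially. \<rho> ^ n < e" using e by (intro order_tendstoD) auto
    ultimately show "\<forall>\<^sub>F n in sequentially. Z \<le> A n" using eventually_ge_at_top[of 1]
    proof eventually_elim
      case (elim n)
      show ?case
      proof (rule ccontr)
        assume "\<not> Z \<le> A n"
        then have "1 \<le> \<bar>Z / A n\<bar>" using A_pos[of n] elim Z by auto
        then have "cmod (char D (Z / A n)) ^ n \<le> \<rho> ^ n" by (intro power_mono \<rho>) auto
        then show False using elim by (simp add: norm_power)
      qed
    qed
  qed
qed

sublocale regular_scale \<psi> A c \<alpha>
proof
  show "uniform_limit {0..V} (\<lambda>k v. real k * \<psi> (v / A k)) (\<lambda>v. c * v powr \<alpha>) sequentially" if V: "0 < V" for V
  proof (rule uniform_limitI)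
    fix e :: real assume e: "0 < e"
    \<comment> \<open>Half the minimum of cmod (char \<mu>X v) over [0, V]: from some n on both
      moduli are at least m, where ln is Lipschitz with constant 1 / m.\<close>
    define m where "m = exp (- c * V powr \<alpha>) / 2"
    have m: "0 < m" by (simp add: m_def)
    have "\<forall>\<^sub>F n in sequentially. \<forall>t\<in>{-V..V}. dist (char D (t / A n) ^ n) (char \<mu>X t) < min m (e * m)"
      using uniform_limitD[OF ulim[of V], of "min m (e * m)"] e m by simp
    then show "\<forall>\<^sub>F n in sequentially. \<forall>x\<in>{0..V}. dist (real n * \<psi> (x / A n)) (c * x powr \<alpha>) < e"
      using eventually_gt_at_top[of 0]
    proof eventually_elim
      case (elim n)
      show ?case
      proof
        fix v assume v: "v \<in> {0..V}"
        define F where "F = cmod (char D (v / A n) ^ n)"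
        define F0 where "F0 = cmod (char \<mu>X v)"
        have "dist (char D (v / A n) ^ n) (char \<mu>X v) < min m (e * m)" using elim v by auto
        then have d: "\<bar>F - F0\<bar> < min m (e * m)"
          using norm_triangle_ineq3[of "char D (v / A n) ^ n" "char \<mu>X v"] by (simp add: F_def F0_def dist_norm)
        have "v powr \<alpha> \<le> V powr \<alpha>" using v alpha by (intro powr_mono2) auto
        then have F0: "2 * m \<le> F0" using v c_pos by (simp add: F0_def m_def cmod_char_\<mu>X)
        have F: "m \<le> F" using d F0 by linarith
        have "\<bar>ln F - ln F0\<bar> \<le> \<bar>F - F0\<bar> / m" using F F0 m by (intro ln_diff_abs_le) auto
        also have "\<dots> < e" using d m by (simp add: divide_less_eq)
        finally have "\<bar>ln F - ln F0\<bar> < e" .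
        moreover have "ln F0 = - (c * v powr \<alpha>)" using v by (simp add: F0_def cmod_char_\<mu>X)
        moreover have "ln F = - (real n * \<psi> (v / A n))"
        proof -
          have "0 < cmod (char D (v / A n)) ^ n" using F m by (simp add: F_def norm_power)
          then have "0 < cmod (char D (v / A n))" using elim by (cases "char D (v / A n) = 0") (auto simp: power_0_left)
          then show ?thesis by (simp add: F_def norm_power \<psi>_def ln_realpow)
        qed
        ultimately show "dist (real n * \<psi> (v / A n)) (c * v powr \<alpha>) < e"
          by (simp add: dist_real_def)
      qed
    qed
  qed
qed (use A_pos c_pos alpha A_at_top in auto)

lemma cmod_char_neg: "cmod (char D (- t)) = cmod (char D t)"
proof -
  have "char D (- t) = cnj (char D t)"
    unfolding char_def using Bochner_Integration.integral_cnj[of D "\<lambda>x. iexp (t * x)"] by (simp add: exp_cnj)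
  then show ?thesis by simp
qed

text \<open>A majorant on the whole range \<bar>u\<bar> < \<delta> * A k, far beyond the compact
  sets of the uniform limit. Doubling with exponent 1 makes k * \<psi> (u / A k) grow at least
  linearly with slope c / 4; the factor exp \<kappa> covers \<bar>u\<bar> \<le> 1.\<close>

lemma char_power_majorant:
  obtains \<delta> \<kappa> k0 where "0 < \<delta>" "0 < \<kappa>" "1 \<le> k0"
    "\<And>k u. k0 \<le> k \<Longrightarrow> \<bar>u\<bar> < \<delta> * A k \<Longrightarrow> cmod (char D (u / A k)) ^ k \<le> exp \<kappa> * exp (- \<kappa> * \<bar>u\<bar>)"
proof -
  obtain \<delta> where \<delta>: "0 < \<delta>" "\<And>t. 0 < t \<Longrightarrow> t \<le> \<delta> \<Longrightarrow> 2 powr 1 * \<psi> t \<le> \<psi> (2 * t)"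
    using doubling[of 1] alpha by auto
  have "\<forall>\<^sub>F k in sequentially. 1 \<le> k \<and> (\<forall>v\<in>{0..2}. \<bar>real k * \<psi> (v / A k) - c * v powr \<alpha>\<bar> < c / 2)"
    using eventually_ge_at_top[of 1] scaling_eventually[of 2 "c / 2"] c_pos by (auto intro!: eventually_conj)
  then obtain K where K: "\<And>k. K \<le> k \<Longrightarrow> 1 \<le> k"
    "\<And>k v. K \<le> k \<Longrightarrow> v \<in> {0..2} \<Longrightarrow> \<bar>real k * \<psi> (v / A k) - c * v powr \<alpha>\<bar> < c / 2"
    unfolding eventually_sequentially by blast
  have pos_bound: "cmod (char D (u / A k)) ^ k \<le> exp (c / 4) * exp (- (c / 4) * u)"
    if k: "K \<le> k" and u: "0 \<le> u" "u < \<delta> * A k" for k u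
  proof (cases "u \<le> 1")
    case True
    have "cmod (char D (u / A k)) ^ k \<le> 1" by (intro power_le_one) (auto simp: D.cmod_char_le_1)
    also have "1 \<le> exp (c / 4) * exp (- (c / 4) * u)"
      using True c_pos by (simp add: exp_add[symmetric] mult_left_le)
    finally show ?thesis .
  next
    case False
    then obtain i where ui: "2 ^ i \<le> u" "u < 2 * 2 ^ i" using dyadic_floor[of u] by auto
    define v where "v = u / 2 ^ i"
    have v: "1 \<le> v" "v \<le> 2" using ui by (auto simp: v_def field_simps)
    have kp: "0 < real k" "0 < A k" using K(1)[OF k] A_pos by auto
    have eq: "u / A k = 2 ^ i * (v / A k)" by (simp add: v_def)
    have "u / A k < \<delta>" using u kp by (simp add: field_simps)
    then have "2 powr (1 * real i) * \<psi> (v / A k) \<le> \<psi> (u / A k)"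
      unfolding eq by (intro doubling_iterate[OF \<delta>(2)]) (use \<delta>(1) v kp in auto)
    then have 1: "2 ^ i * \<psi> (v / A k) \<le> \<psi> (u / A k)" by (simp add: powr_realpow)
    have "c * 1 \<le> c * v powr \<alpha>"
      using v alpha c_pos by (intro mult_left_mono) (auto simp: ge_one_powr_ge_zero)
    moreover have "\<bar>real k * \<psi> (v / A k) - c * v powr \<alpha>\<bar> < c / 2" using K(2)[OF k, of v] v by auto
    ultimately have 2: "c / 2 \<le> real k * \<psi> (v / A k)" by linarith
    have "c / 4 * u \<le> 2 ^ i * (c / 2)" using ui c_pos by (simp add: field_simps)
    also have "\<dots> \<le> 2 ^ i * (real k * \<psi> (v / A k))" using 2 by (intro mult_left_mono) auto
    also have "\<dots> = real k * (2 ^ i * \<psi> (v / A k))" by simp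
    also have "\<dots> \<le> real k * \<psi> (u / A k)" using 1 kp by (intro mult_left_mono) auto
    finally have 3: "c / 4 * u \<le> real k * \<psi> (u / A k)" .
    show ?thesis
    proof (cases "cmod (char D (u / A k)) = 0")
      \<comment> \<open>Here \<psi> only has its conventional value, but the power itself is
        0.\<close>
      case True then show ?thesis using kp by (simp add: power_0_left)
    next
      case False
      then have "cmod (char D (u / A k)) ^ k = exp (ln (cmod (char D (u / A k)))) ^ k" by simp
      also have "\<dots> = exp (real k * ln (cmod (char D (u / A k))))" by (rule exp_of_nat_mult[symmetric])
      also have "\<dots> \<le> exp (- (c / 4) * u)" using 3 by (simp add: \<psi>_def)
      also have "\<dots> \<le> exp (c / 4) * exp (- (c / 4) * u)" using c_pos by simp
      finally show ?thesis .
    qed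
  qed
  show ?thesis
  proof (rule that[of \<delta> "c / 4" K])
    fix k u assume k: "K \<le> k" and u: "\<bar>u\<bar> < \<delta> * A k"
    have "cmod (char D (u / A k)) = cmod (char D (\<bar>u\<bar> / A k))"
      using cmod_char_neg[of "u / A k"] by (cases "0 \<le> u") auto
    then show "cmod (char D (u / A k)) ^ k \<le> exp (c / 4) * exp (- (c / 4) * \<bar>u\<bar>)"
      using pos_bound[OF k, of "\<bar>u\<bar>"] u by simp
  qed (use \<delta>(1) c_pos K(1)[of K] in auto)
qed

end

lemma integrable_exp_neg_abs:
  assumes "0 < \<kappa>"
  shows "integrable lborel (\<lambda>u::real. exp (- \<kappa> * \<bar>u\<bar>))"
proof -
  have pos: "integrable lborel (\<lambda>u::real. indicator {0<..} u * exp (- \<kappa> * u))"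
  proof -
    have "has_bochner_integral lborel (\<lambda>x. indicator {0<..} x * (exp (- \<kappa> * x) * x powr (1 - 1))) (Gamma 1 * \<kappa> powr (- 1))"
      using has_bochner_integral_Gamma_scaled[of 1 \<kappa>] assms by simp
    then have "integrable lborel (\<lambda>x. indicator {0<..} x * (exp (- \<kappa> * x) * x powr (1 - 1)))"
      by (rule integrable.intros)
    moreover have "(\<lambda>x. indicator {0<..} x * (exp (- \<kappa> * x) * x powr (1 - 1))) = (\<lambda>u::real. indicator {0<..} u * exp (- \<kappa> * u))"
      by (auto simp: indicator_def)
    ultimately show ?thesis by simp
  qed
  have neg: "integrable lborel (\<lambda>u::real. indicator {0<..} (0 + (-1) * u) * exp (- \<kappa> * (0 + (-1) * u)))"
    using pos by (rule lborel_integrable_real_affine) simp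
  have "integrable lborel (\<lambda>u::real. indicator {0<..} u * exp (- \<kappa> * u) + indicator {0<..} (0 + (-1) * u) * exp (- \<kappa> * (0 + (-1) * u)))"
    using pos neg by (rule Bochner_Integration.integrable_add)
  then show ?thesis
  proof (rule integrable_cong_AE_imp)
    show "AE x in lborel. indicator {0<..} x * exp (- \<kappa> * x) + indicator {0<..} (0 + (-1) * x) * exp (- \<kappa> * (0 + (-1) * x)) = exp (- \<kappa> * \<bar>x\<bar>)"
      using AE_lborel_singleton[of 0] by eventually_elim (auto simp: indicator_def)
  qed auto
qed

section \<open>Fourier inversion for the limit density and the low-frequency integral\<close>

locale attracted_walk_density = attracted_walk +
  fixes fX :: "real \<Rightarrow> real"
  assumes density: "\<mu>X = density lborel (\<lambda>x. ennreal (fX x))"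
    and fX_nonneg: "\<And>x. 0 \<le> fX x" and fX_cont: "continuous_on UNIV fX"
begin

lemma fX_measurable [measurable]: "fX \<in> borel_measurable borel"
  using fX_cont by (rule borel_measurable_continuous_onI)

lemma fX_integral: "has_bochner_integral lborel fX 1"
proof -
  interpret real_distribution \<mu>X by (rule \<mu>X)
  have "(\<integral>\<^sup>+x. ennreal (fX x) \<partial>lborel) = emeasure \<mu>X UNIV"
    by (subst density) (simp add: emeasure_density)
  also have "\<dots> = ennreal 1" using emeasure_space_1 by simp
  finally show ?thesis by (intro has_bochner_integral_nn_integral) (auto simp: fX_nonneg)
qed

lemma char_\<mu>X_integrable: "integrable lborel (char \<mu>X)"
proof (rule Bochner_Integration.integrable_bound)
  show "integrable lborel (\<lambda>u. exp c * exp (- c * \<bar>u\<bar>))"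
    using c_pos by (intro integrable_mult_right integrable_exp_neg_abs)
  show "char \<mu>X \<in> borel_measurable lborel" using real_distribution.char_measurable[OF \<mu>X] by simp
  show "AE u in lborel. cmod (char \<mu>X u) \<le> norm (exp c * exp (- c * \<bar>u\<bar>))"
  proof (rule AE_I2)
    fix u :: real
    have "\<bar>u\<bar> \<le> 1 + \<bar>u\<bar> powr \<alpha>"
    proof (cases "\<bar>u\<bar> \<le> 1")
      case False
      then have "\<bar>u\<bar> powr 1 \<le> \<bar>u\<bar> powr \<alpha>" using alpha by (intro powr_mono) auto
      then show ?thesis using False by simp
    qed (simp add: add_increasing2)
    then have "c * \<bar>u\<bar> \<le> c * (1 + \<bar>u\<bar> powr \<alpha>)" using c_pos by (intro mult_left_mono) auto
    then have "- c * \<bar>u\<bar> powr \<alpha> \<le> c + - c * \<bar>u\<bar>" by (simp add: algebra_simps)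
    then show "cmod (char \<mu>X u) \<le> norm (exp c * exp (- c * \<bar>u\<bar>))"
      by (simp add: cmod_char_\<mu>X exp_add[symmetric])
  qed
qed

text \<open>An approximate identity for a density known to be integrable and continuous. For
  \<bar>x\<bar> < r continuity suffices. Outside, fX x meets the small kernel value at r and
  integrates to at most that value, while the constant fX 0 meets the Gaussian tail.\<close>

lemma gauss_smooth_\<mu>X_tendsto:
  fixes h :: "nat \<Rightarrow> real"
  assumes h: "\<And>n. 0 < h n" "h \<longlonglongrightarrow> 0"
  shows "(\<lambda>n. gauss_smooth \<mu>X (h n) 0) \<longlonglongrightarrow> fX 0"
proof (rule LIMSEQ_I)
  fix e :: real assume e: "0 < e"
  have "isCont fX 0" using fX_cont by (simp add: continuous_on_eq_continuous_at)
  then obtain r where r: "0 < r" "\<And>x. \<bar>x\<bar> < r \<Longrightarrow> \<bar>fX x - fX 0\<bar> < e / 4"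
  proof -
    have "0 < e / 4" using e by simp
    then obtain d where "d > 0" "\<forall>x'. \<bar>x' - 0\<bar> < d \<longrightarrow> \<bar>fX x' - fX 0\<bar> < e / 4"
      using \<open>isCont fX 0\<close> unfolding continuous_at_eps_delta dist_real_def by blast
    then show ?thesis using that[of d] by simp
  qed
  have lim: "(\<lambda>n. normal_density 0 (h n) r) \<longlonglongrightarrow> 0" "(\<lambda>n. exp (- ((r / h n)\<^sup>2) / 4)) \<longlonglongrightarrow> 0"
  proof -
    have h0: "filterlim h (at_right 0) sequentially"
      unfolding filterlim_at using h(2) order.strict_implies_not_eq[OF h(1)] h(1) by simp
    have "((\<lambda>h. normal_density 0 h r) \<longlongrightarrow> 0) (at_right 0)"
      unfolding normal_density_def using r(1) by real_asymp
    then show "(\<lambda>n. normal_density 0 (h n) r) \<longlonglongrightarrow> 0" using h0 by (rule filterlim_compose)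
    have "((\<lambda>h. exp (- ((r / h)\<^sup>2) / 4)) \<longlongrightarrow> 0) (at_right 0)" using r(1) by real_asymp
    then show "(\<lambda>n. exp (- ((r / h n)\<^sup>2) / 4)) \<longlonglongrightarrow> 0" using h0 by (rule filterlim_compose)
  qed
  have "(\<lambda>n. sqrt 2 * exp (- ((r / h n)\<^sup>2) / 4) * fX 0) \<longlonglongrightarrow> sqrt 2 * 0 * fX 0"
    by (intro tendsto_intros lim)
  then have ev2: "\<forall>\<^sub>F n in sequentially. sqrt 2 * exp (- ((r / h n)\<^sup>2) / 4) * fX 0 < e / 4"
    using e by (intro order_tendstoD) auto
  have ev1: "\<forall>\<^sub>F n in sequentially. normal_density 0 (h n) r < e / 4"
    using lim(1) e by (intro order_tendstoD) auto
  have fint: "integrable lborel fX" "(LBINT x. fX x) = 1" using fX_integral by (auto simp: has_bochner_integral_iff)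
  have "\<forall>\<^sub>F n in sequentially. norm (gauss_smooth \<mu>X (h n) 0 - fX 0) < e"
    using ev1 ev2
  proof eventually_elim
    case (elim n)
    let ?g = "normal_density 0 (h n)"
    have hn: "0 < h n" by (rule h)
    have gs: "gauss_smooth \<mu>X (h n) 0 = (LBINT x. fX x * ?g x)"
      unfolding gauss_smooth_def density by (subst integral_density) (auto simp: fX_nonneg)
    have int: "integrable lborel (\<lambda>x. fX x * ?g x)"
    proof (rule Bochner_Integration.integrable_bound)
      show "integrable lborel (\<lambda>x. 1 / h n * fX x)" using fint by (intro integrable_mult_right)
      show "AE x in lborel. norm (fX x * ?g x) \<le> norm (1 / h n * fX x)"
      proof (rule AE_I2)
        fix x
        have "fX x * ?g x \<le> fX x * (1 / h n)"
          using normal_density_le[OF hn] fX_nonneg by (intro mult_left_mono) auto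
        then show "norm (fX x * ?g x) \<le> norm (1 / h n * fX x)"
          using hn fX_nonneg[of x] by (simp add: abs_mult)
      qed
    qed auto
    have "gauss_smooth \<mu>X (h n) 0 - fX 0 = (LBINT x. fX x * ?g x - fX 0 * ?g x)"
      using int hn by (simp add: gs)
    then have "\<bar>gauss_smooth \<mu>X (h n) 0 - fX 0\<bar> \<le> (LBINT x. \<bar>fX x * ?g x - fX 0 * ?g x\<bar>)"
      using integral_abs_bound[of lborel "\<lambda>x. fX x * ?g x - fX 0 * ?g x"] by (simp only:)
    also have "\<dots> \<le> (LBINT x. e / 4 * ?g x + (normal_density 0 (h n) r * fX x
         + fX 0 * (sqrt 2 * exp (- ((r / h n)\<^sup>2) / 4) * normal_density 0 (sqrt 2 * h n) x)))"
    proof (rule integral_mono)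
      show "integrable lborel (\<lambda>x. \<bar>fX x * ?g x - fX 0 * ?g x\<bar>)"
        using int hn by (intro integrable_abs Bochner_Integration.integrable_diff integrable_mult_right) auto
      show "integrable lborel (\<lambda>x. e / 4 * ?g x + (normal_density 0 (h n) r * fX x
         + fX 0 * (sqrt 2 * exp (- ((r / h n)\<^sup>2) / 4) * normal_density 0 (sqrt 2 * h n) x)))"
        using fint hn by (intro Bochner_Integration.integrable_add integrable_mult_right) auto
      fix x
      show "\<bar>fX x * ?g x - fX 0 * ?g x\<bar> \<le> e / 4 * ?g x + (normal_density 0 (h n) r * fX x
         + fX 0 * (sqrt 2 * exp (- ((r / h n)\<^sup>2) / 4) * normal_density 0 (sqrt 2 * h n) x))"
      proof (cases "\<bar>x\<bar> < r")
        case True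
        have "\<bar>fX x * ?g x - fX 0 * ?g x\<bar> = \<bar>fX x - fX 0\<bar> * ?g x"
          by (simp add: left_diff_distrib[symmetric] abs_mult)
        also have "\<dots> \<le> e / 4 * ?g x" using r(2)[OF True] by (intro mult_right_mono) auto
        moreover have "0 \<le> normal_density 0 (h n) r * fX x
         + fX 0 * (sqrt 2 * exp (- ((r / h n)\<^sup>2) / 4) * normal_density 0 (sqrt 2 * h n) x)"
          using fX_nonneg by (intro add_nonneg_nonneg mult_nonneg_nonneg) auto
        ultimately show ?thesis by linarith
      next
        case False
        have "\<bar>r\<bar> \<le> \<bar>x\<bar>" using False r(1) by auto
        then have sq: "r\<^sup>2 \<le> x\<^sup>2" by (simp add: abs_le_square_iff)
        have "?g x \<le> normal_density 0 (h n) r"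
          unfolding normal_density_def using sq hn by (intro mult_left_mono) (auto simp: divide_right_mono)
        then have 1: "fX x * ?g x \<le> normal_density 0 (h n) r * fX x"
          using fX_nonneg[of x] by (simp add: mult.commute mult_left_mono)
        have "?g x \<le> sqrt 2 * exp (- ((r / h n)\<^sup>2) / 4) * normal_density 0 (sqrt 2 * h n) x"
          by (rule normal_density_tail_le) (use hn r(1) False in auto)
        then have 2: "fX 0 * ?g x \<le> fX 0 * (sqrt 2 * exp (- ((r / h n)\<^sup>2) / 4) * normal_density 0 (sqrt 2 * h n) x)"
          using fX_nonneg by (intro mult_left_mono) auto
        have 3: "0 \<le> e / 4 * ?g x" "0 \<le> fX x * ?g x" "0 \<le> fX 0 * ?g x" using e fX_nonneg by auto
        then have "\<bar>fX x * ?g x - fX 0 * ?g x\<bar> \<le> fX x * ?g x + fX 0 * ?g x" by linarith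
        then show ?thesis using 1 2 3 by linarith
      qed
    qed
    also have "\<dots> = e / 4 + (normal_density 0 (h n) r + fX 0 * (sqrt 2 * exp (- ((r / h n)\<^sup>2) / 4)))"
      using fint hn by (simp add: Bochner_Integration.integral_add)
    also have "\<dots> < e" using elim e by (simp add: mult.commute mult.left_commute)
    finally show ?case by simp
  qed
  then show "\<exists>no. \<forall>n\<ge>no. norm (gauss_smooth \<mu>X (h n) 0 - fX 0) < e"
    by (simp add: eventually_sequentially)
qed

text \<open>Both sides of the smoothed inversion formula converge as the smoothing scale tends to
  0.\<close>

lemma fX_0_eq: "complex_of_real (fX 0) = 1 / (2 * pi) * (CLBINT u. char \<mu>X u)"
proof (rule LIMSEQ_unique)
  interpret X: real_distribution \<mu>X by (rule \<mu>X)
  let ?h = "\<lambda>n. 1 / real (Suc n)"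
  have h: "\<And>n. 0 < ?h n" "?h \<longlonglongrightarrow> 0"
    using LIMSEQ_inverse_real_of_nat by (auto simp: inverse_eq_divide)
  show "(\<lambda>n. complex_of_real (gauss_smooth \<mu>X (?h n) 0)) \<longlonglongrightarrow> complex_of_real (fX 0)"
    using gauss_smooth_\<mu>X_tendsto[OF h] by (rule tendsto_of_real)
  have "(\<lambda>n. CLBINT t. exp (- (?h n * t)\<^sup>2 / 2) *\<^sub>R (iexp (- t * 0) * char \<mu>X t)) \<longlonglongrightarrow> (CLBINT t. char \<mu>X t)"
  proof (rule integral_dominated_convergence[where w="\<lambda>t. cmod (char \<mu>X t)"])
    show "integrable lborel (\<lambda>t. cmod (char \<mu>X t))" by (intro integrable_norm char_\<mu>X_integrable)
    show "AE t in lborel. (\<lambda>n. exp (- (?h n * t)\<^sup>2 / 2) *\<^sub>R (iexp (- t * 0) * char \<mu>X t)) \<longlonglongrightarrow> char \<mu>X t"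
    proof (rule AE_I2)
      fix t
      have "(\<lambda>n. exp (- (?h n * t)\<^sup>2 / 2) *\<^sub>R (iexp (- t * 0) * char \<mu>X t)) \<longlonglongrightarrow> exp (- (0 * t)\<^sup>2 / 2) *\<^sub>R (iexp (- t * 0) * char \<mu>X t)"
        by (intro tendsto_intros h(2)) auto
      then show "(\<lambda>n. exp (- (?h n * t)\<^sup>2 / 2) *\<^sub>R (iexp (- t * 0) * char \<mu>X t)) \<longlonglongrightarrow> char \<mu>X t" by simp
    qed
    show "AE t in lborel. norm (exp (- (?h n * t)\<^sup>2 / 2) *\<^sub>R (iexp (- t * 0) * char \<mu>X t)) \<le> cmod (char \<mu>X t)" for n
      by (intro AE_I2) (auto simp: norm_mult intro!: mult_left_le_one_le)
  qed auto
  then have "(\<lambda>n. 1 / (2 * pi) * (CLBINT t. exp (- (?h n * t)\<^sup>2 / 2) *\<^sub>R (iexp (- t * 0) * char \<mu>X t))) \<longlonglongrightarrow> 1 / (2 * pi) * (CLBINT t. char \<mu>X t)"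
    by (intro tendsto_mult tendsto_const)
  then show "(\<lambda>n. complex_of_real (gauss_smooth \<mu>X (?h n) 0)) \<longlonglongrightarrow> 1 / (2 * pi) * (CLBINT u. char \<mu>X u)"
    using X.gauss_smooth_fourier(1)[OF h(1), of _ 0] by (simp only:)
qed

text \<open>After t = u / A k the integrand converges pointwise under the majorant of
  \<open>char_power_majorant\<close>; by \<open>fX_0_eq\<close> the limit is 2 pi fX 0. The absolute
  bound B later prices the replacement of a factor close to 1 inside the integral.\<close>

lemma truncated_char_integral:
  obtains \<delta> B k0 where "0 < \<delta>" "0 < B" "1 \<le> k0"
    "(\<lambda>k. A k *\<^sub>R (CLBINT t. indicator {-\<delta><..<\<delta>} t *\<^sub>R char D t ^ k)) \<longlonglongrightarrow> (CLBINT u. char \<mu>X u)"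
    "\<And>k. k0 \<le> k \<Longrightarrow> A k * (LBINT t. indicator {-\<delta><..<\<delta>} t * cmod (char D t) ^ k) \<le> B"
proof -
  obtain \<delta> \<kappa> k0 where \<delta>: "0 < \<delta>" "0 < \<kappa>" "1 \<le> k0"
    "\<And>k u. k0 \<le> k \<Longrightarrow> \<bar>u\<bar> < \<delta> * A k \<Longrightarrow> cmod (char D (u / A k)) ^ k \<le> exp \<kappa> * exp (- \<kappa> * \<bar>u\<bar>)"
    using char_power_majorant by blast
  let ?w = "\<lambda>u::real. exp \<kappa> * exp (- \<kappa> * \<bar>u\<bar>)"
  have w: "integrable lborel ?w" using \<delta>(2) by (intro integrable_mult_right integrable_exp_neg_abs)
  have Dm [measurable]: "char D \<in> borel_measurable borel" by (rule D.char_measurable)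
  have ind: "indicator {-\<delta><..<\<delta>} (0 + (1 / A k) * u) = (indicator {-\<delta> * A k<..<\<delta> * A k} u :: real)" if "k0 \<le> k" for k u
    using A_pos[of k] that \<delta>(3) by (auto simp: indicator_def field_simps)
  have scale1: "A k *\<^sub>R (CLBINT t. indicator {-\<delta><..<\<delta>} t *\<^sub>R char D t ^ k)
      = (CLBINT u. indicator {-\<delta> * A k<..<\<delta> * A k} u *\<^sub>R char D (u / A k) ^ k)" if k: "k0 \<le> k" for k
  proof -
    have Ak: "0 < A k" using A_pos k \<delta> by auto
    have "(CLBINT t. indicator {-\<delta><..<\<delta>} t *\<^sub>R char D t ^ k)
       = \<bar>1 / A k\<bar> *\<^sub>R (CLBINT u. indicator {-\<delta><..<\<delta>} (0 + (1 / A k) * u) *\<^sub>R char D (0 + (1 / A k) * u) ^ k)"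
      using Ak by (intro lborel_integral_real_affine) auto
    then show ?thesis using Ak unfolding ind[OF k] by simp
  qed
  have scale2: "A k * (LBINT t. indicator {-\<delta><..<\<delta>} t * cmod (char D t) ^ k)
      = (LBINT u. indicator {-\<delta> * A k<..<\<delta> * A k} u * cmod (char D (u / A k)) ^ k)" if k: "k0 \<le> k" for k
  proof -
    have Ak: "0 < A k" using A_pos k \<delta> by auto
    have "(LBINT t. indicator {-\<delta><..<\<delta>} t * cmod (char D t) ^ k)
       = \<bar>1 / A k\<bar> *\<^sub>R (LBINT u. indicator {-\<delta><..<\<delta>} (0 + (1 / A k) * u) * cmod (char D (0 + (1 / A k) * u)) ^ k)"
      using Ak by (intro lborel_integral_real_affine) auto
    then show ?thesis using Ak unfolding ind[OF k] by simp
  qed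
  have bound: "indicator {-\<delta> * A k<..<\<delta> * A k} u * cmod (char D (u / A k)) ^ k \<le> ?w u" if "k0 \<le> k" for k u
    using \<delta>(4)[OF that, of u] by (auto simp: indicator_def)
  have "(\<lambda>n. CLBINT u. indicator {-\<delta> * A (n + k0)<..<\<delta> * A (n + k0)} u *\<^sub>R char D (u / A (n + k0)) ^ (n + k0)) \<longlonglongrightarrow> (CLBINT u. char \<mu>X u)"
  proof (rule integral_dominated_convergence[where w="?w"])
    show "AE u in lborel. (\<lambda>n. indicator {-\<delta> * A (n + k0)<..<\<delta> * A (n + k0)} u *\<^sub>R char D (u / A (n + k0)) ^ (n + k0)) \<longlonglongrightarrow> char \<mu>X u"
    proof (rule AE_I2)
      fix u :: real
      have 1: "(\<lambda>n. char D (u / A n) ^ n) \<longlonglongrightarrow> char \<mu>X u"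
        by (rule tendsto_uniform_limitI[OF ulim[of "\<bar>u\<bar>"]]) auto
      have "\<forall>\<^sub>F n in sequentially. \<bar>u\<bar> / \<delta> + 1 \<le> A n" using A_at_top by (simp add: filterlim_at_top)
      then have "\<forall>\<^sub>F n in sequentially. char D (u / A n) ^ n = indicator {-\<delta> * A n<..<\<delta> * A n} u *\<^sub>R char D (u / A n) ^ n"
      proof eventually_elim
        case (elim n)
        then have "\<bar>u\<bar> / \<delta> < A n" by linarith
        then have "\<bar>u\<bar> < \<delta> * A n" using \<delta>(1) by (simp add: field_simps)
        then show ?case by (auto simp: indicator_def)
      qed
      with 1 have "(\<lambda>n. indicator {-\<delta> * A n<..<\<delta> * A n} u *\<^sub>R char D (u / A n) ^ n) \<longlonglongrightarrow> char \<mu>X u"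
        by (rule Lim_transform_eventually)
      then show "(\<lambda>n. indicator {-\<delta> * A (n + k0)<..<\<delta> * A (n + k0)} u *\<^sub>R char D (u / A (n + k0)) ^ (n + k0)) \<longlonglongrightarrow> char \<mu>X u"
        by (rule LIMSEQ_ignore_initial_segment)
    qed
    show "AE u in lborel. norm (indicator {-\<delta> * A (n + k0)<..<\<delta> * A (n + k0)} u *\<^sub>R char D (u / A (n + k0)) ^ (n + k0)) \<le> ?w u" for n
      using bound[of "n + k0"] by (intro AE_I2) (simp add: norm_power)
    show "char \<mu>X \<in> borel_measurable lborel" using real_distribution.char_measurable[OF \<mu>X] by simp
  qed (use w in auto)
  then have "(\<lambda>n. A (n + k0) *\<^sub>R (CLBINT t. indicator {-\<delta><..<\<delta>} t *\<^sub>R char D t ^ (n + k0))) \<longlonglongrightarrow> (CLBINT u. char \<mu>X u)"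
    using scale1 by simp
  then have lim: "(\<lambda>k. A k *\<^sub>R (CLBINT t. indicator {-\<delta><..<\<delta>} t *\<^sub>R char D t ^ k)) \<longlonglongrightarrow> (CLBINT u. char \<mu>X u)"
    by (rule LIMSEQ_offset)
  have "A k * (LBINT t. indicator {-\<delta><..<\<delta>} t * cmod (char D t) ^ k) \<le> (LBINT u. ?w u)" if k: "k0 \<le> k" for k
    unfolding scale2[OF k]
  proof (rule integral_mono)
    show "integrable lborel (\<lambda>u. indicator {-\<delta> * A k<..<\<delta> * A k} u * cmod (char D (u / A k)) ^ k)"
      by (rule Bochner_Integration.integrable_bound[OF w]) (use bound[OF k] in \<open>auto intro!: AE_I2\<close>)
  qed (use w bound[OF k] in auto)
  then show ?thesis
    using that[of \<delta> "max 1 (LBINT u. ?w u)" k0] \<delta> lim by (force simp: le_max_iff_disj)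
qed

end

section \<open>Local limit theorem\<close>

context attracted_walk_density
begin

text \<open>Makes A k harmless against the exponentially small \<rho>^k.\<close>

lemma A_linear_bound: obtains C k0 where "0 < C" "1 \<le> k0" "\<And>n. k0 \<le> n \<Longrightarrow> A n \<le> C * (1 + real n)"
proof -
  obtain C k0 where C: "0 < C" "1 \<le> k0"
    "\<And>n k. k0 \<le> n \<Longrightarrow> 1 \<le> k \<Longrightarrow> A n / A k \<le> C * (1 + (real n / real k) powr (1 / 1))"
    using ratio_bound[of 1] alpha by auto
  have A1: "0 < A 1" using A_pos by simp
  show ?thesis
  proof (rule that[of "C * A 1" k0])
    fix n assume "k0 \<le> n"
    then show "A n \<le> C * A 1 * (1 + real n)" using C(3)[of n 1] A1 by (simp add: field_simps)
  qed (use C A1 in auto)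
qed

text \<open>Three errors, e / 3 each. High frequencies cost A k * \<rho>^k / h, which is small as
  long as h is at least of order 1 / k^2; replacing damping and phase by 1 on \<bar>t\<bar> <
  \<delta> costs \<eta> * B; the integral that remains is within e / 3 of its limit.\<close>

lemma smooth_llt:
  assumes b: "0 < b" and e: "0 < e"
  obtains k0 h0 where "1 \<le> k0" "0 < h0"
    "\<And>k h y. k0 \<le> k \<Longrightarrow> b / (real k)\<^sup>2 \<le> h \<Longrightarrow> h \<le> h0 \<Longrightarrow> \<bar>y\<bar> \<le> h0 \<Longrightarrow> \<bar>A k * gauss_smooth (\<nu> k) h y - fX 0\<bar> \<le> e"
proof -
  obtain \<delta> B K where \<delta>: "0 < \<delta>" and B: "0 < B" and K: "1 \<le> K"
    and lim: "(\<lambda>k. A k *\<^sub>R (CLBINT t. indicator {-\<delta><..<\<delta>} t *\<^sub>R char D t ^ k)) \<longlonglongrightarrow> (CLBINT u. char \<mu>X u)"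
    and bd: "\<And>k. K \<le> k \<Longrightarrow> A k * (LBINT t. indicator {-\<delta><..<\<delta>} t * cmod (char D t) ^ k) \<le> B"
    using truncated_char_integral by blast
  obtain \<rho> where \<rho>: "0 < \<rho>" "\<rho> < 1" "\<And>t. \<delta> \<le> \<bar>t\<bar> \<Longrightarrow> cmod (char D t) \<le> \<rho>"
    using D.cramer_bound[OF cramer \<delta>] by blast
  obtain C K' where C: "0 < C" "1 \<le> K'" "\<And>n. K' \<le> n \<Longrightarrow> A n \<le> C * (1 + real n)"
    using A_linear_bound by blast
  define Z where "Z = (CLBINT u. char \<mu>X u)"
  define J0 where "J0 k = (CLBINT t. indicator {-\<delta><..<\<delta>} t *\<^sub>R char D t ^ k)" for k
  have ev1: "\<forall>\<^sub>F k in sequentially. cmod (A k *\<^sub>R J0 k - Z) < e / 3"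
  proof -
    have "(\<lambda>k. A k *\<^sub>R J0 k) \<longlonglongrightarrow> Z" using lim by (simp add: Z_def J0_def)
    from tendstoD[OF this, of "e / 3"] show ?thesis using e by (simp add: dist_norm)
  qed
  have "(\<lambda>k. C * (1 + real k) * \<rho> ^ k * (real k)\<^sup>2 / b) \<longlonglongrightarrow> 0"
    using C(1) b \<rho>(1,2) by real_asymp
  then have ev2: "\<forall>\<^sub>F k in sequentially. C * (1 + real k) * \<rho> ^ k * (real k)\<^sup>2 / b < e / 3"
    using e by (intro order_tendstoD) auto
  have "\<forall>\<^sub>F k in sequentially. max K K' \<le> k \<and> cmod (A k *\<^sub>R J0 k - Z) < e / 3 \<and> C * (1 + real k) * \<rho> ^ k * (real k)\<^sup>2 / b < e / 3"
    using ev1 ev2 eventually_ge_at_top[of "max K K'"] by eventually_elim simp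
  then obtain k0 where k0: "\<And>k. k0 \<le> k \<Longrightarrow> max K K' \<le> k"
    "\<And>k. k0 \<le> k \<Longrightarrow> cmod (A k *\<^sub>R J0 k - Z) < e / 3"
    "\<And>k. k0 \<le> k \<Longrightarrow> C * (1 + real k) * \<rho> ^ k * (real k)\<^sup>2 / b < e / 3"
    unfolding eventually_sequentially by blast
  \<comment> \<open>At h = h0 the bracket bounds the distance of exp (- (h t)^2 / 2) * exp (- i t y)
    from 1 for all \<bar>t\<bar> < \<delta>, h \<le> h0 and \<bar>y\<bar> \<le> h0; one h0 serves
    every k.\<close>
  have "((\<lambda>h. ((h * \<delta>)\<^sup>2 / 2 + \<delta> * h) * B) \<longlongrightarrow> ((0 * \<delta>)\<^sup>2 / 2 + \<delta> * 0) * B) (at_right 0)"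
    by (intro tendsto_intros) auto
  then have "((\<lambda>h. ((h * \<delta>)\<^sup>2 / 2 + \<delta> * h) * B) \<longlongrightarrow> 0) (at_right 0)" by simp
  then have "\<forall>\<^sub>F h in at_right 0. ((h * \<delta>)\<^sup>2 / 2 + \<delta> * h) * B < e / 3"
    using e by (intro order_tendstoD) auto
  then have "\<forall>\<^sub>F h in at_right 0. 0 < h \<and> ((h * \<delta>)\<^sup>2 / 2 + \<delta> * h) * B < e / 3"
    using eventually_at_right_less[of 0] by eventually_elim simp
  then obtain h0 where h0: "0 < h0" "((h0 * \<delta>)\<^sup>2 / 2 + \<delta> * h0) * B < e / 3"
    by (metis (no_types, lifting) eventually_happens trivial_limit_at_right_real)
  show ?thesis
  proof (rule that[of k0 h0])
    show "1 \<le> k0" using k0(1)[of k0] K by auto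
    show "0 < h0" by (rule h0)
    fix k h y
    assume k: "k0 \<le> k" and hb: "b / (real k)\<^sup>2 \<le> h" and hh: "h \<le> h0" and y: "\<bar>y\<bar> \<le> h0"
    interpret nu: real_distribution "\<nu> k" by (rule \<nu>)
    have kK: "K \<le> k" "K' \<le> k" "1 \<le> k" using k0(1)[OF k] K by auto
    have Ak: "0 < A k" using A_pos kK by auto
    have "0 < b / (real k)\<^sup>2" using b kK by simp
    then have h: "0 < h" using hb by linarith
    let ?w = "\<lambda>t. exp (- (h * t)\<^sup>2 / 2) *\<^sub>R (iexp (- t * y) * char (\<nu> k) t)"
    define J where "J = (CLBINT t. indicator {-\<delta><..<\<delta>} t *\<^sub>R ?w t)"
    have s1: "cmod (complex_of_real (gauss_smooth (\<nu> k) h y) - 1 / (2 * pi) * J) \<le> \<rho> ^ k / h"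
      unfolding J_def
      by (rule nu.gauss_smooth_split[OF h]) (use \<rho> in \<open>auto simp: char_\<nu> norm_power intro!: power_mono\<close>)
    have [measurable]: "char D \<in> borel_measurable borel" by (rule D.char_measurable)
    have int0: "integrable lborel (\<lambda>t. indicator {-\<delta><..<\<delta>} t *\<^sub>R char D t ^ k)"
      using emeasure_lborel_box_finite[of "-\<delta>" \<delta>] D.cmod_char_le_1
      by (intro integrableI_bounded_set[where A="{-\<delta><..<\<delta>}" and B=1])
         (auto simp: norm_power power_le_one less_top indicator_def)
    have intc: "integrable lborel (\<lambda>t. indicator {-\<delta><..<\<delta>} t * cmod (char D t) ^ k)"
      using integrable_norm[OF int0] by (simp add: norm_power)
    have intJ: "integrable lborel (\<lambda>t. indicator {-\<delta><..<\<delta>} t *\<^sub>R ?w t)"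
      using nu.gauss_smooth_fourier(2)[OF h, of y] by (rule integrable_mult_indicator[rotated]) simp
    define \<eta> where "\<eta> = (h0 * \<delta>)\<^sup>2 / 2 + \<delta> * h0"
    have wbound: "cmod (complex_of_real (exp (- (h * t)\<^sup>2 / 2)) * iexp (- t * y) - 1) \<le> \<eta>" if t: "t \<in> {-\<delta><..<\<delta>}" for t
    proof -
      define E where "E = exp (- (h * t)\<^sup>2 / 2)"
      have E: "0 \<le> E" "E \<le> 1" "1 - E \<le> (h * t)\<^sup>2 / 2"
        using exp_ge_add_one_self[of "- (h * t)\<^sup>2 / 2"] by (auto simp: E_def)
      have tb: "\<bar>t\<bar> \<le> \<delta>" using t by auto
      have "complex_of_real E * iexp (- t * y) - 1 = complex_of_real E * (iexp (- t * y) - 1) - complex_of_real (1 - E)"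
        by (simp add: algebra_simps)
      then have "cmod (complex_of_real E * iexp (- t * y) - 1) \<le> cmod (complex_of_real E * (iexp (- t * y) - 1)) + cmod (complex_of_real (1 - E))"
        by (simp only: norm_triangle_ineq4)
      also have "cmod (complex_of_real (1 - E)) = 1 - E" using E by (simp only: norm_of_real)
      also have "cmod (complex_of_real E * (iexp (- t * y) - 1)) = E * cmod (iexp (- t * y) - iexp 0)"
        using E(1) by (simp add: norm_mult)
      also have "\<dots> \<le> 1 * \<bar>t * y\<bar>"
        using cmod_iexp_diff_le[of "- t * y" 0] E by (intro mult_mono) auto
      also have "1 * \<bar>t * y\<bar> \<le> \<delta> * h0" using tb y by (simp add: abs_mult mult_mono)
      also have "1 - E \<le> (h0 * \<delta>)\<^sup>2 / 2"
      proof -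
        have "\<bar>h * t\<bar> \<le> \<bar>h0 * \<delta>\<bar>" using hh h tb \<delta> by (simp add: abs_mult mult_mono)
        then have "(h * t)\<^sup>2 \<le> (h0 * \<delta>)\<^sup>2" by (simp add: abs_le_square_iff)
        then show ?thesis using E(3) by linarith
      qed
      finally show ?thesis by (simp add: E_def \<eta>_def)
    qed
    have JJ: "cmod (J - J0 k) \<le> \<eta> * (LBINT t. indicator {-\<delta><..<\<delta>} t * cmod (char D t) ^ k)"
    proof -
      have diff: "J - J0 k = (CLBINT t. indicator {-\<delta><..<\<delta>} t *\<^sub>R ?w t - indicator {-\<delta><..<\<delta>} t *\<^sub>R char D t ^ k)"
        unfolding J_def J0_def by (rule Bochner_Integration.integral_diff[OF intJ int0, symmetric])
      have "cmod (J - J0 k) \<le> (LBINT t. cmod (indicator {-\<delta><..<\<delta>} t *\<^sub>R ?w t - indicator {-\<delta><..<\<delta>} t *\<^sub>R char D t ^ k))"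
        unfolding diff by (rule integral_norm_bound)
      also have "\<dots> \<le> (LBINT t. \<eta> * (indicator {-\<delta><..<\<delta>} t * cmod (char D t) ^ k))"
      proof (rule integral_mono)
        show "integrable lborel (\<lambda>t. cmod (indicator {-\<delta><..<\<delta>} t *\<^sub>R ?w t - indicator {-\<delta><..<\<delta>} t *\<^sub>R char D t ^ k))"
          by (rule integrable_norm[OF Bochner_Integration.integrable_diff[OF intJ int0]])
        show "integrable lborel (\<lambda>t. \<eta> * (indicator {-\<delta><..<\<delta>} t * cmod (char D t) ^ k))"
          by (rule integrable_mult_right[OF intc])
        fix t
        show "cmod (indicator {-\<delta><..<\<delta>} t *\<^sub>R ?w t - indicator {-\<delta><..<\<delta>} t *\<^sub>R char D t ^ k) \<le> \<eta> * (indicator {-\<delta><..<\<delta>} t * cmod (char D t) ^ k)"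
        proof (cases "t \<in> {-\<delta><..<\<delta>}")
          case True
          have eq: "?w t - char D t ^ k = (complex_of_real (exp (- (h * t)\<^sup>2 / 2)) * iexp (- t * y) - 1) * char D t ^ k"
            unfolding scaleR_conv_of_real char_\<nu> by (simp only: left_diff_distrib mult.assoc mult_1_left)
          have "cmod (?w t - char D t ^ k) \<le> \<eta> * cmod (char D t) ^ k"
            unfolding eq norm_mult norm_power using wbound[OF True] by (rule mult_right_mono) simp
          then show ?thesis using True by (simp only: indicator_simps scaleR_one mult_1_left)
        qed simp
      qed
      also have "\<dots> = \<eta> * (LBINT t. indicator {-\<delta><..<\<delta>} t * cmod (char D t) ^ k)" by simp
      finally show ?thesis .
    qed
    have s2: "A k * cmod (J - J0 k) \<le> \<eta> * B"
    proof -
      have "\<eta> \<ge> 0" using h0(1) \<delta> by (simp add: \<eta>_def)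
      have "A k * cmod (J - J0 k) \<le> A k * (\<eta> * (LBINT t. indicator {-\<delta><..<\<delta>} t * cmod (char D t) ^ k))"
        using JJ Ak by (intro mult_left_mono) auto
      also have "\<dots> = \<eta> * (A k * (LBINT t. indicator {-\<delta><..<\<delta>} t * cmod (char D t) ^ k))" by simp
      also have "\<dots> \<le> \<eta> * B" using bd[OF kK(1)] \<open>\<eta> \<ge> 0\<close> by (intro mult_left_mono)
      finally show ?thesis .
    qed
    define q where "q = complex_of_real (1 / (2 * pi))"
    have q: "cmod q \<le> 1" using pi_gt3 by (simp add: q_def norm_divide)
    have fq: "complex_of_real (fX 0) = q * Z" unfolding fX_0_eq Z_def q_def by simp
    have s1': "cmod (complex_of_real (gauss_smooth (\<nu> k) h y) - q * J) \<le> \<rho> ^ k / h"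
      using s1 by (simp add: q_def)
    have "complex_of_real (A k * gauss_smooth (\<nu> k) h y - fX 0)
        = A k *\<^sub>R (complex_of_real (gauss_smooth (\<nu> k) h y) - q * J) + (q * (A k *\<^sub>R (J - J0 k)) + q * (A k *\<^sub>R J0 k - Z))"
      unfolding of_real_diff of_real_mult fq scaleR_conv_of_real by (simp add: algebra_simps)
    then have "\<bar>A k * gauss_smooth (\<nu> k) h y - fX 0\<bar>
        = cmod (A k *\<^sub>R (complex_of_real (gauss_smooth (\<nu> k) h y) - q * J) + (q * (A k *\<^sub>R (J - J0 k)) + q * (A k *\<^sub>R J0 k - Z)))"
      by (metis norm_of_real)
    also have "\<dots> \<le> cmod (A k *\<^sub>R (complex_of_real (gauss_smooth (\<nu> k) h y) - q * J))
         + (cmod (q * (A k *\<^sub>R (J - J0 k))) + cmod (q * (A k *\<^sub>R J0 k - Z)))"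
      by (intro order_trans[OF norm_triangle_ineq] add_left_mono norm_triangle_ineq)
    finally have tri: "\<bar>A k * gauss_smooth (\<nu> k) h y - fX 0\<bar> \<le> cmod (A k *\<^sub>R (complex_of_real (gauss_smooth (\<nu> k) h y) - q * J))
         + (cmod (q * (A k *\<^sub>R (J - J0 k))) + cmod (q * (A k *\<^sub>R J0 k - Z)))" .
    have t2: "cmod (q * (A k *\<^sub>R (J - J0 k))) \<le> 1 * (\<eta> * B)"
      unfolding norm_mult using q s2 Ak by (intro mult_mono) auto
    have t3: "cmod (q * (A k *\<^sub>R J0 k - Z)) \<le> 1 * (e / 3)"
      unfolding norm_mult using q k0(2)[OF k] by (intro mult_mono) auto
    have t1: "cmod (A k *\<^sub>R (complex_of_real (gauss_smooth (\<nu> k) h y) - q * J)) \<le> e / 3"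
    proof -
      have "cmod (A k *\<^sub>R (complex_of_real (gauss_smooth (\<nu> k) h y) - q * J)) \<le> A k * (\<rho> ^ k / h)"
        unfolding norm_scaleR using mult_left_mono[OF s1', of "A k"] Ak by (simp only: abs_of_pos less_imp_le)
      also have "\<dots> \<le> (C * (1 + real k)) * (\<rho> ^ k / (b / (real k)\<^sup>2))"
        using C(3)[OF kK(2)] C(1) hb b kK \<rho>(1) h Ak
        by (intro mult_mono divide_left_mono) auto
      also have "\<dots> = C * (1 + real k) * \<rho> ^ k * (real k)\<^sup>2 / b" by simp
      also have "\<dots> \<le> e / 3" using k0(3)[OF k] by simp
      finally show ?thesis .
    qed
    have "\<eta> * B < e / 3" using h0(2) by (simp only: \<eta>_def)
    then show "\<bar>A k * gauss_smooth (\<nu> k) h y - fX 0\<bar> \<le> e" using tri t1 t2 t3 by linarith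
  qed
qed

text \<open>The Cramer bound \<open>\<rho> ^ k\<close> on the high frequencies beats every power of \<open>k\<close>; this is what
  allows windows that shrink like \<open>1 / k\<^sup>2\<close>.\<close>
lemma local_limit:
  assumes e: "0 < e"
  obtains e0 where "0 < e0"
    "\<And>\<epsilon> k y. 0 < \<epsilon> \<Longrightarrow> \<epsilon> < e0 \<Longrightarrow> 1 \<le> \<epsilon> * (real k)\<^sup>2 \<Longrightarrow> \<bar>y\<bar> \<le> \<epsilon> \<Longrightarrow>
       \<bar>A k * measure (\<nu> k) {y-\<epsilon><..<y+\<epsilon>} / (2 * \<epsilon>) - fX 0\<bar> \<le> e"
proof -
  define f0 where "f0 = fX 0"
  \<comment> \<open>With the smoothing scale h = \<epsilon> / R^2, the length of R standard
    deviations is \<epsilon> / R. Edge losses and Gaussian tails both vanish as R grows, so one R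
    serves all \<epsilon> and k.\<close>
  have l1: "((\<lambda>R::real. (f0 + 1 / R) * (1 + 1 / R) / (1 - sqrt 2 * exp (- (R\<^sup>2) / 4))) \<longlongrightarrow> f0) at_top"
    by real_asymp
  have l2: "((\<lambda>R::real. (f0 - 1 / R) * (1 - 1 / R) - sqrt 2 * exp (- (R\<^sup>2) / 4) * ((f0 + 1 / R) * (1 - 1 / R))) \<longlongrightarrow> f0) at_top"
    by real_asymp
  have l3: "((\<lambda>R::real. sqrt 2 * exp (- (R\<^sup>2) / 4)) \<longlongrightarrow> 0) at_top" by real_asymp
  have "\<forall>\<^sub>F R in at_top. (f0 + 1 / R) * (1 + 1 / R) / (1 - sqrt 2 * exp (- (R\<^sup>2) / 4)) < f0 + e"
    using l1 e by (intro order_tendstoD) auto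
  moreover have "\<forall>\<^sub>F R in at_top. f0 - e < (f0 - 1 / R) * (1 - 1 / R) - sqrt 2 * exp (- (R\<^sup>2) / 4) * ((f0 + 1 / R) * (1 - 1 / R))"
    using l2 e by (intro order_tendstoD) auto
  moreover have "\<forall>\<^sub>F R::real in at_top. sqrt 2 * exp (- (R\<^sup>2) / 4) < 1" using l3 by (intro order_tendstoD) auto
  moreover have "\<forall>\<^sub>F R::real in at_top. 1 < R" by (rule eventually_gt_at_top)
  ultimately have "\<forall>\<^sub>F R in at_top. 1 < R \<and> sqrt 2 * exp (- (R\<^sup>2) / 4) < 1 \<and>
    (f0 + 1 / R) * (1 + 1 / R) / (1 - sqrt 2 * exp (- (R\<^sup>2) / 4)) < f0 + e \<and>
    f0 - e < (f0 - 1 / R) * (1 - 1 / R) - sqrt 2 * exp (- (R\<^sup>2) / 4) * ((f0 + 1 / R) * (1 - 1 / R))"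
    by eventually_elim simp
  then obtain R where R: "1 < R" "sqrt 2 * exp (- (R\<^sup>2) / 4) < 1"
    "(f0 + 1 / R) * (1 + 1 / R) / (1 - sqrt 2 * exp (- (R\<^sup>2) / 4)) < f0 + e"
    "f0 - e < (f0 - 1 / R) * (1 - 1 / R) - sqrt 2 * exp (- (R\<^sup>2) / 4) * ((f0 + 1 / R) * (1 - 1 / R))"
    using eventually_happens[of _ "at_top :: real filter"] by (metis (no_types, lifting) trivial_limit_at_top_linorder)
  define \<tau> where "\<tau> = sqrt 2 * exp (- (R\<^sup>2) / 4)"
  obtain k0 h0 where k0: "1 \<le> k0" "0 < h0"
    "\<And>k h y. k0 \<le> k \<Longrightarrow> (1 / R\<^sup>2) / (real k)\<^sup>2 \<le> h \<Longrightarrow> h \<le> h0 \<Longrightarrow> \<bar>y\<bar> \<le> h0 \<Longrightarrow> \<bar>A k * gauss_smooth (\<nu> k) h y - fX 0\<bar> \<le> 1 / R"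
    using smooth_llt[of "1 / R\<^sup>2" "1 / R"] R(1) by auto
  show ?thesis
  \<comment> \<open>The smoothed density is read only within 3 \<epsilon> of 0, hence h0 / 3. The
    other bound turns 1 \<le> \<epsilon> * k^2 into k0 \<le> k.\<close>
  proof (rule that[of "min (h0 / 3) (1 / (real k0)\<^sup>2)"])
    show "0 < min (h0 / 3) (1 / (real k0)\<^sup>2)" using k0 by simp
    fix \<epsilon> k y
    assume \<epsilon>: "0 < \<epsilon>" "\<epsilon> < min (h0 / 3) (1 / (real k0)\<^sup>2)" and k: "1 \<le> \<epsilon> * (real k)\<^sup>2" and y: "\<bar>y\<bar> \<le> \<epsilon>"
    interpret nu: real_distribution "\<nu> k" by (rule \<nu>)
    have kk0: "k0 \<le> k"
    proof (rule ccontr)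
      assume "\<not> k0 \<le> k"
      then have "(real k)\<^sup>2 \<le> (real k0)\<^sup>2" by (intro power_mono) auto
      then have "\<epsilon> * (real k)\<^sup>2 \<le> \<epsilon> * (real k0)\<^sup>2" using \<epsilon> by (intro mult_left_mono) auto
      also have "\<dots> < 1" using \<epsilon> k0(1) by (simp add: field_simps)
      finally show False using k by simp
    qed
    have Ak: "0 < A k" using A_pos kk0 k0(1) by auto
    have kpos: "0 < real k" using kk0 k0(1) by auto
    define h where "h = \<epsilon> / R\<^sup>2"
    have h: "0 < h" using \<epsilon> R by (simp add: h_def)
    have hR: "h * R = \<epsilon> / R" using R by (simp add: h_def power2_eq_square)
    have eR: "\<epsilon> / R < \<epsilon>" "0 < \<epsilon> / R" using \<epsilon> R by (simp_all add: field_simps)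
    have near: "\<bar>y'\<bar> \<le> h0" if "y' \<in> {y-\<epsilon>-h*R..y+\<epsilon>+h*R} \<or> y' \<in> {y-\<epsilon>+h*R..y+\<epsilon>-h*R}" for y'
    proof -
      have "\<epsilon> < h0 / 3" using \<epsilon>(2) by simp
      then show ?thesis using that y eR unfolding hR by auto
    qed
    have "(1 / R\<^sup>2) / (real k)\<^sup>2 \<le> h"
      using k kpos R by (simp add: h_def divide_le_eq mult.commute)
    moreover have hs: "h \<le> sqrt 2 * h" using h by simp
    moreover have "sqrt 2 * h \<le> h0"
    proof -
      have "sqrt 2 \<le> sqrt 4" by (subst real_sqrt_le_iff) simp
      then have s2: "sqrt 2 \<le> 2" by simp
      have "1 \<le> R\<^sup>2" using R(1) by simp
      then have "h \<le> \<epsilon>" using \<epsilon>(1) by (simp add: h_def divide_le_eq mult_le_cancel_left1)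
      then have "sqrt 2 * h \<le> 2 * \<epsilon>" using s2 h by (intro mult_mono) auto
      then show ?thesis using \<epsilon> by simp
    qed
    ultimately have sm: "\<bar>A k * gauss_smooth (\<nu> k) h y' - f0\<bar> \<le> 1 / R"
       "\<bar>A k * gauss_smooth (\<nu> k) (sqrt 2 * h) y' - f0\<bar> \<le> 1 / R" if "\<bar>y'\<bar> \<le> h0" for y'
      using k0(3)[OF kk0, of h y'] k0(3)[OF kk0, of "sqrt 2 * h" y'] that unfolding f0_def by linarith+
    have ub: "gauss_smooth (\<nu> k) h y' \<le> (f0 + 1 / R) / A k" "gauss_smooth (\<nu> k) (sqrt 2 * h) y' \<le> (f0 + 1 / R) / A k"
      "(f0 - 1 / R) / A k \<le> gauss_smooth (\<nu> k) h y'" if "\<bar>y'\<bar> \<le> h0" for y'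
    proof -
      have "A k * gauss_smooth (\<nu> k) h y' \<le> f0 + 1 / R" "A k * gauss_smooth (\<nu> k) (sqrt 2 * h) y' \<le> f0 + 1 / R"
        "f0 - 1 / R \<le> A k * gauss_smooth (\<nu> k) h y'" using sm[OF that] by linarith+
      then show "gauss_smooth (\<nu> k) h y' \<le> (f0 + 1 / R) / A k" "gauss_smooth (\<nu> k) (sqrt 2 * h) y' \<le> (f0 + 1 / R) / A k"
        "(f0 - 1 / R) / A k \<le> gauss_smooth (\<nu> k) h y'" using Ak by (simp_all add: pos_le_divide_eq pos_divide_le_eq mult.commute)
    qed
    define m where "m = measure (\<nu> k) {y-\<epsilon><..<y+\<epsilon>}"
    have "(1 - \<tau>) * m \<le> (f0 + 1 / R) / A k * (2 * (\<epsilon> + h * R))"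
      unfolding \<tau>_def m_def
      by (rule nu.desmooth_upper[OF h]) (use R \<epsilon> eR hR in \<open>auto intro!: ub near\<close>)
    then have "(1 - \<tau>) * m * (A k / (2 * \<epsilon>)) \<le> (f0 + 1 / R) / A k * (2 * (\<epsilon> + h * R)) * (A k / (2 * \<epsilon>))"
      using Ak \<epsilon> by (intro mult_right_mono) auto
    also have "\<dots> = (f0 + 1 / R) * (1 + 1 / R)"
    proof -
      have "2 * (\<epsilon> + h * R) * (1 / (2 * \<epsilon>)) = 1 + 1 / R" unfolding hR using \<epsilon> by (simp add: field_simps)
      moreover have "(f0 + 1 / R) / A k * (2 * (\<epsilon> + h * R)) * (A k / (2 * \<epsilon>)) = (f0 + 1 / R) * (2 * (\<epsilon> + h * R) * (1 / (2 * \<epsilon>)))"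
        using Ak by simp
      ultimately show ?thesis by (simp only:)
    qed
    finally have "(1 - \<tau>) * (A k * m / (2 * \<epsilon>)) \<le> (f0 + 1 / R) * (1 + 1 / R)" by (simp add: mult_ac)
    moreover have "0 < 1 - \<tau>" using R by (simp add: \<tau>_def)
    ultimately have "A k * m / (2 * \<epsilon>) \<le> (f0 + 1 / R) * (1 + 1 / R) / (1 - \<tau>)"
      by (simp add: pos_le_divide_eq mult.commute)
    then have up: "A k * m / (2 * \<epsilon>) \<le> f0 + e" using R(3) unfolding \<tau>_def by linarith
    have "(f0 - 1 / R) / A k * (2 * (\<epsilon> - h * R)) \<le> m + \<tau> * ((f0 + 1 / R) / A k * (2 * (\<epsilon> - h * R)))"
      unfolding \<tau>_def m_def
      by (rule nu.desmooth_lower[OF h]) (use R \<epsilon> eR hR in \<open>auto intro!: ub near\<close>)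
    then have "((f0 - 1 / R) / A k * (2 * (\<epsilon> - h * R)) - \<tau> * ((f0 + 1 / R) / A k * (2 * (\<epsilon> - h * R)))) * (A k / (2 * \<epsilon>)) \<le> m * (A k / (2 * \<epsilon>))"
      using Ak \<epsilon> by (intro mult_right_mono) auto
    also have "((f0 - 1 / R) / A k * (2 * (\<epsilon> - h * R)) - \<tau> * ((f0 + 1 / R) / A k * (2 * (\<epsilon> - h * R)))) * (A k / (2 * \<epsilon>))
       = (f0 - 1 / R) * (1 - 1 / R) - \<tau> * ((f0 + 1 / R) * (1 - 1 / R))"
    proof -
      have "2 * (\<epsilon> - h * R) * (1 / (2 * \<epsilon>)) = 1 - 1 / R" unfolding hR using \<epsilon> by (simp add: field_simps)
      moreover have "p / A k * (2 * (\<epsilon> - h * R)) * (A k / (2 * \<epsilon>)) = p * (2 * (\<epsilon> - h * R) * (1 / (2 * \<epsilon>)))" for p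
        using Ak by simp
      ultimately have *: "p / A k * (2 * (\<epsilon> - h * R)) * (A k / (2 * \<epsilon>)) = p * (1 - 1 / R)" for p
        by (simp only:)
      have "((f0 - 1 / R) / A k * (2 * (\<epsilon> - h * R)) - \<tau> * ((f0 + 1 / R) / A k * (2 * (\<epsilon> - h * R)))) * (A k / (2 * \<epsilon>))
         = (f0 - 1 / R) / A k * (2 * (\<epsilon> - h * R)) * (A k / (2 * \<epsilon>)) - \<tau> * ((f0 + 1 / R) / A k * (2 * (\<epsilon> - h * R)) * (A k / (2 * \<epsilon>)))"
        by (simp only: left_diff_distrib mult.assoc)
      then show ?thesis by (simp only: *)
    qed
    finally have "(f0 - 1 / R) * (1 - 1 / R) - \<tau> * ((f0 + 1 / R) * (1 - 1 / R)) \<le> A k * m / (2 * \<epsilon>)"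
      by (simp add: mult.commute)
    then have "f0 - e \<le> A k * m / (2 * \<epsilon>)" using R(4) unfolding \<tau>_def by linarith
    then show "\<bar>A k * measure (\<nu> k) {y-\<epsilon><..<y+\<epsilon>} / (2 * \<epsilon>) - fX 0\<bar> \<le> e"
      using up unfolding m_def f0_def by linarith
  qed
qed

end

section \<open>A concentration bound for all times\<close>

context attracted_walk
begin

text \<open>Crude, but valid for every k and every centre; it covers the times before the local
  limit theorem applies. The constant is 5 * 2, as the modulus of a characteristic function
  integrates to at most 2 over (-1, 1).\<close>

lemma concentration_bound:
  obtains C \<rho> where "0 < C" "0 < \<rho>" "\<rho> < 1"
    "\<And>k \<epsilon> y. 0 < \<epsilon> \<Longrightarrow> measure (\<nu> k) {y-\<epsilon>..y+\<epsilon>} \<le> C * (\<epsilon> + \<rho> ^ k)"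
proof -
  obtain \<rho> where \<rho>: "0 < \<rho>" "\<rho> < 1" "\<And>t. 1 \<le> \<bar>t\<bar> \<Longrightarrow> cmod (char D t) \<le> \<rho>"
    using D.cramer_bound[OF cramer, of 1] by auto
  show ?thesis
  proof (rule that[of 10 \<rho>])
    fix k y and \<epsilon> :: real assume \<epsilon>: "0 < \<epsilon>"
    interpret nu: real_distribution "\<nu> k" by (rule \<nu>)
    let ?I = "LBINT t. indicator {-1<..<1} t * cmod (char (\<nu> k) t)"
    have "measure (\<nu> k) {y-\<epsilon>..y+\<epsilon>} \<le> 5 * (\<epsilon> * ?I + \<rho> ^ k)"
      by (rule nu.concentration[OF \<epsilon>]) (use \<rho> in \<open>auto simp: char_\<nu> norm_power intro!: power_mono\<close>)
    moreover have "?I \<le> 2"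
    proof -
      have "?I \<le> (LBINT t. indicator {-1<..<1::real} t)"
      proof (rule integral_mono)
        show "integrable lborel (\<lambda>t. indicator {-1<..<1} t * cmod (char (\<nu> k) t))"
          by (rule integrableI_bounded_set[where A="{-1<..<1}" and B=1])
             (use emeasure_lborel_box_finite[of "-1" "1::real"] nu.cmod_char_le_1 in \<open>auto simp: indicator_def less_top\<close>)
      qed (use nu.cmod_char_le_1 in \<open>auto split: split_indicator\<close>)
      then show ?thesis by simp
    qed
    then have "\<epsilon> * ?I \<le> \<epsilon> * 2" using \<epsilon> by (intro mult_left_mono) auto
    ultimately show "measure (\<nu> k) {y-\<epsilon>..y+\<epsilon>} \<le> 10 * (\<epsilon> + \<rho> ^ k)"
      using zero_less_power[OF \<rho>(1), of k] by (simp add: algebra_simps)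
  qed (use \<rho> in auto)
qed

end

section \<open>Positivity of the limit density at the origin\<close>

context attracted_walk_density
begin

text \<open>Strict stability, a consequence of norming without centring. The 2 n-th power on the
  scale A n is the square of the n-th; on its own scale A (2 n) it is taken at an argument
  multiplied by A (2 n) / A n, which tends to 2 powr (1 / \<alpha>).\<close>

lemma char_\<mu>X_square: "(char \<mu>X t)\<^sup>2 = char \<mu>X (2 powr (1 / \<alpha>) * t)"
proof (rule LIMSEQ_unique)
  define q where "q = 2 powr (1 / \<alpha>)"
  define r where "r n = A (2 * n) / A n" for n
  have two: "filterlim (\<lambda>n::nat. 2 * n) sequentially sequentially" by real_asymp
  have "(\<lambda>n. char D (t / A n) ^ n) \<longlonglongrightarrow> char \<mu>X t"
    by (rule tendsto_uniform_limitI[OF ulim[of "\<bar>t\<bar>"]]) auto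
  then have "(\<lambda>n. (char D (t / A n) ^ n)\<^sup>2) \<longlonglongrightarrow> (char \<mu>X t)\<^sup>2" by (intro tendsto_intros)
  then show "(\<lambda>n. char D (t / A n) ^ (2 * n)) \<longlonglongrightarrow> (char \<mu>X t)\<^sup>2"
    by (simp add: power_mult[symmetric] mult.commute)
  have "(\<lambda>n. real (2 * n) / real n) \<longlonglongrightarrow> 2" by real_asymp
  then have "(\<lambda>n. A n / A (2 * n)) \<longlonglongrightarrow> 2 powr (- 1 / \<alpha>)" by (rule ratio_tendsto) simp
  then have "(\<lambda>n. inverse (A n / A (2 * n))) \<longlonglongrightarrow> inverse (2 powr (- 1 / \<alpha>))" by (intro tendsto_inverse) auto
  then have r: "r \<longlonglongrightarrow> q" by (simp add: r_def[abs_def] q_def powr_minus)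
  have s: "(\<lambda>n. r n * t) \<longlonglongrightarrow> q * t" using r by (intro tendsto_intros)
  \<comment> \<open>A compact interval that eventually contains the moving argument r n * t.\<close>
  define T where "T = \<bar>q * t\<bar> + 1"
  have "\<forall>\<^sub>F n in sequentially. \<bar>r n * t - q * t\<bar> < 1"
    using tendstoD[OF s, of 1] by (simp add: dist_real_def)
  then have evT: "\<forall>\<^sub>F n in sequentially. r n * t \<in> {-T..T}"
    by eventually_elim (auto simp: T_def)
  have 1: "(\<lambda>n. char D (r n * t / A (2 * n)) ^ (2 * n) - char \<mu>X (r n * t)) \<longlonglongrightarrow> 0"
  proof (rule tendstoI)
    fix e :: real assume e: "0 < e"
    have "\<forall>\<^sub>F n in sequentially. \<forall>x\<in>{-T..T}. dist (char D (x / A (2 * n)) ^ (2 * n)) (char \<mu>X x) < e"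
      using eventually_compose_filterlim[OF uniform_limitD[OF ulim[of T] e] two] .
    then show "\<forall>\<^sub>F n in sequentially. dist (char D (r n * t / A (2 * n)) ^ (2 * n) - char \<mu>X (r n * t)) 0 < e"
      using evT by eventually_elim (simp only: dist_norm diff_0_right Ball_def)
  qed
  have 2: "(\<lambda>n. char \<mu>X (r n * t)) \<longlonglongrightarrow> char \<mu>X (q * t)"
    using real_distribution.isCont_char[OF \<mu>X] s by (rule isCont_tendsto_compose)
  have "(\<lambda>n. char D (r n * t / A (2 * n)) ^ (2 * n)) \<longlonglongrightarrow> char \<mu>X (q * t)"
    using tendsto_add[OF 1 2] by simp
  moreover have "\<forall>\<^sub>F n in sequentially. char D (r n * t / A (2 * n)) ^ (2 * n) = char D (t / A n) ^ (2 * n)"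
    using eventually_gt_at_top[of 0]
  proof eventually_elim
    case (elim n)
    have "0 < A (2 * n)" "0 < A n" using A_pos[of "2 * n"] A_pos[of n] elim by auto
    then show ?case by (simp add: r_def)
  qed
  ultimately show "(\<lambda>n. char D (t / A n) ^ (2 * n)) \<longlonglongrightarrow> char \<mu>X (2 powr (1 / \<alpha>) * t)"
    unfolding q_def by (rule Lim_transform_eventually)
qed

text \<open>Strict stability as an equality of laws, the form in which masses near a point can be
  compared.\<close>

lemma sum_law: "distr (\<mu>X \<Otimes>\<^sub>M \<mu>X) borel (\<lambda>p. fst p + snd p) = distr \<mu>X borel (\<lambda>x. 2 powr (1 / \<alpha>) * x)"
proof (rule Levy_uniqueness)
  interpret X: real_distribution \<mu>X by (rule \<mu>X)
  interpret P: pair_prob_space \<mu>X \<mu>X ..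
  have m [measurable]: "(\<lambda>p. fst p + snd p) \<in> borel_measurable (\<mu>X \<Otimes>\<^sub>M \<mu>X)" by measurable
  show "real_distribution (distr (\<mu>X \<Otimes>\<^sub>M \<mu>X) borel (\<lambda>p. fst p + snd p))" by (rule P.real_distribution_distr) simp
  show "real_distribution (distr \<mu>X borel (\<lambda>x. 2 powr (1 / \<alpha>) * x))" by (rule X.real_distribution_distr) simp
  show "char (distr (\<mu>X \<Otimes>\<^sub>M \<mu>X) borel (\<lambda>p. fst p + snd p)) = char (distr \<mu>X borel (\<lambda>x. 2 powr (1 / \<alpha>) * x))"
  proof
    fix t
    have int: "integrable (\<mu>X \<Otimes>\<^sub>M \<mu>X) (\<lambda>p. iexp (t * (fst p + snd p)))"
      by (rule P.integrable_const_bound[where B=1]) (auto simp del: of_real_mult)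
    have "char (distr (\<mu>X \<Otimes>\<^sub>M \<mu>X) borel (\<lambda>p. fst p + snd p)) t = (\<integral>p. iexp (t * (fst p + snd p)) \<partial>(\<mu>X \<Otimes>\<^sub>M \<mu>X))"
      unfolding char_def by (subst integral_distr) auto
    also have "\<dots> = (\<integral>x. (\<integral>y. iexp (t * (x + y)) \<partial>\<mu>X) \<partial>\<mu>X)"
      using P.integral_fst'[OF int] by (simp only: fst_conv snd_conv)
    also have "\<dots> = (\<integral>x. iexp (t * x) * char \<mu>X t \<partial>\<mu>X)"
    proof (intro Bochner_Integration.integral_cong refl)
      fix x
      have "(\<integral>y. iexp (t * (x + y)) \<partial>\<mu>X) = (\<integral>y. iexp (t * x) * iexp (t * y) \<partial>\<mu>X)"
        by (intro Bochner_Integration.integral_cong refl) (simp only: distrib_left of_real_add exp_add)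
      then show "(\<integral>y. iexp (t * (x + y)) \<partial>\<mu>X) = iexp (t * x) * char \<mu>X t" by (simp add: char_def)
    qed
    also have "\<dots> = (char \<mu>X t)\<^sup>2" by (simp add: char_def power2_eq_square)
    also have "\<dots> = char (distr \<mu>X borel (\<lambda>x. 2 powr (1 / \<alpha>) * x)) t"
      unfolding char_\<mu>X_square unfolding char_def by (subst integral_distr) (auto simp: mult_ac)
    finally show "char (distr (\<mu>X \<Otimes>\<^sub>M \<mu>X) borel (\<lambda>p. fst p + snd p)) t = char (distr \<mu>X borel (\<lambda>x. 2 powr (1 / \<alpha>) * x)) t" .
  qed
qed

lemma emeasure_\<mu>X: "S \<in> sets borel \<Longrightarrow> emeasure \<mu>X S = (\<integral>\<^sup>+x. ennreal (fX x) * indicator S x \<partial>lborel)"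
  unfolding density by (rule emeasure_density) auto

lemma \<mu>X_Icc_ge:
  assumes "0 \<le> m" "a \<le> b" "\<And>x. x \<in> {a..b} \<Longrightarrow> m \<le> fX x"
  shows "ennreal (m * (b - a)) \<le> emeasure \<mu>X {a..b}"
proof -
  have "ennreal (m * (b - a)) = (\<integral>\<^sup>+x. ennreal m * indicator {a..b} x \<partial>lborel)"
    using assms by (simp add: nn_integral_cmult_indicator ennreal_mult')
  also have "\<dots> \<le> (\<integral>\<^sup>+x. ennreal (fX x) * indicator {a..b} x \<partial>lborel)"
    using assms by (intro nn_integral_mono) (auto simp: indicator_def ennreal_leI)
  finally show ?thesis by (simp add: emeasure_\<mu>X)
qed

lemma \<mu>X_Icc_le:
  assumes "0 \<le> m" "a \<le> b" "\<And>x. x \<in> {a..b} \<Longrightarrow> fX x \<le> m"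
  shows "emeasure \<mu>X {a..b} \<le> ennreal (m * (b - a))"
proof -
  have "ennreal (m * (b - a)) = (\<integral>\<^sup>+x. ennreal m * indicator {a..b} x \<partial>lborel)"
    using assms by (simp add: nn_integral_cmult_indicator ennreal_mult')
  moreover have "(\<integral>\<^sup>+x. ennreal (fX x) * indicator {a..b} x \<partial>lborel) \<le> \<dots>"
    using assms by (intro nn_integral_mono) (auto simp: indicator_def ennreal_leI)
  ultimately show ?thesis by (simp add: emeasure_\<mu>X)
qed

lemma fX_lower_near:
  assumes "0 < fX x"
  obtains r where "0 < r" "\<And>x'. \<bar>x' - x\<bar> \<le> r \<Longrightarrow> fX x / 2 \<le> fX x'"
proof -
  have "isCont fX x" using fX_cont by (simp add: continuous_on_eq_continuous_at)
  then obtain d where d: "0 < d" "\<forall>x'. \<bar>x' - x\<bar> < d \<longrightarrow> \<bar>fX x' - fX x\<bar> < fX x / 2"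
    using assms unfolding continuous_at_eps_delta dist_real_def by (metis half_gt_zero)
  show ?thesis
  proof (rule that[of "d / 2"])
    fix x' assume "\<bar>x' - x\<bar> \<le> d / 2"
    then have "\<bar>fX x' - fX x\<bar> < fX x / 2" using d by auto
    then show "fX x / 2 \<le> fX x'" by linarith
  qed (use d in auto)
qed

text \<open>If fX vanished at w, the scaled copy in \<open>sum_law\<close> would give the
  \<eta>-neighbourhood of x + y a mass o(\<eta>), whereas two independent copies near x and y give
  it a mass of order \<eta>.\<close>

lemma fX_pos_add:
  assumes x: "0 < fX x" and y: "0 < fX y"
  shows "0 < fX ((x + y) / 2 powr (1 / \<alpha>))"
proof (rule ccontr)
  interpret X: real_distribution \<mu>X by (rule \<mu>X)
  interpret P: pair_prob_space \<mu>X \<mu>X ..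
  define q where "q = 2 powr (1 / \<alpha>)"
  have q: "0 < q" by (simp add: q_def)
  define w where "w = (x + y) / q"
  assume "\<not> 0 < fX ((x + y) / 2 powr (1 / \<alpha>))"
  then have fw: "fX w = 0" using fX_nonneg[of w] by (simp add: w_def q_def)
  obtain r1 where r1: "0 < r1" "\<And>x'. \<bar>x' - x\<bar> \<le> r1 \<Longrightarrow> fX x / 2 \<le> fX x'" using fX_lower_near[OF x] by blast
  obtain r2 where r2: "0 < r2" "\<And>x'. \<bar>x' - y\<bar> \<le> r2 \<Longrightarrow> fX y / 2 \<le> fX x'" using fX_lower_near[OF y] by blast
  define r where "r = min r1 r2"
  define m where "m = min (fX x) (fX y) / 2"
  have r: "0 < r" and m: "0 < m" using r1 r2 x y by (auto simp: r_def m_def)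
  have fx: "m \<le> fX u" if "\<bar>u - x\<bar> \<le> r" for u using r1(2)[of u] that by (auto simp: r_def m_def)
  have fy: "m \<le> fX u" if "\<bar>u - y\<bar> \<le> r" for u using r2(2)[of u] that by (auto simp: r_def m_def)
  \<comment> \<open>Makes the upper bound 2 \<kappa> \<eta> / q exactly half of the lower bound,
    which is the product of m * r / 2 for the first copy and 2 * m * \<eta> for the second.\<close>
  define \<kappa> where "\<kappa> = m * m * r * q / 4"
  have \<kappa>: "0 < \<kappa>" using m r q by (simp add: \<kappa>_def)
  have "isCont fX w" using fX_cont by (simp add: continuous_on_eq_continuous_at)
  then obtain d where d: "0 < d" "\<forall>x'. \<bar>x' - w\<bar> < d \<longrightarrow> \<bar>fX x' - fX w\<bar> < \<kappa>"
    using \<kappa> unfolding continuous_at_eps_delta dist_real_def by blast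
  define \<eta> where "\<eta> = min (r / 2) (q * d / 2)"
  have \<eta>: "0 < \<eta>" "\<eta> \<le> r / 2" "\<eta> / q < d"
  proof -
    show "0 < \<eta>" "\<eta> \<le> r / 2" using r q d by (auto simp: \<eta>_def)
    have "\<eta> \<le> q * d / 2" by (simp add: \<eta>_def)
    then show "\<eta> / q < d" using q d by (simp add: field_simps) (smt (verit) mult_pos_pos)
  qed
  define S where "S = {p. \<bar>fst p + snd p - (x + y)\<bar> \<le> \<eta>}"
  have Seq: "emeasure (\<mu>X \<Otimes>\<^sub>M \<mu>X) S = emeasure \<mu>X {w - \<eta> / q..w + \<eta> / q}"
  proof -
    have "emeasure (distr (\<mu>X \<Otimes>\<^sub>M \<mu>X) borel (\<lambda>p. fst p + snd p)) {x+y-\<eta>..x+y+\<eta>} = emeasure (distr \<mu>X borel (\<lambda>x. q * x)) {x+y-\<eta>..x+y+\<eta>}"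
      unfolding q_def sum_law ..
    moreover have "emeasure (distr (\<mu>X \<Otimes>\<^sub>M \<mu>X) borel (\<lambda>p. fst p + snd p)) {x+y-\<eta>..x+y+\<eta>} = emeasure (\<mu>X \<Otimes>\<^sub>M \<mu>X) S"
      by (subst emeasure_distr) (auto simp: S_def space_pair_measure abs_le_iff intro!: arg_cong[where f="emeasure (\<mu>X \<Otimes>\<^sub>M \<mu>X)"])
    moreover have "emeasure (distr \<mu>X borel (\<lambda>x. q * x)) {x+y-\<eta>..x+y+\<eta>} = emeasure \<mu>X {w - \<eta> / q..w + \<eta> / q}"
    proof -
      have "(\<lambda>x. q * x) -` {x+y-\<eta>..x+y+\<eta>} = {w - \<eta> / q..w + \<eta> / q}"
        unfolding w_def diff_divide_distrib[symmetric] add_divide_distrib[symmetric]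
        using q by (auto simp: pos_divide_le_eq pos_le_divide_eq mult.commute)
      then show ?thesis by (subst emeasure_distr) auto
    qed
    ultimately show ?thesis by simp
  qed
  have "emeasure \<mu>X {w - \<eta> / q..w + \<eta> / q} \<le> ennreal (\<kappa> * ((w + \<eta> / q) - (w - \<eta> / q)))"
  proof (rule \<mu>X_Icc_le)
    show "fX u \<le> \<kappa>" if "u \<in> {w - \<eta> / q..w + \<eta> / q}" for u
    proof -
      have "\<bar>u - w\<bar> \<le> \<eta> / q" using that by auto
      then have "\<bar>fX u - fX w\<bar> < \<kappa>" using d(2) \<eta>(3) by (meson le_less_trans)
      then show ?thesis using fw by linarith
    qed
  qed (use \<kappa> \<eta> q in auto)
  also have "\<kappa> * ((w + \<eta> / q) - (w - \<eta> / q)) = m * m * r * \<eta> / 2" using q by (simp add: \<kappa>_def)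
  finally have up: "emeasure (\<mu>X \<Otimes>\<^sub>M \<mu>X) S \<le> ennreal (m * m * r * \<eta> / 2)" using Seq by simp
  have Sm: "S \<in> sets (\<mu>X \<Otimes>\<^sub>M \<mu>X)"
  proof -
    have "S = {p \<in> space (\<mu>X \<Otimes>\<^sub>M \<mu>X). \<bar>fst p + snd p - (x + y)\<bar> \<le> \<eta>}" by (simp add: S_def space_pair_measure)
    also have "\<dots> \<in> sets (\<mu>X \<Otimes>\<^sub>M \<mu>X)" by measurable
    finally show ?thesis .
  qed
  have "ennreal (m * m * r * \<eta>) = ennreal (2 * m * \<eta>) * ennreal (m * ((x + r / 4) - (x - r / 4)))"
    using m r \<eta> by (simp add: ennreal_mult'[symmetric] mult_ac)
  also have "\<dots> \<le> ennreal (2 * m * \<eta>) * emeasure \<mu>X {x - r / 4..x + r / 4}"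
    using m r by (intro mult_left_mono \<mu>X_Icc_ge fx) auto
  also have "\<dots> = (\<integral>\<^sup>+u. ennreal (2 * m * \<eta>) * indicator {x - r / 4..x + r / 4} u \<partial>\<mu>X)"
    by (simp add: nn_integral_cmult_indicator)
  also have "\<dots> \<le> (\<integral>\<^sup>+u. emeasure \<mu>X (Pair u -` S) \<partial>\<mu>X)"
  proof (rule nn_integral_mono)
    fix u
    show "ennreal (2 * m * \<eta>) * indicator {x - r / 4..x + r / 4} u \<le> emeasure \<mu>X (Pair u -` S)"
    proof (cases "u \<in> {x - r / 4..x + r / 4}")
      case True
      have "Pair u -` S = {x + y - u - \<eta>..x + y - u + \<eta>}" by (auto simp: S_def)
      moreover have "ennreal (m * ((x + y - u + \<eta>) - (x + y - u - \<eta>))) \<le> emeasure \<mu>X {x + y - u - \<eta>..x + y - u + \<eta>}"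
      proof (rule \<mu>X_Icc_ge)
        show "m \<le> fX v" if "v \<in> {x + y - u - \<eta>..x + y - u + \<eta>}" for v
          by (rule fy) (use that True \<eta>(1,2) r in \<open>auto simp: abs_le_iff\<close>)
      qed (use m \<eta> in auto)
      ultimately show ?thesis using True by (simp add: mult_ac)
    qed simp
  qed
  also have "\<dots> = emeasure (\<mu>X \<Otimes>\<^sub>M \<mu>X) S" using Sm by (rule X.emeasure_pair_measure_alt[symmetric])
  also note up
  finally have "m * m * r * \<eta> \<le> m * m * r * \<eta> / 2" using m r \<eta> by (simp add: ennreal_le_iff)
  moreover have "0 < m * m * r * \<eta>" using m r \<eta> by simp
  ultimately show False by linarith
qed

text \<open>A one-sided limit law is impossible: with \<open>q = 2 powr (1 / \<alpha>)\<close>, its Laplace transform would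
  satisfy \<open>L(1)\<^sup>2 = L(q)\<close> by stability and \<open>L(q) \<ge> L(1) powr q\<close> by Jensen, although \<open>q < 2\<close>.\<close>
lemma fX_not_one_sided:
  assumes \<sigma>: "\<sigma> = 1 \<or> \<sigma> = (-1::real)"
  shows "\<exists>x. 0 < \<sigma> * x \<and> 0 < fX x"
proof (rule ccontr)
  interpret X: real_distribution \<mu>X by (rule \<mu>X)
  interpret P: pair_prob_space \<mu>X \<mu>X ..
  assume "\<not> (\<exists>x. 0 < \<sigma> * x \<and> 0 < fX x)"
  then have z: "fX x = 0" if "0 < \<sigma> * x" for x using that fX_nonneg[of x] by (metis antisym_conv1)
  define q where "q = 2 powr (1 / \<alpha>)"
  have q: "1 < q" "q < 2"
  proof -
    have "2 powr 0 < q" unfolding q_def using alpha by (intro powr_less_mono) auto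
    then show "1 < q" by simp
    have "q < 2 powr 1" unfolding q_def using alpha by (intro powr_less_mono) auto
    then show "q < 2" by simp
  qed
  have "emeasure \<mu>X {x. \<not> \<sigma> * x < 0} = (\<integral>\<^sup>+x. ennreal (fX x) * indicator {x. \<not> \<sigma> * x < 0} x \<partial>lborel)"
    by (intro emeasure_\<mu>X) measurable
  also have "\<dots> = 0"
  proof (subst nn_integral_0_iff_AE)
    show "(\<lambda>x. ennreal (fX x) * indicator {x. \<not> \<sigma> * x < 0} x) \<in> borel_measurable lborel" by measurable
    show "AE x in lborel. ennreal (fX x) * indicator {x. \<not> \<sigma> * x < 0} x = 0"
      using AE_lborel_singleton[of 0]
    proof eventually_elim
      case (elim x)
      then have "0 < \<sigma> * x \<or> \<sigma> * x < 0" using \<sigma> by auto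
      then show ?case using z[of x] by (auto simp: indicator_def)
    qed
  qed
  finally have neg: "AE x in \<mu>X. \<sigma> * x < 0" by (intro AE_I[of _ _ "{x. \<not> \<sigma> * x < 0}"]) auto
  define L where "L s = (\<integral>x. exp (s * \<sigma> * x) \<partial>\<mu>X)" for s
  have int: "integrable \<mu>X (\<lambda>x. exp (s * \<sigma> * x))" if "0 < s" for s
  proof (rule X.integrable_const_bound[where B=1])
    show "AE x in \<mu>X. norm (exp (s * \<sigma> * x)) \<le> 1"
      using neg
    proof eventually_elim
      case (elim x)
      then have "s * (\<sigma> * x) \<le> 0" using that by (simp add: mult_nonneg_nonpos)
      then show ?case by (simp add: mult.assoc)
    qed
  qed auto
  have Lq: "L q = (L 1)\<^sup>2"
  proof -
    have "L q = (\<integral>x. exp (\<sigma> * x) \<partial>distr \<mu>X borel (\<lambda>x. q * x))"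
      unfolding L_def by (subst integral_distr) (auto simp: mult_ac)
    also have "\<dots> = (\<integral>x. exp (\<sigma> * x) \<partial>distr (\<mu>X \<Otimes>\<^sub>M \<mu>X) borel (\<lambda>p. fst p + snd p))"
      unfolding sum_law q_def ..
    also have "\<dots> = (\<integral>p. exp (\<sigma> * fst p) * exp (\<sigma> * snd p) \<partial>(\<mu>X \<Otimes>\<^sub>M \<mu>X))"
      by (subst integral_distr) (auto simp: distrib_left exp_add)
    also have "\<dots> = (\<integral>x. (\<integral>y. exp (\<sigma> * x) * exp (\<sigma> * y) \<partial>\<mu>X) \<partial>\<mu>X)"
    proof -
      have "integrable (\<mu>X \<Otimes>\<^sub>M \<mu>X) (\<lambda>p. exp (\<sigma> * fst p) * exp (\<sigma> * snd p))"
      proof (rule P.Fubini_integrable)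
        show "AE x in \<mu>X. integrable \<mu>X (\<lambda>y. exp (\<sigma> * fst (x, y)) * exp (\<sigma> * snd (x, y)))"
          using int[of 1] by simp
        show "integrable \<mu>X (\<lambda>x. \<integral>y. norm (exp (\<sigma> * fst (x, y)) * exp (\<sigma> * snd (x, y))) \<partial>\<mu>X)"
          using int[of 1] by simp
      qed measurable
      from P.integral_fst'[OF this] show ?thesis by simp
    qed
    also have "\<dots> = (L 1)\<^sup>2" by (simp add: L_def power2_eq_square)
    finally show ?thesis .
  qed
  have L1: "0 < L 1" "L 1 < 1"
  proof -
    have nn: "AE x in \<mu>X. 0 \<le> 1 - exp (1 * \<sigma> * x)" using neg by eventually_elim auto
    have i1: "integrable \<mu>X (\<lambda>x. 1 - exp (1 * \<sigma> * x))" using int[of 1] by simp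
    have "L 1 \<noteq> 1"
    proof
      assume "L 1 = 1"
      then have "(\<integral>x. 1 - exp (1 * \<sigma> * x) \<partial>\<mu>X) = 0"
        using int[of 1] X.prob_space by (simp add: L_def)
      then have "AE x in \<mu>X. 1 - exp (1 * \<sigma> * x) = 0"
        using integral_nonneg_eq_0_iff_AE[OF i1 nn] by simp
      with neg have "AE x in \<mu>X. False" by eventually_elim auto
      then show False by simp
    qed
    moreover have "L 1 \<le> 1"
    proof -
      have "L 1 \<le> (\<integral>x. 1 \<partial>\<mu>X)" unfolding L_def
        using int[of 1] nn by (intro integral_mono_AE) auto
      then show ?thesis using X.prob_space by simp
    qed
    ultimately show "L 1 < 1" by simp
    have "L 1 \<noteq> 0"
    proof
      assume "L 1 = 0"
      then have "AE x in \<mu>X. exp (1 * \<sigma> * x) = 0"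
        unfolding L_def using integral_nonneg_eq_0_iff_AE[OF int[of 1]] by simp
      then show False by simp
    qed
    moreover have "0 \<le> L 1" unfolding L_def by (intro integral_nonneg_AE) auto
    ultimately show "0 < L 1" by simp
  qed
  have "(L 1) powr q \<le> (\<integral>x. exp (1 * \<sigma> * x) powr q \<partial>\<mu>X)"
    unfolding L_def
  proof (rule X.jensens_inequality[where I="{0<..}"])
    show "integrable \<mu>X (\<lambda>x. exp (1 * \<sigma> * x) powr q)" using int[of q] q by (simp add: exp_powr_real mult_ac)
    show "convex_on {0<..} (\<lambda>x. x powr q)" using q by (intro powr_convex) auto
  qed (use int[of 1] in auto)
  also have "\<dots> = L q" by (simp add: L_def exp_powr_real mult_ac)
  finally have "(L 1) powr q \<le> (L 1) powr 2" using Lq L1 by (simp add: powr_numeral)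
  moreover have "(L 1) powr 2 < (L 1) powr q"
  proof -
    have "ln (L 1) < 0" using L1 by simp
    then have "2 * ln (L 1) < q * ln (L 1)" using q by (intro mult_strict_right_mono_neg)
    then show ?thesis using L1 by (simp add: powr_def)
  qed
  ultimately show False by simp
qed

text \<open>The set where \<open>fX\<close> is positive is open, meets both half-lines and is closed under
  \<open>(x, y) \<mapsto> (x + y) / 2 powr (1 / \<alpha>)\<close>; balancing \<open>2 ^ n\<close> summands of the two signs gives \<open>0\<close>.\<close>
lemma fX_0_pos: "0 < fX 0"
proof -
  obtain a where a: "0 < a" "0 < fX a" using fX_not_one_sided[of 1] by auto
  obtain b' where b': "b' < 0" "0 < fX b'" using fX_not_one_sided[of "-1"] by auto
  define b where "b = - b'"
  have b: "0 < b" "0 < fX (- b)" using b' by (auto simp: b_def)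
  define q where "q = 2 powr (1 / \<alpha>)"
  have comb: "0 < fX ((real p * a' - (2 ^ n - real p) * b) / q ^ n)" if "0 < fX a'" "p \<le> 2 ^ n" for a' p n
    using that(2)
  proof (induction n arbitrary: p)
    case 0
    then have "p = 0 \<or> p = 1" by auto
    then show ?case using that(1) b by auto
  next
    case (Suc n)
    define p1 where "p1 = min p (2 ^ n)"
    define p2 where "p2 = p - p1"
    have p: "p1 \<le> 2 ^ n" "p2 \<le> 2 ^ n" "p = p1 + p2" using Suc.prems by (auto simp: p1_def p2_def)
    let ?x1 = "(real p1 * a' - (2 ^ n - real p1) * b) / q ^ n" and ?x2 = "(real p2 * a' - (2 ^ n - real p2) * b) / q ^ n"
    have "0 < fX ((?x1 + ?x2) / q)"
      unfolding q_def[symmetric] using fX_pos_add[OF Suc.IH[OF p(1)] Suc.IH[OF p(2)]] by (simp add: q_def)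
    moreover have "(?x1 + ?x2) / q = (real p * a' - (2 ^ Suc n - real p) * b) / q ^ Suc n"
      by (simp add: p(3) add_divide_distrib[symmetric] algebra_simps)
    ultimately show ?case by simp
  qed
  obtain r where r: "0 < r" "\<And>x'. \<bar>x' - a\<bar> \<le> r \<Longrightarrow> fX a / 2 \<le> fX x'" using fX_lower_near[OF a(2)] by blast
  \<comment> \<open>The share of positive summands at which copies of a and of - b would cancel; the
    dyadic fraction p n / 2^n only approximates it.\<close>
  define \<theta> where "\<theta> = b / (a + b)"
  have \<theta>: "0 < \<theta>" "\<theta> < 1" using a b by (auto simp: \<theta>_def)
  define p where "p n = nat \<lceil>2 ^ n * \<theta>\<rceil>" for n :: nat
  have pn: "real (p n) = of_int \<lceil>2 ^ n * \<theta>\<rceil>" for n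
  proof -
    have "0 < 2 ^ n * \<theta>" using \<theta> by simp
    then show ?thesis unfolding p_def by simp
  qed
  have "(\<lambda>n::nat. of_int \<lceil>2 ^ n * \<theta>\<rceil> / 2 ^ n) \<longlonglongrightarrow> \<theta>" by real_asymp
  then have lim: "(\<lambda>n. real (p n) / 2 ^ n) \<longlonglongrightarrow> \<theta>" by (simp add: pn)
  have "(\<lambda>n. (1 / (real (p n) / 2 ^ n) - 1) * b) \<longlonglongrightarrow> (1 / \<theta> - 1) * b"
    using lim \<theta> by (intro tendsto_intros) auto
  moreover have "(1 / \<theta> - 1) * b = a" using a b by (simp add: \<theta>_def field_simps)
  ultimately have "(\<lambda>n. (1 / (real (p n) / 2 ^ n) - 1) * b) \<longlonglongrightarrow> a" by simp
  from tendstoD[OF this r(1)] obtain n where n: "\<bar>(1 / (real (p n) / 2 ^ n) - 1) * b - a\<bar> < r"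
    by (auto simp: eventually_sequentially dist_real_def)
  \<comment> \<open>Moving a to a' makes the cancellation exact, and a' is close enough to a for fX
    to stay positive.\<close>
  define a' where "a' = (1 / (real (p n) / 2 ^ n) - 1) * b"
  have "fX a / 2 \<le> fX a'" using r(2)[of a'] n by (auto simp: a'_def)
  then have a': "0 < fX a'" using a by simp
  have pos: "0 < real (p n)"
  proof -
    have "0 < 2 ^ n * \<theta>" using \<theta> by simp
    then show ?thesis unfolding pn by linarith
  qed
  have "p n \<le> 2 ^ n"
  proof -
    have "2 ^ n * \<theta> \<le> of_int (2 ^ n)" using \<theta> by (simp add: mult_left_le)
    then have "\<lceil>2 ^ n * \<theta>\<rceil> \<le> 2 ^ n" by (rule ceiling_le)
    then show ?thesis unfolding p_def by (simp add: nat_le_iff)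
  qed
  from comb[OF a' this] have "0 < fX ((real (p n) * a' - (2 ^ n - real (p n)) * b) / q ^ n)" .
  moreover have "real (p n) * a' - (2 ^ n - real (p n)) * b = 0" using pos by (simp add: a'_def field_simps)
  ultimately show ?thesis by simp
qed

end

section \<open>Renewal identity\<close>

lemma (in prob_space) prob_sum_partition:
  assumes "finite I" "\<And>i. i \<in> I \<Longrightarrow> E i \<in> sets M"
    and "\<And>x. x \<in> space M \<Longrightarrow> \<exists>!i. i \<in> I \<and> x \<in> E i"
  shows "(\<Sum>i\<in>I. emeasure M (E i)) = 1"
proof -
  have "disjoint_family_on E I"
    unfolding disjoint_family_on_def
  proof safe
    fix i j x assume "i \<in> I" "j \<in> I" "i \<noteq> j" "x \<in> E i" "x \<in> E j"
    moreover then have "x \<in> space M" using assms(2) sets.sets_into_space by blast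
    ultimately show "x \<in> {}" using assms(3)[of x] by blast
  qed
  then have "(\<Sum>i\<in>I. emeasure M (E i)) = emeasure M (\<Union>i\<in>I. E i)"
    using assms by (intro sum_emeasure) auto
  also have "(\<Union>i\<in>I. E i) = space M"
  proof
    show "(\<Union>i\<in>I. E i) \<subseteq> space M" using assms(2) sets.sets_into_space by blast
    show "space M \<subseteq> (\<Union>i\<in>I. E i)" using assms(3) by blast
  qed
  finally show ?thesis using emeasure_space_1 by simp
qed

text \<open>The steps live on the sequence space: \<open>comb_seq\<close> splices a path with an independent copy at
  a given time, which is the Markov property in product form.\<close>
locale iid_steps = real_distribution D for D :: "real measure"
begin

sublocale seq: sequence_space D ..

abbreviation "\<S> \<equiv> \<Pi>\<^sub>M i\<in>UNIV::nat set. D"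

definition ps :: "nat \<Rightarrow> (nat \<Rightarrow> real) \<Rightarrow> real" where "ps n x = (\<Sum>i<n. x i)"

definition survive :: "real set \<Rightarrow> real \<Rightarrow> nat \<Rightarrow> real" where
  "survive J y m = measure \<S> {x \<in> space \<S>. \<forall>j\<in>{1..m}. y + ps j x \<notin> J}"

definition step_law :: "nat \<Rightarrow> real measure" where "step_law k = distr \<S> borel (ps k)"

lemma space_\<S>: "space \<S> = UNIV"
  by (auto simp: space_PiM)

lemma measurable_coordinate: "(\<lambda>x. x i) \<in> borel_measurable \<S>"
proof -
  have "(\<lambda>x. x i) \<in> measurable \<S> D" by (rule measurable_component_singleton) simp
  then show ?thesis by (simp add: measurable_def)
qed

lemma measurable_ps [measurable]: "ps k \<in> borel_measurable \<S>"
  unfolding ps_def[abs_def] by (intro borel_measurable_sum measurable_coordinate)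

lemma real_distribution_step_law: "real_distribution (step_law k)"
  unfolding step_law_def by (rule seq.P.real_distribution_distr) simp

lemma ps_comb_seq: "ps (k + j) (comb_seq k x x') = ps k x + ps j x'"
proof -
  have "ps (k + j) (comb_seq k x x') = (\<Sum>i<k. comb_seq k x x' i) + (\<Sum>i=k..<k+j. comb_seq k x x' i)"
    unfolding ps_def lessThan_atLeast0 by (rule sum.atLeastLessThan_concat[symmetric]) auto
  also have "(\<Sum>i<k. comb_seq k x x' i) = ps k x" unfolding ps_def by (intro sum.cong) (auto simp: comb_seq_def)
  also have "(\<Sum>i=k..<k+j. comb_seq k x x' i) = (\<Sum>i<j. x' i)"
    by (rule sum.reindex_bij_witness[of _ "\<lambda>i. i + k" "\<lambda>i. i - k"]) (auto simp: comb_seq_def)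
  finally show ?thesis by (simp add: ps_def)
qed

lemma survive_bounds: "0 \<le> survive J y m" "survive J y m \<le> 1"
  by (auto simp: survive_def)

lemma survive_measurable:
  assumes [measurable]: "J \<in> sets borel"
  shows "(\<lambda>y. survive J y m) \<in> borel_measurable borel"
proof -
  have "(\<lambda>y. emeasure \<S> (Pair y -` {p \<in> space (borel \<Otimes>\<^sub>M \<S>). \<forall>j\<in>{1..m}. fst p + ps j (snd p) \<notin> J})) \<in> borel_measurable borel"
    by (rule seq.P.measurable_emeasure_Pair) measurable
  moreover have "Pair y -` {p \<in> space (borel \<Otimes>\<^sub>M \<S>). \<forall>j\<in>{1..m}. fst p + ps j (snd p) \<notin> J} = {x \<in> space \<S>. \<forall>j\<in>{1..m}. y + ps j x \<notin> J}" for y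
    by (auto simp: space_pair_measure)
  ultimately show ?thesis unfolding survive_def measure_def by simp
qed

lemma survive_measurable' [measurable (raw)]:
  assumes "f \<in> borel_measurable N" "J \<in> sets borel"
  shows "(\<lambda>x. survive J (f x) m) \<in> borel_measurable N"
  using measurable_compose[OF assms(1) survive_measurable[OF assms(2)]] .

lemma step_law_window_measurable [measurable]:
  "(\<lambda>y. measure (step_law k) {y-\<epsilon><..<y+\<epsilon>}) \<in> borel_measurable borel"
proof -
  interpret L: real_distribution "step_law k" by (rule real_distribution_step_law)
  have "(\<lambda>y. emeasure (step_law k) (Pair y -` {p \<in> space (borel \<Otimes>\<^sub>M step_law k). fst p - \<epsilon> < snd p \<and> snd p < fst p + \<epsilon>})) \<in> borel_measurable borel"
    by (rule L.measurable_emeasure_Pair) measurable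
  moreover have "Pair y -` {p \<in> space (borel \<Otimes>\<^sub>M step_law k). fst p - \<epsilon> < snd p \<and> snd p < fst p + \<epsilon>} = {y-\<epsilon><..<y+\<epsilon>}" for y
    by (auto simp: space_pair_measure)
  ultimately have "(\<lambda>y. emeasure (step_law k) {y-\<epsilon><..<y+\<epsilon>}) \<in> borel_measurable borel" by (simp only:)
  then show ?thesis unfolding measure_def by (rule borel_measurable_enn2real)
qed

text \<open>The start lies in J, so a last visit up to time n exists, and its time k partitions the
  space. After time k the spliced path is an independent copy, which contributes the survival
  probability from the current position over the remaining n - k steps.\<close>

lemma last_visit:
  assumes J [measurable]: "J \<in> sets borel" and y: "y \<in> J"
  shows "(\<Sum>k\<le>n. \<integral>\<^sup>+s. indicator J (y + s) * ennreal (survive J (y + s) (n - k)) \<partial>step_law k) = 1"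
proof -
  define E where "E k = {x \<in> space \<S>. y + ps k x \<in> J \<and> (\<forall>j\<in>{k<..n}. y + ps j x \<notin> J)}" for k
  have Em [measurable]: "E k \<in> sets \<S>" for k unfolding E_def by measurable
  have "(\<Sum>k\<in>{..n}. emeasure \<S> (E k)) = 1"
  proof (rule seq.P.prob_sum_partition)
    fix x assume x: "x \<in> space \<S>"
    define k where "k = Max {k. k \<le> n \<and> y + ps k x \<in> J}"
    have fin: "finite {k. k \<le> n \<and> y + ps k x \<in> J}" by simp
    have ne: "0 \<in> {k. k \<le> n \<and> y + ps k x \<in> J}" using y by (simp add: ps_def)
    then have "k \<in> {k. k \<le> n \<and> y + ps k x \<in> J}" unfolding k_def using fin by (intro Max_in) auto
    then have k: "k \<le> n" "y + ps k x \<in> J" by auto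
    have "x \<in> E k"
      unfolding E_def
    proof (intro CollectI conjI ballI notI x k(2))
      fix j assume j: "j \<in> {k<..n}" "y + ps j x \<in> J"
      then have "j \<le> k" unfolding k_def by (intro Max_ge fin) auto
      then show False using j by simp
    qed
    moreover have "i = k" if "i \<le> n" "x \<in> E i" for i
    proof (rule ccontr)
      assume "i \<noteq> k"
      then consider "i < k" | "k < i" by linarith
      then show False using that k x \<open>x \<in> E k\<close> by cases (auto simp: E_def)
    qed
    ultimately show "\<exists>!i. i \<in> {..n} \<and> x \<in> E i" using k by blast
  qed (auto simp: Em)
  moreover have "emeasure \<S> (E k) = (\<integral>\<^sup>+s. indicator J (y + s) * ennreal (survive J (y + s) (n - k)) \<partial>step_law k)"
    if k: "k \<le> n" for k
  proof -
    let ?c = "\<lambda>p. comb_seq k (fst p) (snd p)"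
    have cm: "?c \<in> measurable (\<S> \<Otimes>\<^sub>M \<S>) \<S>" using measurable_comb_seq[of k D] by (simp add: split_beta')
    define F where "F = ?c -` E k \<inter> space (\<S> \<Otimes>\<^sub>M \<S>)"
    have Fm: "F \<in> sets (\<S> \<Otimes>\<^sub>M \<S>)" unfolding F_def using cm Em by (rule measurable_sets)
    have "emeasure \<S> (E k) = emeasure (distr (\<S> \<Otimes>\<^sub>M \<S>) \<S> ?c) (E k)"
      using seq.PiM_comb_seq[of k] by (simp add: split_beta')
    also have "\<dots> = emeasure (\<S> \<Otimes>\<^sub>M \<S>) F" unfolding F_def using cm Em by (rule emeasure_distr)
    also have "\<dots> = (\<integral>\<^sup>+x. emeasure \<S> (Pair x -` F) \<partial>\<S>)" using Fm by (rule seq.P.emeasure_pair_measure_alt)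
    also have "\<dots> = (\<integral>\<^sup>+x. indicator J (y + ps k x) * ennreal (survive J (y + ps k x) (n - k)) \<partial>\<S>)"
    proof (rule nn_integral_cong)
      fix x assume x: "x \<in> space \<S>"
      have later: "(\<forall>j\<in>{k<..n}. y + ps j (comb_seq k x x') \<notin> J) \<longleftrightarrow> (\<forall>j\<in>{1..n-k}. y + ps k x + ps j x' \<notin> J)" for x'
      proof safe
        fix j assume a: "\<forall>j\<in>{k<..n}. y + ps j (comb_seq k x x') \<notin> J" and j: "j \<in> {1..n-k}" and mem: "y + ps k x + ps j x' \<in> J"
        have "k + j \<in> {k<..n}" using j k by auto
        then have "y + ps (k + j) (comb_seq k x x') \<notin> J" using a by blast
        then show False using ps_comb_seq[of k j x x'] mem by (simp add: add.assoc)
      next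
        fix j assume a: "\<forall>j\<in>{1..n-k}. y + ps k x + ps j x' \<notin> J" and j: "j \<in> {k<..n}" and mem: "y + ps j (comb_seq k x x') \<in> J"
        have jk: "j - k \<in> {1..n-k}" "k + (j - k) = j" using j by auto
        then have "y + ps k x + ps (j - k) x' \<notin> J" using a by blast
        then show False using ps_comb_seq[of k "j - k" x x'] mem jk(2) by (simp add: add.assoc)
      qed
      have at: "ps k (comb_seq k x x') = ps k x" for x' using ps_comb_seq[of k 0 x x'] by (simp add: ps_def)
      have "Pair x -` F = (if y + ps k x \<in> J then {x' \<in> space \<S>. \<forall>j\<in>{1..n-k}. y + ps k x + ps j x' \<notin> J} else {})"
        unfolding F_def E_def using at later by (auto simp: space_\<S> space_pair_measure)
      then show "emeasure \<S> (Pair x -` F) = indicator J (y + ps k x) * ennreal (survive J (y + ps k x) (n - k))"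
        by (auto simp: survive_def seq.P.emeasure_eq_measure)
    qed
    also have "\<dots> = (\<integral>\<^sup>+s. indicator J (y + s) * ennreal (survive J (y + s) (n - k)) \<partial>step_law k)"
      unfolding step_law_def by (subst nn_integral_distr) auto
    finally show ?thesis .
  qed
  ultimately show ?thesis by simp
qed

text \<open>For J = {0} the position at the last visit is always 0, so the integrals factor.\<close>

lemma return_identity: "(\<Sum>k\<le>n. measure (step_law k) {0} * survive {0} 0 (n - k)) = 1"
proof -
  interpret L: real_distribution "step_law k" for k by (rule real_distribution_step_law)
  have "(\<integral>\<^sup>+s. indicator {0} (0 + s) * ennreal (survive {0} (0 + s) (n - k)) \<partial>step_law k) = ennreal (measure (step_law k) {0} * survive {0} 0 (n - k))" for k
  proof -
    have "(\<integral>\<^sup>+s. indicator {0} (0 + s) * ennreal (survive {0} (0 + s) (n - k)) \<partial>step_law k)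
       = (\<integral>\<^sup>+s. ennreal (survive {0} 0 (n - k)) * indicator {0} s \<partial>step_law k)"
      by (intro nn_integral_cong) (auto simp: indicator_def)
    also have "\<dots> = ennreal (survive {0} 0 (n - k)) * emeasure (step_law k) {0}"
      by (rule nn_integral_cmult_indicator) simp
    finally show ?thesis
      by (simp add: L.emeasure_eq_measure ennreal_mult'[symmetric] survive_bounds mult.commute)
  qed
  then have "(\<Sum>k\<le>n. ennreal (measure (step_law k) {0} * survive {0} 0 (n - k))) = 1"
    using last_visit[of "{0}" 0 n] by simp
  then have "ennreal (\<Sum>k\<le>n. measure (step_law k) {0} * survive {0} 0 (n - k)) = 1"
    by (subst sum_ennreal[symmetric]) (auto simp: survive_bounds)
  then show ?thesis by simp
qed

definition uniform_survive :: "real \<Rightarrow> nat \<Rightarrow> real" where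
  "uniform_survive \<epsilon> m = (LBINT y. indicator {-\<epsilon><..<\<epsilon>} y * survive {-\<epsilon><..<\<epsilon>} y m) / (2 * \<epsilon>)"

lemma integrable_survive: "integrable lborel (\<lambda>y. indicator {-\<epsilon><..<\<epsilon>} y * survive {-\<epsilon><..<\<epsilon>} y m)"
  by (rule integrableI_bounded_set[where A="{-\<epsilon><..<\<epsilon>}" and B=1])
     (use emeasure_lborel_box_finite[of "-\<epsilon>" \<epsilon>] survive_bounds in \<open>auto simp: less_top indicator_def\<close>)

lemma uniform_survive_bounds: "0 < \<epsilon> \<Longrightarrow> 0 \<le> uniform_survive \<epsilon> m" "0 < \<epsilon> \<Longrightarrow> uniform_survive \<epsilon> m \<le> 1"
proof -
  assume \<epsilon>: "0 < \<epsilon>"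
  show "0 \<le> uniform_survive \<epsilon> m" unfolding uniform_survive_def
    using \<epsilon> survive_bounds by (intro divide_nonneg_pos integral_nonneg_AE) auto
  have "(LBINT y. indicator {-\<epsilon><..<\<epsilon>} y * survive {-\<epsilon><..<\<epsilon>} y m) \<le> (LBINT y. indicator {-\<epsilon><..<\<epsilon>} y)"
    by (intro integral_mono integrable_survive) (use survive_bounds \<epsilon> in \<open>auto split: split_indicator\<close>)
  also have "\<dots> = 2 * \<epsilon>" using \<epsilon> by simp
  finally show "uniform_survive \<epsilon> m \<le> 1" unfolding uniform_survive_def using \<epsilon> by simp
qed

text \<open>\<open>last_visit\<close> integrated over the start u against Lebesgue measure. By
  translation invariance the position y = u + s at the last visit becomes the integration variable,
  and the condition that the start y - s lie in the interval turns into s \<in>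
  {y-\<epsilon><..<y+\<epsilon>}.\<close>

lemma uniform_renewal:
  assumes \<epsilon>: "0 < \<epsilon>"
  shows "(\<Sum>k\<le>n. LBINT y. indicator {-\<epsilon><..<\<epsilon>} y * (survive {-\<epsilon><..<\<epsilon>} y (n - k) * measure (step_law k) {y-\<epsilon><..<y+\<epsilon>})) = 2 * \<epsilon>"
proof -
  let ?J = "{-\<epsilon><..<\<epsilon>}"
  interpret L: real_distribution "step_law k" for k by (rule real_distribution_step_law)
  have swap: "(\<integral>\<^sup>+u. indicator ?J u * (\<integral>\<^sup>+s. indicator ?J (u + s) * ennreal (survive ?J (u + s) m) \<partial>step_law k) \<partial>lborel)
     = ennreal (LBINT y. indicator ?J y * (survive ?J y m * measure (step_law k) {y-\<epsilon><..<y+\<epsilon>}))" for k m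
  proof -
    interpret P: pair_sigma_finite lborel "step_law k" ..
    have "(\<integral>\<^sup>+u. indicator ?J u * (\<integral>\<^sup>+s. indicator ?J (u + s) * ennreal (survive ?J (u + s) m) \<partial>step_law k) \<partial>lborel)
      = (\<integral>\<^sup>+u. (\<integral>\<^sup>+s. indicator ?J u * (indicator ?J (u + s) * ennreal (survive ?J (u + s) m)) \<partial>step_law k) \<partial>lborel)"
      by (intro nn_integral_cong nn_integral_cmult[symmetric]) measurable
    also have "\<dots> = (\<integral>\<^sup>+s. (\<integral>\<^sup>+u. indicator ?J u * (indicator ?J (u + s) * ennreal (survive ?J (u + s) m)) \<partial>lborel) \<partial>step_law k)"
      by (rule P.Fubini'[symmetric]) measurable
    also have "\<dots> = (\<integral>\<^sup>+s. (\<integral>\<^sup>+y. indicator ?J (y - s) * (indicator ?J y * ennreal (survive ?J y m)) \<partial>lborel) \<partial>step_law k)"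
    proof (rule nn_integral_cong)
      fix s
      show "(\<integral>\<^sup>+u. indicator ?J u * (indicator ?J (u + s) * ennreal (survive ?J (u + s) m)) \<partial>lborel)
         = (\<integral>\<^sup>+y. indicator ?J (y - s) * (indicator ?J y * ennreal (survive ?J y m)) \<partial>lborel)"
        by (subst nn_integral_real_affine[where c=1 and t="-s"]) (auto simp: algebra_simps)
    qed
    also have "\<dots> = (\<integral>\<^sup>+y. (\<integral>\<^sup>+s. indicator ?J (y - s) * (indicator ?J y * ennreal (survive ?J y m)) \<partial>step_law k) \<partial>lborel)"
      by (rule P.Fubini') measurable
    also have "\<dots> = (\<integral>\<^sup>+y. ennreal (indicator ?J y * (survive ?J y m * measure (step_law k) {y-\<epsilon><..<y+\<epsilon>})) \<partial>lborel)"
    proof (rule nn_integral_cong)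
      fix y :: real
      have "(\<integral>\<^sup>+s. indicator ?J (y - s) * (indicator ?J y * ennreal (survive ?J y m)) \<partial>step_law k)
         = (\<integral>\<^sup>+s. (indicator ?J y * ennreal (survive ?J y m)) * indicator {y-\<epsilon><..<y+\<epsilon>} s \<partial>step_law k)"
        by (intro nn_integral_cong) (auto simp: indicator_def)
      also have "\<dots> = (indicator ?J y * ennreal (survive ?J y m)) * emeasure (step_law k) {y-\<epsilon><..<y+\<epsilon>}"
        by (rule nn_integral_cmult_indicator) simp
      also have "\<dots> = ennreal (indicator ?J y * (survive ?J y m * measure (step_law k) {y-\<epsilon><..<y+\<epsilon>}))"
        by (auto simp: L.emeasure_eq_measure ennreal_mult' survive_bounds indicator_def)
      finally show "(\<integral>\<^sup>+s. indicator ?J (y - s) * (indicator ?J y * ennreal (survive ?J y m)) \<partial>step_law k)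
         = ennreal (indicator ?J y * (survive ?J y m * measure (step_law k) {y-\<epsilon><..<y+\<epsilon>}))" .
    qed
    also have "\<dots> = ennreal (LBINT y. indicator ?J y * (survive ?J y m * measure (step_law k) {y-\<epsilon><..<y+\<epsilon>}))"
    proof (rule nn_integral_eq_integral)
      show "integrable lborel (\<lambda>y. indicator ?J y * (survive ?J y m * measure (step_law k) {y-\<epsilon><..<y+\<epsilon>}))"
        by (rule Bochner_Integration.integrable_bound[OF integrable_survive[of \<epsilon> m]])
           (auto simp: indicator_def abs_mult survive_bounds intro!: mult_left_le)
    qed (auto simp: survive_bounds)
    finally show ?thesis .
  qed
  have "ennreal (2 * \<epsilon>) = (\<integral>\<^sup>+u. indicator ?J u \<partial>lborel)" using \<epsilon> by simp
  also have "\<dots> = (\<integral>\<^sup>+u. (\<Sum>k\<le>n. indicator ?J u * (\<integral>\<^sup>+s. indicator ?J (u + s) * ennreal (survive ?J (u + s) (n - k)) \<partial>step_law k)) \<partial>lborel)"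
  proof (rule nn_integral_cong)
    fix u :: real
    show "indicator ?J u = (\<Sum>k\<le>n. indicator ?J u * (\<integral>\<^sup>+s. indicator ?J (u + s) * ennreal (survive ?J (u + s) (n - k)) \<partial>step_law k))"
      using last_visit[of ?J u n] by (cases "u \<in> ?J") (auto simp: sum_distrib_left[symmetric])
  qed
  also have "\<dots> = (\<Sum>k\<le>n. ennreal (LBINT y. indicator ?J y * (survive ?J y (n - k) * measure (step_law k) {y-\<epsilon><..<y+\<epsilon>})))"
    unfolding swap[symmetric] by (rule nn_integral_sum) measurable
  also have "\<dots> = ennreal (\<Sum>k\<le>n. LBINT y. indicator ?J y * (survive ?J y (n - k) * measure (step_law k) {y-\<epsilon><..<y+\<epsilon>}))"
    by (rule sum_ennreal) (auto intro!: integral_nonneg_AE simp: survive_bounds)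
  finally show ?thesis using \<epsilon>
    by (subst (asm) ennreal_inj) (auto intro!: sum_nonneg integral_nonneg_AE simp: survive_bounds)
qed

text \<open>Window bounds uniform in y take the weights out of the integral; what remains is a
  genuine convolution with \<open>uniform_survive\<close>, to which generating functions
  apply.\<close>

lemma uniform_renewal_bounds:
  assumes \<epsilon>: "0 < \<epsilon>"
    and lo: "\<And>k y. y \<in> {-\<epsilon><..<\<epsilon>} \<Longrightarrow> lo k \<le> measure (step_law k) {y-\<epsilon><..<y+\<epsilon>}"
    and hi: "\<And>k y. y \<in> {-\<epsilon><..<\<epsilon>} \<Longrightarrow> measure (step_law k) {y-\<epsilon><..<y+\<epsilon>} \<le> hi k"
  shows "(\<Sum>k\<le>n. lo k * uniform_survive \<epsilon> (n - k)) \<le> 1"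
    and "1 \<le> (\<Sum>k\<le>n. hi k * uniform_survive \<epsilon> (n - k))"
proof -
  let ?J = "{-\<epsilon><..<\<epsilon>}"
  interpret L: real_distribution "step_law k" for k by (rule real_distribution_step_law)
  have int: "integrable lborel (\<lambda>y. indicator ?J y * (survive ?J y m * measure (step_law k) {y-\<epsilon><..<y+\<epsilon>}))" for k m
    by (rule Bochner_Integration.integrable_bound[OF integrable_survive[of \<epsilon> m]])
       (auto simp: indicator_def abs_mult survive_bounds intro!: mult_left_le)
  have us: "(LBINT y. c * (indicator ?J y * survive ?J y m)) = 2 * \<epsilon> * (c * uniform_survive \<epsilon> m)" for c m
    using \<epsilon> by (simp add: uniform_survive_def)
  have "2 * \<epsilon> * (\<Sum>k\<le>n. lo k * uniform_survive \<epsilon> (n - k)) = (\<Sum>k\<le>n. LBINT y. lo k * (indicator ?J y * survive ?J y (n - k)))"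
    unfolding us by (simp add: sum_distrib_left)
  also have "\<dots> \<le> (\<Sum>k\<le>n. LBINT y. indicator ?J y * (survive ?J y (n - k) * measure (step_law k) {y-\<epsilon><..<y+\<epsilon>}))"
  proof (intro sum_mono integral_mono int integrable_mult_right integrable_survive)
    fix k y
    show "lo k * (indicator ?J y * survive ?J y (n - k)) \<le> indicator ?J y * (survive ?J y (n - k) * measure (step_law k) {y-\<epsilon><..<y+\<epsilon>})"
      using mult_right_mono[OF lo[of y k] survive_bounds(1)[of ?J y "n - k"]] by (auto simp: indicator_def mult.commute)
  qed
  also have "\<dots> = 2 * \<epsilon>" by (rule uniform_renewal[OF \<epsilon>])
  finally show "(\<Sum>k\<le>n. lo k * uniform_survive \<epsilon> (n - k)) \<le> 1" using \<epsilon> by simp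
  have "2 * \<epsilon> = (\<Sum>k\<le>n. LBINT y. indicator ?J y * (survive ?J y (n - k) * measure (step_law k) {y-\<epsilon><..<y+\<epsilon>}))"
    by (rule uniform_renewal[OF \<epsilon>, symmetric])
  also have "\<dots> \<le> (\<Sum>k\<le>n. LBINT y. hi k * (indicator ?J y * survive ?J y (n - k)))"
  proof (intro sum_mono integral_mono int integrable_mult_right integrable_survive)
    fix k y
    show "indicator ?J y * (survive ?J y (n - k) * measure (step_law k) {y-\<epsilon><..<y+\<epsilon>}) \<le> hi k * (indicator ?J y * survive ?J y (n - k))"
      using mult_right_mono[OF hi[of y k] survive_bounds(1)[of ?J y "n - k"]] by (auto simp: indicator_def mult.commute)
  qed
  also have "\<dots> = 2 * \<epsilon> * (\<Sum>k\<le>n. hi k * uniform_survive \<epsilon> (n - k))"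
    unfolding us by (simp add: sum_distrib_left)
  finally show "1 \<le> (\<Sum>k\<le>n. hi k * uniform_survive \<epsilon> (n - k))" using \<epsilon> by simp
qed

end

section \<open>Generating function of the survival probabilities\<close>

text \<open>The generating function of a convolution is a product, and that of the constant 1 is 1 /
  (1 - z).\<close>

lemma generating_function_le:
  fixes w q :: "nat \<Rightarrow> real"
  assumes z: "0 < z" "z < 1" and w: "\<And>k. 0 \<le> w k" "summable (\<lambda>k. z ^ k * w k)"
    and q: "\<And>k. 0 \<le> q k" "\<And>k. q k \<le> 1"
  shows "(\<And>n. (\<Sum>k\<le>n. w k * q (n - k)) \<le> 1) \<Longrightarrow> (\<Sum>k. z ^ k * w k) * ((1 - z) * (\<Sum>k. z ^ k * q k)) \<le> 1"
    and "(\<And>n. 1 \<le> (\<Sum>k\<le>n. w k * q (n - k))) \<Longrightarrow> 1 \<le> (\<Sum>k. z ^ k * w k) * ((1 - z) * (\<Sum>k. z ^ k * q k))"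
proof -
  have geo: "summable (\<lambda>k. z ^ k)" "(\<Sum>k. z ^ k) = 1 / (1 - z)"
    using z by (auto simp: summable_geometric suminf_geometric)
  have qs: "summable (\<lambda>k. z ^ k * q k)"
    by (rule summable_comparison_test'[OF geo(1), of 0]) (use z q in \<open>auto simp: abs_mult intro!: mult_left_le\<close>)
  have nw: "summable (\<lambda>k. norm (z ^ k * w k))" "summable (\<lambda>k. norm (z ^ k * q k))"
    using w qs z q(1) by (auto simp: abs_mult)
  have conv: "(\<Sum>i\<le>k. (z ^ i * w i) * (z ^ (k - i) * q (k - i))) = z ^ k * (\<Sum>i\<le>k. w i * q (k - i))" for k
    unfolding sum_distrib_left
  proof (rule sum.cong)
    fix i assume "i \<in> {..k}"
    then have "z ^ k = z ^ i * z ^ (k - i)" by (simp add: power_add[symmetric])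
    then show "(z ^ i * w i) * (z ^ (k - i) * q (k - i)) = z ^ k * (w i * q (k - i))" by simp
  qed simp
  have prod: "(\<Sum>k. z ^ k * w k) * (\<Sum>k. z ^ k * q k) = (\<Sum>k. z ^ k * (\<Sum>i\<le>k. w i * q (k - i)))"
    using Cauchy_product[OF nw] by (simp only: conv)
  have sm: "summable (\<lambda>k. z ^ k * (\<Sum>i\<le>k. w i * q (k - i)))"
    using summable_Cauchy_product[OF nw] by (simp only: conv)
  have scale: "(\<Sum>k. z ^ k * w k) * ((1 - z) * (\<Sum>k. z ^ k * q k)) = (1 - z) * (\<Sum>k. z ^ k * (\<Sum>i\<le>k. w i * q (k - i)))"
    unfolding prod[symmetric] by simp
  have one: "(1 - z) * (\<Sum>k. z ^ k) = 1" using geo z by simp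
  show "(\<Sum>k. z ^ k * w k) * ((1 - z) * (\<Sum>k. z ^ k * q k)) \<le> 1" if "\<And>n. (\<Sum>k\<le>n. w k * q (n - k)) \<le> 1"
  proof -
    have "(\<Sum>k. z ^ k * (\<Sum>i\<le>k. w i * q (k - i))) \<le> (\<Sum>k. z ^ k)"
      using that z by (intro suminf_le sm geo) (auto intro!: mult_left_le)
    then have "(1 - z) * (\<Sum>k. z ^ k * (\<Sum>i\<le>k. w i * q (k - i))) \<le> (1 - z) * (\<Sum>k. z ^ k)"
      using z by (intro mult_left_mono) auto
    then show ?thesis unfolding scale one .
  qed
  show "1 \<le> (\<Sum>k. z ^ k * w k) * ((1 - z) * (\<Sum>k. z ^ k * q k))" if "\<And>n. 1 \<le> (\<Sum>k\<le>n. w k * q (n - k))"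
  proof -
    have "(\<Sum>k. z ^ k) \<le> (\<Sum>k. z ^ k * (\<Sum>i\<le>k. w i * q (k - i)))"
    proof (intro suminf_le sm geo)
      fix k
      have "z ^ k * 1 \<le> z ^ k * (\<Sum>i\<le>k. w i * q (k - i))" using that[of k] z by (intro mult_left_mono) auto
      then show "z ^ k \<le> z ^ k * (\<Sum>i\<le>k. w i * q (k - i))" by simp
    qed
    then have "(1 - z) * (\<Sum>k. z ^ k) \<le> (1 - z) * (\<Sum>k. z ^ k * (\<Sum>i\<le>k. w i * q (k - i)))"
      using z by (intro mult_left_mono) auto
    then show ?thesis unfolding scale one .
  qed
qed

text \<open>The bound is demanded from k = 1 on, because the majorants will involve 1 / k^2, whose
  conventional value 0 at k = 0 bounds nothing.\<close>

lemma tannery_sequentially: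
  fixes a :: "nat \<Rightarrow> nat \<Rightarrow> real"
  assumes "\<And>k. (\<lambda>n. a k n) \<longlonglongrightarrow> b k" "\<And>k n. 1 \<le> k \<Longrightarrow> \<bar>a k n\<bar> \<le> M k" "summable M"
  shows "(\<lambda>n. \<Sum>k. a k n) \<longlonglongrightarrow> (\<Sum>k. b k)" "\<And>n. summable (\<lambda>k. a k n)"
proof -
  have "\<forall>\<^sub>F (k, n) in sequentially \<times>\<^sub>F sequentially. norm (a k n) \<le> M k"
  proof -
    have "\<forall>\<^sub>F p in sequentially \<times>\<^sub>F (sequentially :: nat filter). 1 \<le> fst p \<and> True"
      by (rule eventually_prodI[OF eventually_ge_at_top[of 1] eventually_True])
    then show ?thesis by eventually_elim (use assms(2) in auto)
  qed
  then show "(\<lambda>n. \<Sum>k. a k n) \<longlonglongrightarrow> (\<Sum>k. b k)"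
    using tannerys_theorem[OF assms(1) _ assms(3)] by auto
  show "summable (\<lambda>k. a k n)" for n
    by (rule summable_comparison_test'[OF assms(3), of 1]) (use assms(2) in auto)
qed

section \<open>Return probabilities at 0 and the limit of the survival generating function\<close>

locale attracted_steps = iid_steps D + attracted_walk_density D "iid_steps.step_law D" A \<mu>X c \<alpha> fX
  for D A \<mu>X c \<alpha> fX
begin

definition return_prob :: "nat \<Rightarrow> real" where "return_prob k = measure (step_law k) {0}"

definition Pstar :: real where "Pstar = measure \<S> {x \<in> space \<S>. \<forall>j\<ge>1. ps j x \<noteq> 0}"

lemma return_prob_nonneg: "0 \<le> return_prob k" by (simp add: return_prob_def)

text \<open>Shrinking the window to a point in the concentration bound leaves geometric
  decay.\<close>

lemma return_prob_le: obtains C \<rho> where "0 < C" "0 < \<rho>" "\<rho> < 1" "\<And>k. return_prob k \<le> C * \<rho> ^ k"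
  "\<And>k \<epsilon> y. 0 < \<epsilon> \<Longrightarrow> measure (step_law k) {y-\<epsilon>..y+\<epsilon>} \<le> C * (\<epsilon> + \<rho> ^ k)"
proof -
  obtain C \<rho> where C: "0 < C" "0 < \<rho>" "\<rho> < 1"
    "\<And>k \<epsilon> y. 0 < \<epsilon> \<Longrightarrow> measure (step_law k) {y-\<epsilon>..y+\<epsilon>} \<le> C * (\<epsilon> + \<rho> ^ k)"
    using concentration_bound by blast
  have "return_prob k \<le> C * \<rho> ^ k" for k
  proof (rule field_le_epsilon)
    fix e :: real assume e: "0 < e"
    interpret L: real_distribution "step_law k" by (rule real_distribution_step_law)
    have "return_prob k \<le> measure (step_law k) {0 - e / C..0 + e / C}"
      unfolding return_prob_def using e C by (intro L.finite_measure_mono) auto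
    also have "\<dots> \<le> C * (e / C + \<rho> ^ k)" using e C by (intro C(4)) auto
    also have "\<dots> = C * \<rho> ^ k + e" using C by (simp add: field_simps)
    finally show "return_prob k \<le> C * \<rho> ^ k + e" .
  qed
  then show ?thesis using that C by blast
qed

lemma summable_return_prob: "summable return_prob"
proof -
  obtain C \<rho> where C: "0 < C" "0 < \<rho>" "\<rho> < 1" "\<And>k. return_prob k \<le> C * \<rho> ^ k"
    using return_prob_le by metis
  show ?thesis
    by (rule summable_comparison_test'[of "\<lambda>k. C * \<rho> ^ k" 0])
       (use C return_prob_nonneg in \<open>auto intro!: summable_mult summable_geometric\<close>)
qed

lemma survive_zero_tendsto: "survive {0} 0 \<longlonglongrightarrow> Pstar"
proof -
  let ?B = "\<lambda>m. {x \<in> space \<S>. \<forall>j\<in>{1..m}. 0 + ps j x \<notin> {0}}"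
  have "(\<lambda>m. measure \<S> (?B m)) \<longlonglongrightarrow> measure \<S> (\<Inter>m. ?B m)"
    by (rule seq.P.finite_Lim_measure_decseq) (auto simp: decseq_def)
  moreover have "(\<Inter>m. ?B m) = {x \<in> space \<S>. \<forall>j\<ge>1. ps j x \<noteq> 0}"
  proof (intro equalityI subsetI)
    fix x assume "x \<in> (\<Inter>m. ?B m)"
    then have "x \<in> ?B m" for m by blast
    then have "ps j x \<noteq> 0" if "1 \<le> j" for j using that by (force dest: spec[of _ j])
    then show "x \<in> {x \<in> space \<S>. \<forall>j\<ge>1. ps j x \<noteq> 0}" by (simp add: space_\<S>)
  qed auto
  ultimately show ?thesis by (simp add: survive_def[abs_def] Pstar_def)
qed

text \<open>The limit of \<open>return_identity\<close> under the majorant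
  \<open>return_prob\<close>. It identifies 1 / Pstar as the expected number of visits to 0, and at
  the same time shows that the conditioning event has positive probability.\<close>

lemma suminf_return_prob: "(\<Sum>k. return_prob k) * Pstar = 1"
proof -
  define a where "a k n = (if k \<le> n then return_prob k * survive {0} 0 (n - k) else 0)" for k n
  have lim: "(\<lambda>n. a k n) \<longlonglongrightarrow> return_prob k * Pstar" for k
  proof -
    have "(\<lambda>n. return_prob k * survive {0} 0 n) \<longlonglongrightarrow> return_prob k * Pstar"
      by (intro tendsto_intros survive_zero_tendsto)
    then have "(\<lambda>n. a k (n + k)) \<longlonglongrightarrow> return_prob k * Pstar" by (simp add: a_def)
    then show ?thesis by (rule LIMSEQ_offset)
  qed
  have bd: "\<bar>a k n\<bar> \<le> return_prob k" for k n
    using survive_bounds return_prob_nonneg by (auto simp: a_def abs_mult intro!: mult_left_le)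
  have "(\<lambda>n. \<Sum>k. a k n) \<longlonglongrightarrow> (\<Sum>k. return_prob k * Pstar)"
    using lim bd summable_return_prob by (intro tannery_sequentially) auto
  moreover have "(\<Sum>k. a k n) = 1" for n
  proof -
    have "(\<Sum>k. a k n) = (\<Sum>k\<le>n. a k n)" by (rule suminf_finite) (auto simp: a_def)
    also have "\<dots> = (\<Sum>k\<le>n. measure (step_law k) {0} * survive {0} 0 (n - k))"
      by (intro sum.cong) (auto simp: a_def return_prob_def)
    finally show ?thesis using return_identity by simp
  qed
  ultimately have "(\<lambda>n. 1) \<longlonglongrightarrow> (\<Sum>k. return_prob k * Pstar)" by simp
  then have "(\<Sum>k. return_prob k * Pstar) = 1" by (simp add: LIMSEQ_const_iff)
  then show ?thesis using suminf_mult2[OF summable_return_prob, of Pstar] by simp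
qed

lemma Pstar_pos: "0 < Pstar"
proof -
  have "0 \<le> Pstar" by (simp add: Pstar_def)
  moreover have "Pstar \<noteq> 0" using suminf_return_prob by auto
  ultimately show ?thesis by simp
qed

text \<open>For \<bar>y\<bar> < \<epsilon> every window {y-\<epsilon><..<y+\<epsilon>} contains 0
  and lies in this interval, so all of them share the limit.\<close>

lemma window_tendsto:
  fixes \<epsilon> :: "nat \<Rightarrow> real"
  assumes "\<And>i. 0 < \<epsilon> i" "\<epsilon> \<longlonglongrightarrow> 0"
  shows "(\<lambda>i. measure (step_law k) {- 2 * \<epsilon> i..2 * \<epsilon> i}) \<longlonglongrightarrow> return_prob k"
proof -
  interpret L: real_distribution "step_law k" by (rule real_distribution_step_law)
  have "(\<lambda>i. \<integral>x. indicator {- 2 * \<epsilon> i..2 * \<epsilon> i} x \<partial>step_law k) \<longlonglongrightarrow> (\<integral>x. indicator {0} x \<partial>step_law k :: real)"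
  proof (rule integral_dominated_convergence[where w="\<lambda>_. 1"])
    show "AE x in step_law k. (\<lambda>i. indicator {- 2 * \<epsilon> i..2 * \<epsilon> i} x :: real) \<longlonglongrightarrow> indicator {0} x"
    proof (rule AE_I2)
      fix x :: real
      show "(\<lambda>i. indicator {- 2 * \<epsilon> i..2 * \<epsilon> i} x :: real) \<longlonglongrightarrow> indicator {0} x"
      proof (cases "x = 0")
        case True then show ?thesis using assms(1) by (simp add: less_imp_le)
      next
        case False
        have "\<forall>\<^sub>F i in sequentially. \<epsilon> i < \<bar>x\<bar> / 2" using assms(2) False by (intro order_tendstoD) auto
        then have "\<forall>\<^sub>F i in sequentially. 0 = (indicator {- 2 * \<epsilon> i..2 * \<epsilon> i} x :: real)"
          by eventually_elim (auto simp: indicator_def)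
        then have "(\<lambda>i. indicator {- 2 * \<epsilon> i..2 * \<epsilon> i} x :: real) \<longlonglongrightarrow> 0"
          by (rule Lim_transform_eventually[OF tendsto_const])
        then show ?thesis using False by simp
      qed
    qed
  qed auto
  then show ?thesis by (simp add: return_prob_def)
qed

text \<open>Times \<open>k\<close> with \<open>\<epsilon> * k\<^sup>2 < 1\<close> contribute only the exact returns to \<open>0\<close>, whose total mass is
  \<open>1 / Pstar\<close>; for the other times the local limit theorem applies uniformly on the window.\<close>
lemma survive_generating_function_tendsto:
  fixes \<epsilon> :: "nat \<Rightarrow> real" and n :: "nat \<Rightarrow> nat"
  assumes \<epsilon>: "\<And>i. 0 < \<epsilon> i" "\<epsilon> \<longlonglongrightarrow> 0" and n: "filterlim n at_top sequentially" "\<And>i. 1 \<le> n i"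
    and G: "(\<lambda>i. \<epsilon> i * Gsum A (n i)) \<longlonglongrightarrow> \<theta>" and \<theta>: "0 < \<theta>" and s: "0 < s"
  defines "p \<equiv> 1 - 1 / \<alpha>" and "z \<equiv> \<lambda>i. exp (- s / real (n i))"
  shows "(\<lambda>i. (1 - z i) * (\<Sum>m. z i ^ m * uniform_survive (\<epsilon> i) m))
     \<longlonglongrightarrow> Pstar / (1 + Gamma p * (2 * fX 0 * Pstar) * p * \<theta> * s powr (- p))"
proof -
  have p: "0 < p" using alpha by (simp add: p_def)
  have z: "0 < z i" "z i < 1" for i using s n(2)[of i] by (auto simp: z_def)
  have zk: "0 \<le> z i ^ k" "z i ^ k \<le> 1" for i k using z[of i] by (auto intro: power_le_one)
  have z1: "(\<lambda>i. z i ^ k) \<longlonglongrightarrow> 1" for k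
  proof -
    have "(\<lambda>m. - s / real m) \<longlonglongrightarrow> 0" by real_asymp
    then have "(\<lambda>m. exp (- s / real m) ^ k) \<longlonglongrightarrow> exp 0 ^ k" by (intro tendsto_power tendsto_exp)
    from filterlim_compose[OF this n(1)] show ?thesis by (simp add: z_def)
  qed
  obtain B where B: "0 < B" "\<And>k. 1 \<le> k \<Longrightarrow> 1 / A k \<le> B" using inverse_A_bounded by blast
  obtain C \<rho> where C: "0 < C" "0 < \<rho>" "\<rho> < 1"
    "\<And>k \<epsilon> y. 0 < \<epsilon> \<Longrightarrow> measure (step_law k) {y-\<epsilon>..y+\<epsilon>} \<le> C * (\<epsilon> + \<rho> ^ k)"
    using return_prob_le by metis
  have sq: "summable (\<lambda>k. 1 / (real k)\<^sup>2)" using inverse_power_summable[of 2] by (simp add: inverse_eq_divide)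
  \<comment> \<open>The cut-off at \<epsilon> * k^2 = 1. On its support \<epsilon> i \<le> 1 / k^2,
    so terms of size \<epsilon> i are summable in k uniformly in i.\<close>
  define near where "near i k = (if \<epsilon> i * (real k)\<^sup>2 < 1 then 1 else 0 :: real)" for i k
  have near: "0 \<le> near i k" "near i k \<le> 1" for i k by (auto simp: near_def)
  have near_eps: "near i k * \<epsilon> i \<le> 1 / (real k)\<^sup>2" if "1 \<le> k" for i k
    using that by (auto simp: near_def field_simps)
  have near1: "(\<lambda>i. near i k) \<longlonglongrightarrow> 1" for k
  proof -
    have "(\<lambda>i. \<epsilon> i * (real k)\<^sup>2) \<longlonglongrightarrow> 0 * (real k)\<^sup>2" by (intro tendsto_intros \<epsilon>)
    then have "\<forall>\<^sub>F i in sequentially. \<epsilon> i * (real k)\<^sup>2 < 1" by (intro order_tendstoD) auto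
    then have "\<forall>\<^sub>F i in sequentially. 1 = near i k" by eventually_elim (auto simp: near_def)
    then show ?thesis by (rule Lim_transform_eventually[OF tendsto_const])
  qed
  \<comment> \<open>\<open>T1\<close> and \<open>T2\<close> are the short-time parts of the lower
    and of the upper weight; both tend to the whole return mass.\<close>
  have T1: "(\<lambda>i. \<Sum>k. z i ^ k * (near i k * return_prob k)) \<longlonglongrightarrow> (\<Sum>k. return_prob k)"
    and T1s: "\<And>i. summable (\<lambda>k. z i ^ k * (near i k * return_prob k))"
  proof -
    have "(\<lambda>i. z i ^ k * (near i k * return_prob k)) \<longlonglongrightarrow> return_prob k" for k
      using tendsto_mult[OF z1[of k] tendsto_mult[OF near1[of k] tendsto_const[of "return_prob k"]]] by simp
    moreover have "\<bar>z i ^ k * (near i k * return_prob k)\<bar> \<le> return_prob k" for i k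
    proof -
      have "z i ^ k * (near i k * return_prob k) \<le> 1 * (1 * return_prob k)"
        using zk near return_prob_nonneg by (intro mult_mono) auto
      then show ?thesis using zk near return_prob_nonneg by (simp add: abs_mult)
    qed
    ultimately show "(\<lambda>i. \<Sum>k. z i ^ k * (near i k * return_prob k)) \<longlonglongrightarrow> (\<Sum>k. return_prob k)"
      "\<And>i. summable (\<lambda>k. z i ^ k * (near i k * return_prob k))"
      using tannery_sequentially[of "\<lambda>k i. z i ^ k * (near i k * return_prob k)" return_prob return_prob] summable_return_prob by auto
  qed
  define win where "win i k = measure (step_law k) {- 2 * \<epsilon> i..2 * \<epsilon> i}" for i k
  have T2: "(\<lambda>i. \<Sum>k. z i ^ k * (near i k * win i k)) \<longlonglongrightarrow> (\<Sum>k. return_prob k)"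
    and T2s: "\<And>i. summable (\<lambda>k. z i ^ k * (near i k * win i k))"
  proof -
    let ?M = "\<lambda>k. C * (2 * (1 / (real k)\<^sup>2) + \<rho> ^ k)"
    have "(\<lambda>i. z i ^ k * (near i k * win i k)) \<longlonglongrightarrow> return_prob k" for k
      using tendsto_mult[OF z1[of k] tendsto_mult[OF near1[of k] window_tendsto[OF \<epsilon>, of k]]] by (simp add: win_def)
    moreover have "\<bar>z i ^ k * (near i k * win i k)\<bar> \<le> ?M k" if k: "1 \<le> k" for i k
    proof -
      have w0: "0 \<le> win i k" by (simp add: win_def)
      have "win i k \<le> C * (2 * \<epsilon> i + \<rho> ^ k)" using C(4)[of "2 * \<epsilon> i" k 0] \<epsilon>(1)[of i] by (simp add: win_def)
      then have "near i k * win i k \<le> near i k * (C * (2 * \<epsilon> i + \<rho> ^ k))" using near by (intro mult_left_mono) auto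
      also have "\<dots> = C * (2 * (near i k * \<epsilon> i) + near i k * \<rho> ^ k)" by (simp add: algebra_simps)
      also have "\<dots> \<le> C * (2 * (1 / (real k)\<^sup>2) + 1 * \<rho> ^ k)"
        using near_eps[OF k, of i] near[of i k] C by (intro mult_left_mono add_mono mult_right_mono) auto
      finally have "near i k * win i k \<le> ?M k" by simp
      moreover have "z i ^ k * (near i k * win i k) \<le> 1 * (near i k * win i k)"
        using zk near w0 by (intro mult_right_mono) auto
      ultimately show ?thesis using zk near w0 by (simp add: abs_mult)
    qed
    moreover have "summable ?M" using sq C by (intro summable_mult summable_add summable_geometric) auto
    ultimately show "(\<lambda>i. \<Sum>k. z i ^ k * (near i k * win i k)) \<longlonglongrightarrow> (\<Sum>k. return_prob k)"
      "\<And>i. summable (\<lambda>k. z i ^ k * (near i k * win i k))"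
      using tannery_sequentially[of "\<lambda>k i. z i ^ k * (near i k * win i k)" return_prob ?M] by auto
  qed
  \<comment> \<open>A 0 is unconstrained, so the index 0 gets weight 0.\<close>
  define h where "h k = (if k = 0 then 0 else 1 / A k)" for k
  have h0: "0 \<le> h k" for k using A_pos[of k] by (auto simp: h_def)
  have hs: "summable (\<lambda>k. z i ^ k * h k)" for i
  proof (subst summable_Suc_iff[symmetric])
    show "summable (\<lambda>k. z i ^ Suc k * h (Suc k))" using summable_power_div_A[of "z i"] z[of i] by (simp add: h_def)
  qed
  have h_sum: "(\<Sum>k. z i ^ k * h k) = (\<Sum>k. z i ^ Suc k / A (Suc k))" for i
    using suminf_split_head[OF hs[of i]] by (simp add: h_def)
  define Lim where "Lim = \<theta> * p * (Gamma p * s powr (- p))"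
  have Lim_pos: "0 < Lim" using \<theta> p s Gamma_real_pos[OF p] by (simp add: Lim_def)
  \<comment> \<open>The Abelian sum and Gsum are both of order n / A n. Their quotient has a limit,
    so the hypothesis on \<epsilon> * Gsum carries over to the Abelian sum.\<close>
  have T3: "(\<lambda>i. \<epsilon> i * (\<Sum>k. z i ^ k * h k)) \<longlonglongrightarrow> Lim"
  proof -
    have 1: "(\<lambda>i. A (n i) / real (n i) * (\<Sum>k. z i ^ Suc k / A (Suc k))) \<longlonglongrightarrow> Gamma p * s powr (- p)"
      using filterlim_compose[OF abel_sum_tendsto[OF s] n(1)] by (simp add: z_def p_def)
    have 2: "(\<lambda>i. A (n i) / real (n i) * Gsum A (n i)) \<longlonglongrightarrow> 1 / p"
      using filterlim_compose[OF Gsum_tendsto n(1)] by (simp add: p_def)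
    have "(\<lambda>i. (\<epsilon> i * Gsum A (n i)) / (A (n i) / real (n i) * Gsum A (n i)) * (A (n i) / real (n i) * (\<Sum>k. z i ^ Suc k / A (Suc k))))
       \<longlonglongrightarrow> \<theta> / (1 / p) * (Gamma p * s powr (- p))"
      using p by (intro tendsto_mult tendsto_divide G 1 2) auto
    moreover have "(\<epsilon> i * Gsum A (n i)) / (A (n i) / real (n i) * Gsum A (n i)) * (A (n i) / real (n i) * (\<Sum>k. z i ^ Suc k / A (Suc k)))
       = \<epsilon> i * (\<Sum>k. z i ^ k * h k)" for i
    proof -
      have "0 < A (n i)" "0 < real (n i)" using A_pos n(2)[of i] by auto
      moreover have "0 < Gsum A (n i)" unfolding Gsum_def using A_pos n(2)[of i] by (intro sum_pos) auto
      ultimately show ?thesis unfolding h_sum by (simp add: field_simps)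
    qed
    ultimately show ?thesis by (simp add: Lim_def)
  qed
  \<comment> \<open>Short times are negligible in the Abelian sum, so restricting it to the long
    times in \<open>far\<close> does not change the limit.\<close>
  have T4: "(\<lambda>i. \<Sum>k. z i ^ k * (\<epsilon> i * near i k * h k)) \<longlonglongrightarrow> 0"
    and T4s: "\<And>i. summable (\<lambda>k. z i ^ k * (\<epsilon> i * near i k * h k))"
  proof -
    let ?M = "\<lambda>k. B * (1 / (real k)\<^sup>2)"
    have "(\<lambda>i. z i ^ k * (\<epsilon> i * near i k * h k)) \<longlonglongrightarrow> 0" for k
      using tendsto_mult[OF z1[of k] tendsto_mult[OF tendsto_mult[OF \<epsilon>(2) near1[of k]] tendsto_const[of "h k"]]] by simp
    moreover have "\<bar>z i ^ k * (\<epsilon> i * near i k * h k)\<bar> \<le> ?M k" if k: "1 \<le> k" for i k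
    proof -
      have "h k \<le> B" using B(2)[OF k] k by (simp add: h_def)
      then have "\<epsilon> i * near i k * h k \<le> (1 / (real k)\<^sup>2) * B"
        using near_eps[OF k, of i] h0 by (intro mult_mono) (auto simp: mult.commute)
      moreover have nn: "0 \<le> \<epsilon> i * near i k * h k" using \<epsilon>(1)[of i] near h0 by simp
      moreover have "z i ^ k * (\<epsilon> i * near i k * h k) \<le> 1 * (\<epsilon> i * near i k * h k)"
        using zk nn by (intro mult_right_mono) auto
      moreover have "0 \<le> z i ^ k * (\<epsilon> i * near i k * h k)" by (rule mult_nonneg_nonneg[OF zk(1) nn])
      ultimately show ?thesis by (simp add: mult.commute)
    qed
    moreover have "summable ?M" using sq by (intro summable_mult)
    ultimately show "(\<lambda>i. \<Sum>k. z i ^ k * (\<epsilon> i * near i k * h k)) \<longlonglongrightarrow> 0"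
      "\<And>i. summable (\<lambda>k. z i ^ k * (\<epsilon> i * near i k * h k))"
      using tannery_sequentially[of "\<lambda>k i. z i ^ k * (\<epsilon> i * near i k * h k)" "\<lambda>_. 0" ?M] by auto
  qed
  define far where "far i k = \<epsilon> i * (1 - near i k) * h k" for i k
  have far_eq: "z i ^ k * far i k = \<epsilon> i * (z i ^ k * h k) - z i ^ k * (\<epsilon> i * near i k * h k)" for i k
    by (simp add: far_def algebra_simps)
  have fars: "summable (\<lambda>k. z i ^ k * far i k)" for i
    unfolding far_eq by (intro summable_diff summable_mult hs T4s)
  have T5: "(\<lambda>i. \<Sum>k. z i ^ k * far i k) \<longlonglongrightarrow> Lim"
  proof -
    have "(\<Sum>k. z i ^ k * far i k) = \<epsilon> i * (\<Sum>k. z i ^ k * h k) - (\<Sum>k. z i ^ k * (\<epsilon> i * near i k * h k))" for i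
      unfolding far_eq using suminf_diff[OF summable_mult[OF hs] T4s] suminf_mult[OF hs] by simp
    then show ?thesis using tendsto_diff[OF T3 T4] by simp
  qed
  define Q where "Q i = (1 - z i) * (\<Sum>m. z i ^ m * uniform_survive (\<epsilon> i) m)" for i
  define a where "a = (\<Sum>k. return_prob k)"
  have a: "0 < a" "a * Pstar = 1"
  proof -
    show "a * Pstar = 1" using suminf_return_prob by (simp add: a_def)
    then show "0 < a" using Pstar_pos by (metis zero_less_mult_pos2 zero_less_one)
  qed
  have Q0: "0 \<le> Q i" for i
  proof -
    have "summable (\<lambda>m. z i ^ m * uniform_survive (\<epsilon> i) m)"
    proof (rule summable_comparison_test'[of "\<lambda>m. z i ^ m" 0])
      show "summable (\<lambda>m. z i ^ m)" using z[of i] by (simp add: summable_geometric)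
      show "norm (z i ^ m * uniform_survive (\<epsilon> i) m) \<le> z i ^ m" for m
        using uniform_survive_bounds[OF \<epsilon>(1), of i m] z[of i] by (simp add: abs_mult mult_left_le)
    qed
    then show ?thesis unfolding Q_def using z[of i] uniform_survive_bounds(1)[OF \<epsilon>(1)]
      by (intro mult_nonneg_nonneg suminf_nonneg) auto
  qed
  \<comment> \<open>The same e is the accuracy of the local limit theorem and the slack in the
    limits of the two weight sums; e < fX 0 and e < a keep the lower denominator positive.\<close>
  have sandwich: "\<forall>\<^sub>F i in sequentially. Q i \<in> {1 / (a + 2 * (fX 0 + e) * Lim + e)..1 / (a + 2 * (fX 0 - e) * Lim - e)}"
    if e: "0 < e" "e < fX 0" "e < a" for e
  proof -
    obtain e0 where e0: "0 < e0"
      "\<And>\<epsilon> k y. 0 < \<epsilon> \<Longrightarrow> \<epsilon> < e0 \<Longrightarrow> 1 \<le> \<epsilon> * (real k)\<^sup>2 \<Longrightarrow> \<bar>y\<bar> \<le> \<epsilon> \<Longrightarrow>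
       \<bar>A k * measure (step_law k) {y-\<epsilon><..<y+\<epsilon>} / (2 * \<epsilon>) - fX 0\<bar> \<le> e"
      using local_limit[OF e(1)] by blast
    define lo where "lo i k = near i k * return_prob k + 2 * (fX 0 - e) * far i k" for i k
    define hi where "hi i k = near i k * win i k + 2 * (fX 0 + e) * far i k" for i k
    have far0: "0 \<le> far i k" for i k using \<epsilon>(1)[of i] near[of i k] h0[of k] by (simp add: far_def)
    have los: "summable (\<lambda>k. z i ^ k * lo i k)" "(\<Sum>k. z i ^ k * lo i k) = (\<Sum>k. z i ^ k * (near i k * return_prob k)) + 2 * (fX 0 - e) * (\<Sum>k. z i ^ k * far i k)" for i
    proof -
      have eq: "z i ^ k * lo i k = z i ^ k * (near i k * return_prob k) + 2 * (fX 0 - e) * (z i ^ k * far i k)" for k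
        by (simp add: lo_def algebra_simps)
      show "summable (\<lambda>k. z i ^ k * lo i k)" unfolding eq by (intro summable_add summable_mult T1s fars)
      show "(\<Sum>k. z i ^ k * lo i k) = (\<Sum>k. z i ^ k * (near i k * return_prob k)) + 2 * (fX 0 - e) * (\<Sum>k. z i ^ k * far i k)"
        unfolding eq using suminf_add[OF T1s summable_mult[OF fars], symmetric] suminf_mult[OF fars] by simp
    qed
    have his: "summable (\<lambda>k. z i ^ k * hi i k)" "(\<Sum>k. z i ^ k * hi i k) = (\<Sum>k. z i ^ k * (near i k * win i k)) + 2 * (fX 0 + e) * (\<Sum>k. z i ^ k * far i k)" for i
    proof -
      have eq: "z i ^ k * hi i k = z i ^ k * (near i k * win i k) + 2 * (fX 0 + e) * (z i ^ k * far i k)" for k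
        by (simp add: hi_def algebra_simps)
      show "summable (\<lambda>k. z i ^ k * hi i k)" unfolding eq by (intro summable_add summable_mult T2s fars)
      show "(\<Sum>k. z i ^ k * hi i k) = (\<Sum>k. z i ^ k * (near i k * win i k)) + 2 * (fX 0 + e) * (\<Sum>k. z i ^ k * far i k)"
        unfolding eq using suminf_add[OF T2s summable_mult[OF fars], symmetric] suminf_mult[OF fars] by simp
    qed
    have "(\<lambda>i. \<Sum>k. z i ^ k * lo i k) \<longlonglongrightarrow> a + 2 * (fX 0 - e) * Lim"
      unfolding los a_def by (intro tendsto_intros T1 T5)
    then have evlo: "\<forall>\<^sub>F i in sequentially. a + 2 * (fX 0 - e) * Lim - e < (\<Sum>k. z i ^ k * lo i k)"
      using e by (intro order_tendstoD) auto
    have "(\<lambda>i. \<Sum>k. z i ^ k * hi i k) \<longlonglongrightarrow> a + 2 * (fX 0 + e) * Lim"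
      unfolding his a_def by (intro tendsto_intros T2 T5)
    then have evhi: "\<forall>\<^sub>F i in sequentially. (\<Sum>k. z i ^ k * hi i k) < a + 2 * (fX 0 + e) * Lim + e"
      using e by (intro order_tendstoD) auto
    have "\<forall>\<^sub>F i in sequentially. \<epsilon> i < e0" using \<epsilon>(2) e0(1) by (intro order_tendstoD) auto
    then show ?thesis using evlo evhi
    proof eventually_elim
      case (elim i)
      have lob: "lo i k \<le> measure (step_law k) {y-\<epsilon> i<..<y+\<epsilon> i}" and hib: "measure (step_law k) {y-\<epsilon> i<..<y+\<epsilon> i} \<le> hi i k"
        if y: "y \<in> {-\<epsilon> i<..<\<epsilon> i}" for k y
      proof -
        interpret L: real_distribution "step_law k" by (rule real_distribution_step_law)
        have "lo i k \<le> measure (step_law k) {y-\<epsilon> i<..<y+\<epsilon> i} \<and> measure (step_law k) {y-\<epsilon> i<..<y+\<epsilon> i} \<le> hi i k"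
        proof (cases "\<epsilon> i * (real k)\<^sup>2 < 1")
          case True
          then have "lo i k = return_prob k" "hi i k = win i k" by (simp_all add: lo_def hi_def near_def far_def)
          then show ?thesis unfolding return_prob_def win_def
            using y by (auto intro!: L.finite_measure_mono)
        next
          case False
          then have "k \<noteq> 0" by (cases "k = 0") auto
          then have Ak: "0 < A k" using A_pos[of k] by simp
          have fe: "far i k = \<epsilon> i / A k" using False \<open>k \<noteq> 0\<close> by (simp add: far_def near_def h_def)
          define m where "m = measure (step_law k) {y-\<epsilon> i<..<y+\<epsilon> i}"
          have "\<bar>A k * m / (2 * \<epsilon> i) - fX 0\<bar> \<le> e"
            unfolding m_def using False y by (intro e0(2) \<epsilon>(1) elim(1)) auto
          then have "fX 0 - e \<le> A k * m / (2 * \<epsilon> i)" "A k * m / (2 * \<epsilon> i) \<le> fX 0 + e" by linarith+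
          then have "2 * (fX 0 - e) * (\<epsilon> i / A k) \<le> m" "m \<le> 2 * (fX 0 + e) * (\<epsilon> i / A k)"
            using Ak \<epsilon>(1)[of i] by (simp_all add: pos_le_divide_eq pos_divide_le_eq mult_ac)
          then show ?thesis using False by (simp add: lo_def hi_def near_def fe m_def)
        qed
        then show "lo i k \<le> measure (step_law k) {y-\<epsilon> i<..<y+\<epsilon> i}" "measure (step_law k) {y-\<epsilon> i<..<y+\<epsilon> i} \<le> hi i k" by auto
      qed
      have lo0: "0 \<le> lo i k" and hi0: "0 \<le> hi i k" for k
        using near[of i k] return_prob_nonneg[of k] far0[of i k] e by (auto simp: lo_def hi_def win_def)
      note us = uniform_survive_bounds[OF \<epsilon>(1)[of i]]
      have L: "(\<Sum>k. z i ^ k * lo i k) * Q i \<le> 1"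
        unfolding Q_def using uniform_renewal_bounds(1)[OF \<epsilon>(1) lob hib] z[of i] lo0 los(1) us
        by (intro generating_function_le(1)) auto
      have H: "1 \<le> (\<Sum>k. z i ^ k * hi i k) * Q i"
        unfolding Q_def using uniform_renewal_bounds(2)[OF \<epsilon>(1) lob hib] z[of i] hi0 his(1) us
        by (intro generating_function_le(2)) auto
      have lpos: "0 < a + 2 * (fX 0 - e) * Lim - e"
      proof -
        have "0 < 2 * (fX 0 - e) * Lim" using e Lim_pos by simp
        then show ?thesis using e by linarith
      qed
      have hpos: "0 < a + 2 * (fX 0 + e) * Lim + e" using a e Lim_pos by (intro add_pos_pos mult_pos_pos) auto
      have "(a + 2 * (fX 0 - e) * Lim - e) * Q i \<le> (\<Sum>k. z i ^ k * lo i k) * Q i"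
        using elim(2) Q0 by (intro mult_right_mono) auto
      then have "(a + 2 * (fX 0 - e) * Lim - e) * Q i \<le> 1" using L by linarith
      then have u: "Q i \<le> 1 / (a + 2 * (fX 0 - e) * Lim - e)" using lpos by (simp add: pos_le_divide_eq mult.commute)
      have "(\<Sum>k. z i ^ k * hi i k) * Q i \<le> (a + 2 * (fX 0 + e) * Lim + e) * Q i"
        using elim(3) Q0 by (intro mult_right_mono) auto
      then have "1 \<le> (a + 2 * (fX 0 + e) * Lim + e) * Q i" using H by linarith
      then have "1 / (a + 2 * (fX 0 + e) * Lim + e) \<le> Q i" using hpos by (simp add: pos_divide_le_eq mult.commute)
      then show ?case using u by simp
    qed
  qed
  have den: "0 < a + 2 * fX 0 * Lim" using a Lim_pos fX_0_pos by (intro add_pos_pos mult_pos_pos) auto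
  have "Q \<longlonglongrightarrow> 1 / (a + 2 * fX 0 * Lim)"
  proof (rule tendstoI)
    fix r :: real assume r: "0 < r"
    have "((\<lambda>e. 1 / (a + 2 * (fX 0 + e) * Lim + e)) \<longlongrightarrow> 1 / (a + 2 * (fX 0 + 0) * Lim + 0)) (at_right 0)"
      using den by (intro tendsto_intros) auto
    then have e1: "\<forall>\<^sub>F e in at_right 0. 1 / (a + 2 * fX 0 * Lim) - r < 1 / (a + 2 * (fX 0 + e) * Lim + e)"
      using r by (intro order_tendstoD) auto
    have "((\<lambda>e. 1 / (a + 2 * (fX 0 - e) * Lim - e)) \<longlongrightarrow> 1 / (a + 2 * (fX 0 - 0) * Lim - 0)) (at_right 0)"
      using den by (intro tendsto_intros) auto
    then have e2: "\<forall>\<^sub>F e in at_right 0. 1 / (a + 2 * (fX 0 - e) * Lim - e) < 1 / (a + 2 * fX 0 * Lim) + r"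
      using r by (intro order_tendstoD) auto
    have e3: "\<forall>\<^sub>F e in at_right 0. 0 < e \<and> e < min (fX 0) a"
      using eventually_at_right_real[of 0 "min (fX 0) a"] fX_0_pos a by (auto elim: eventually_mono)
    have "\<forall>\<^sub>F e in at_right 0. 0 < e \<and> e < fX 0 \<and> e < a \<and> 1 / (a + 2 * fX 0 * Lim) - r < 1 / (a + 2 * (fX 0 + e) * Lim + e)
       \<and> 1 / (a + 2 * (fX 0 - e) * Lim - e) < 1 / (a + 2 * fX 0 * Lim) + r"
      using e1 e2 e3 by eventually_elim simp
    then obtain e where e: "0 < e" "e < fX 0" "e < a" "1 / (a + 2 * fX 0 * Lim) - r < 1 / (a + 2 * (fX 0 + e) * Lim + e)"
       "1 / (a + 2 * (fX 0 - e) * Lim - e) < 1 / (a + 2 * fX 0 * Lim) + r"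
      using eventually_happens[of _ "at_right (0::real)"] by (metis (no_types, lifting) trivial_limit_at_right_real)
    show "\<forall>\<^sub>F i in sequentially. dist (Q i) (1 / (a + 2 * fX 0 * Lim)) < r"
      using sandwich[OF e(1-3)]
    proof eventually_elim
      case (elim i)
      then have "1 / (a + 2 * (fX 0 + e) * Lim + e) \<le> Q i" "Q i \<le> 1 / (a + 2 * (fX 0 - e) * Lim - e)" by auto
      then show ?case using e(4,5) unfolding dist_real_def by linarith
    qed
  qed
  moreover have "1 / (a + 2 * fX 0 * Lim) = Pstar / (1 + Gamma p * (2 * fX 0 * Pstar) * p * \<theta> * s powr (- p))"
  proof -
    have "1 / (a + 2 * fX 0 * Lim) = Pstar / (Pstar * (a + 2 * fX 0 * Lim))" using Pstar_pos by simp
    also have "Pstar * (a + 2 * fX 0 * Lim) = 1 + Gamma p * (2 * fX 0 * Pstar) * p * \<theta> * s powr (- p)"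
      using a(2) by (simp add: Lim_def algebra_simps)
    finally show ?thesis .
  qed
  ultimately show ?thesis by (simp add: Q_def[abs_def])
qed

end

section \<open>Transfer to the given probability spaces\<close>

text \<open>The value at \<open>\<infinity>\<close> is the right one only for \<open>0 \<le> z < 1\<close>.\<close>
definition enat_power :: "real \<Rightarrow> enat \<Rightarrow> real" where
  "enat_power z T = (case T of enat m \<Rightarrow> z ^ m | \<infinity> \<Rightarrow> 0)"

lemma enat_power_bounds: "0 \<le> z \<Longrightarrow> z \<le> 1 \<Longrightarrow> 0 \<le> enat_power z T" "0 \<le> z \<Longrightarrow> z \<le> 1 \<Longrightarrow> enat_power z T \<le> 1"
  by (auto simp: enat_power_def power_le_one split: enat.split)

text \<open>k = 0 is excluded because at infinity the left side would be 0 ^ 0 = 1 and the right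
  side 0.\<close>

lemma enat_power_power: "1 \<le> k \<Longrightarrow> enat_power z T ^ k = enat_power (z ^ k) T"
  by (auto simp: enat_power_def power_mult[symmetric] mult.commute split: enat.split)

lemma enat_power_tail_sum:
  assumes "0 < z" "z < 1"
  shows "(\<lambda>m. z ^ m * (if enat m < T then 1 else 0)) sums ((1 - enat_power z T) / (1 - z))"
proof (cases T)
  case (enat n)
  have "(\<lambda>m. z ^ m * (if enat m < T then 1 else 0)) sums (\<Sum>m<n. z ^ m * (if enat m < T then 1 else 0))"
    by (rule sums_finite) (auto simp: enat)
  also have "(\<Sum>m<n. z ^ m * (if enat m < T then 1 else 0)) = (\<Sum>m<n. z ^ m)" by (intro sum.cong) (auto simp: enat)
  also have "\<dots> = (1 - z ^ n) / (1 - z)" using assms by (simp add: sum_gp_strict)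
  finally show ?thesis by (simp add: enat_power_def enat)
next
  case infinity
  then show ?thesis using geometric_sums[of z] assms by (simp add: enat_power_def)
qed

text \<open>The tail indicators of T, weighted by z^m, sum pointwise to (1 - z^T) / (1 - z).
  Termwise integration turns the generating function of survival probabilities into a Laplace
  transform of the hitting time.\<close>

lemma (in prob_space) expectation_enat_power:
  assumes z: "0 < z" "z < 1" and T: "\<And>m. {\<omega> \<in> space M. enat m < T \<omega>} \<in> sets M"
  shows "expectation (\<lambda>\<omega>. enat_power z (T \<omega>)) = 1 - (1 - z) * (\<Sum>m. z ^ m * prob {\<omega> \<in> space M. enat m < T \<omega>})"
    and "(\<lambda>\<omega>. enat_power z (T \<omega>)) \<in> borel_measurable M"
proof -
  let ?f = "\<lambda>m \<omega>. z ^ m * indicator {\<omega> \<in> space M. enat m < T \<omega>} \<omega>"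
  have int: "integrable M (?f m)" for m using T[of m] by (intro integrable_mult_right integrable_real_indicator) (auto simp: less_top[symmetric])
  have int_eq: "(\<integral>\<omega>. ?f m \<omega> \<partial>M) = z ^ m * prob {\<omega> \<in> space M. enat m < T \<omega>}" for m using T[of m] by simp
  have geo: "summable (\<lambda>m. z ^ m)" using z by (simp add: summable_geometric)
  have sm: "summable (\<lambda>m. z ^ m * prob {\<omega> \<in> space M. enat m < T \<omega>})"
    by (rule summable_comparison_test'[OF geo, of 0]) (use z in \<open>auto simp: abs_mult intro!: mult_left_le\<close>)
  have pw: "(\<lambda>m. ?f m \<omega>) sums ((1 - enat_power z (T \<omega>)) / (1 - z))" if "\<omega> \<in> space M" for \<omega>
    using enat_power_tail_sum[OF z, of "T \<omega>"] that by (simp add: indicator_def of_bool_def)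
  have eq: "enat_power z (T \<omega>) = 1 - (1 - z) * (\<Sum>m. ?f m \<omega>)" if "\<omega> \<in> space M" for \<omega>
    using sums_unique[OF pw[OF that]] z by (simp add: field_simps)
  have si: "integrable M (\<lambda>\<omega>. \<Sum>m. ?f m \<omega>)" "(\<integral>\<omega>. (\<Sum>m. ?f m \<omega>) \<partial>M) = (\<Sum>m. \<integral>\<omega>. ?f m \<omega> \<partial>M)"
  proof -
    have n: "AE \<omega> in M. summable (\<lambda>m. norm (?f m \<omega>))"
    proof (rule AE_I2)
      fix \<omega> show "summable (\<lambda>m. norm (?f m \<omega>))"
        by (rule summable_comparison_test'[OF geo, of 0]) (use z in \<open>auto simp: abs_mult indicator_def\<close>)
    qed
    have s: "summable (\<lambda>m. \<integral>\<omega>. norm (?f m \<omega>) \<partial>M)" using sm z T by (simp add: abs_mult)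
    show "integrable M (\<lambda>\<omega>. \<Sum>m. ?f m \<omega>)" using int n s by (rule integrable_suminf)
    show "(\<integral>\<omega>. (\<Sum>m. ?f m \<omega>) \<partial>M) = (\<Sum>m. \<integral>\<omega>. ?f m \<omega> \<partial>M)" using int n s by (rule integral_suminf)
  qed
  have "expectation (\<lambda>\<omega>. enat_power z (T \<omega>)) = expectation (\<lambda>\<omega>. 1 - (1 - z) * (\<Sum>m. ?f m \<omega>))"
    using eq by (intro Bochner_Integration.integral_cong) auto
  also have "\<dots> = 1 - (1 - z) * (\<Sum>m. \<integral>\<omega>. ?f m \<omega> \<partial>M)" using si prob_space by simp
  finally show "expectation (\<lambda>\<omega>. enat_power z (T \<omega>)) = 1 - (1 - z) * (\<Sum>m. z ^ m * prob {\<omega> \<in> space M. enat m < T \<omega>})"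
    unfolding int_eq .
  have "(\<lambda>\<omega>. 1 - (1 - z) * (\<Sum>m. ?f m \<omega>)) \<in> borel_measurable M"
    using si(1) by (intro borel_measurable_diff borel_measurable_times) auto
  then show "(\<lambda>\<omega>. enat_power z (T \<omega>)) \<in> borel_measurable M"
    using eq by (subst measurable_cong[where g="\<lambda>\<omega>. 1 - (1 - z) * (\<Sum>m. ?f m \<omega>)"]) auto
qed

section \<open>Transfer of the given steps to the sequence space\<close>

locale iid_walk = prob_space M for M :: "'a measure" +
  fixes X :: "nat \<Rightarrow> 'a \<Rightarrow> real"
  assumes indep: "indep_vars (\<lambda>_. borel) X UNIV"
    and ident: "\<And>i. distr M borel (X i) = distr M borel (X 0)"
begin

abbreviation "D \<equiv> distr M borel (X 0)"

lemma X_measurable [measurable]: "X i \<in> borel_measurable M"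
  using indep by (auto simp: indep_vars_def)

sublocale steps: iid_steps D
  by (simp add: iid_steps_def real_distribution_distr)

lemma walk_eq: "walk X n \<omega> = steps.ps n (\<lambda>i. X i \<omega>)"
  by (simp add: walk_def steps.ps_def)

lemma walk_measurable [measurable]: "walk X n \<in> borel_measurable M"
  unfolding walk_def[abs_def] by measurable

lemma path_law: "distr M steps.\<S> (\<lambda>\<omega> i. X i \<omega>) = steps.\<S>"
proof -
  have "distr M (\<Pi>\<^sub>M i\<in>UNIV. borel) (\<lambda>\<omega>. \<lambda>i\<in>UNIV. X i \<omega>) = (\<Pi>\<^sub>M i\<in>UNIV. distr M borel (X i))"
    using indep by (subst (asm) indep_vars_iff_distr_eq_PiM) auto
  also have "\<dots> = steps.\<S>" using ident by (intro PiM_cong) auto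
  finally have "distr M (\<Pi>\<^sub>M i\<in>UNIV. borel) (\<lambda>\<omega> i. X i \<omega>) = steps.\<S>" by (simp add: restrict_def)
  moreover have "distr M steps.\<S> (\<lambda>\<omega> i. X i \<omega>) = distr M (\<Pi>\<^sub>M i\<in>UNIV. borel) (\<lambda>\<omega> i. X i \<omega>)"
    by (intro distr_cong sets_PiM_cong) auto
  ultimately show ?thesis by simp
qed

lemma path_measurable [measurable]: "(\<lambda>\<omega> i. X i \<omega>) \<in> measurable M steps.\<S>"
proof -
  have "(\<lambda>\<omega>. \<lambda>i\<in>UNIV. X i \<omega>) \<in> measurable M steps.\<S>"
    by (rule measurable_restrict) (simp add: measurable_def)
  then show ?thesis by (simp add: restrict_def)
qed

lemma prob_path:
  assumes "{x \<in> space steps.\<S>. P x} \<in> sets steps.\<S>"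
  shows "prob {\<omega> \<in> space M. P (\<lambda>i. X i \<omega>)} = measure steps.\<S> {x \<in> space steps.\<S>. P x}"
proof -
  have "measure steps.\<S> {x \<in> space steps.\<S>. P x} = measure (distr M steps.\<S> (\<lambda>\<omega> i. X i \<omega>)) {x \<in> space steps.\<S>. P x}"
    by (simp add: path_law)
  also have "\<dots> = prob ((\<lambda>\<omega> i. X i \<omega>) -` {x \<in> space steps.\<S>. P x} \<inter> space M)"
    using assms by (intro measure_distr) auto
  also have "(\<lambda>\<omega> i. X i \<omega>) -` {x \<in> space steps.\<S>. P x} \<inter> space M = {\<omega> \<in> space M. P (\<lambda>i. X i \<omega>)}"
    by (auto simp: steps.space_\<S>)
  finally show ?thesis by simp
qed

lemma distr_walk: "distr M borel (walk X k) = steps.step_law k"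
proof -
  have "steps.step_law k = distr (distr M steps.\<S> (\<lambda>\<omega> i. X i \<omega>)) borel (steps.ps k)"
    by (simp add: steps.step_law_def path_law)
  also have "\<dots> = distr M borel (steps.ps k \<circ> (\<lambda>\<omega> i. X i \<omega>))" by (rule distr_distr) measurable
  also have "steps.ps k \<circ> (\<lambda>\<omega> i. X i \<omega>) = walk X k" by (auto simp: walk_eq)
  finally show ?thesis by simp
qed

lemma char_walk: "char (distr M borel (walk X k)) t = char D t ^ k"
proof -
  have "indep_vars (\<lambda>_. borel) X {..<k}" using indep by (rule indep_vars_subset) simp
  then have "char (distr M borel (\<lambda>\<omega>. \<Sum>i<k. X i \<omega>)) t = (\<Prod>i<k. char (distr M borel (X i)) t)"
    by (rule char_distr_sum)
  also have "\<dots> = (\<Prod>i<k. char D t)"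
    by (intro prod.cong refl arg_cong[where f="\<lambda>\<mu>. char \<mu> t"] ident)
  finally show ?thesis by (simp add: walk_def[abs_def])
qed

lemma prob_walk_avoids:
  assumes [measurable]: "J \<in> sets borel"
  shows "prob {\<omega> \<in> space M. \<forall>j\<in>{1..m}. y + walk X j \<omega> \<notin> J} = steps.survive J y m"
  unfolding walk_eq steps.survive_def by (rule prob_path) measurable

lemma prob_never_zero:
  "prob {\<omega> \<in> space M. \<forall>j\<ge>1. walk X j \<omega> \<noteq> 0} = measure steps.\<S> {x \<in> space steps.\<S>. \<forall>j\<ge>1. steps.ps j x \<noteq> 0}"
  unfolding walk_eq by (rule prob_path) measurable

text \<open>Independence of the start from the whole walk is given through generated sigma-algebras.
  It is first turned into a product law, under which fixing the start u leaves the survival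
  probability from u.\<close>

lemma prob_uniform_walk_avoids:
  assumes \<epsilon>: "0 < \<epsilon>" and U [measurable]: "U \<in> borel_measurable M"
    and unif: "distr M lborel U = uniform_measure lborel {-\<epsilon><..<\<epsilon>}"
    and ind: "indep_set (sets (vimage_algebra (space M) U borel))
           (sets (vimage_algebra (space M) (\<lambda>\<omega> n. walk X n \<omega>) (Pi\<^sub>M UNIV (\<lambda>_. borel))))"
  shows "prob {\<omega> \<in> space M. \<forall>j\<in>{1..m}. \<not> \<bar>U \<omega> + walk X j \<omega>\<bar> < \<epsilon>} = steps.uniform_survive \<epsilon> m"
proof -
  let ?W = "\<lambda>\<omega> n. walk X n \<omega>" and ?P = "\<Pi>\<^sub>M i\<in>(UNIV::nat set). (borel :: real measure)" and ?J = "{-\<epsilon><..<\<epsilon>}"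
  have Wm [measurable]: "?W \<in> measurable M ?P"
  proof -
    have "(\<lambda>\<omega>. \<lambda>n\<in>UNIV. walk X n \<omega>) \<in> measurable M ?P" by (rule measurable_restrict) simp
    then show ?thesis by (simp add: restrict_def)
  qed
  interpret dU: prob_space "distr M borel U" by (rule prob_space_distr) simp
  interpret dW: prob_space "distr M ?P ?W" by (rule prob_space_distr) simp
  have joint: "distr M borel U \<Otimes>\<^sub>M distr M ?P ?W = distr M (borel \<Otimes>\<^sub>M ?P) (\<lambda>\<omega>. (U \<omega>, ?W \<omega>))"
  proof (rule pair_measure_eqI)
    fix A B assume "A \<in> sets (distr M borel U)" "B \<in> sets (distr M ?P ?W)"
    then have [measurable]: "A \<in> sets borel" "B \<in> sets ?P" by auto
    have "prob ((U -` A \<inter> space M) \<inter> (?W -` B \<inter> space M)) = prob (U -` A \<inter> space M) * prob (?W -` B \<inter> space M)"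
      using ind unfolding indep_sets2_eq by (blast intro: in_vimage_algebra \<open>A \<in> sets borel\<close> \<open>B \<in> sets ?P\<close>)
    moreover have "(\<lambda>\<omega>. (U \<omega>, ?W \<omega>)) -` (A \<times> B) \<inter> space M = (U -` A \<inter> space M) \<inter> (?W -` B \<inter> space M)" by auto
    ultimately show "emeasure (distr M borel U) A * emeasure (distr M ?P ?W) B = emeasure (distr M (borel \<Otimes>\<^sub>M ?P) (\<lambda>\<omega>. (U \<omega>, ?W \<omega>))) (A \<times> B)"
      by (simp add: emeasure_distr emeasure_eq_measure ennreal_mult'[symmetric])
  qed (auto simp: dU.sigma_finite_measure_axioms dW.sigma_finite_measure_axioms cong: sets_pair_measure_cong)
  define S where "S = {p \<in> space (borel \<Otimes>\<^sub>M ?P). \<forall>j\<in>{1..m}. \<not> \<bar>fst p + snd p j\<bar> < \<epsilon>}"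
  have cm [measurable]: "(\<lambda>w. w j) \<in> borel_measurable ?P" for j by (rule measurable_component_singleton) simp
  have Sm: "S \<in> sets (borel \<Otimes>\<^sub>M ?P)"
  proof -
    have "(\<lambda>p. snd p j) \<in> borel_measurable (borel \<Otimes>\<^sub>M ?P)" for j
      by (rule measurable_compose[OF measurable_snd cm])
    then show ?thesis unfolding S_def by measurable
  qed
  have "emeasure M {\<omega> \<in> space M. \<forall>j\<in>{1..m}. \<not> \<bar>U \<omega> + walk X j \<omega>\<bar> < \<epsilon>} = emeasure (distr M (borel \<Otimes>\<^sub>M ?P) (\<lambda>\<omega>. (U \<omega>, ?W \<omega>))) S"
    using Sm by (subst emeasure_distr) (auto simp: S_def space_pair_measure space_PiM intro!: arg_cong[where f="emeasure M"])
  also have "\<dots> = emeasure (distr M borel U \<Otimes>\<^sub>M distr M ?P ?W) S" by (simp only: joint)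
  also have "\<dots> = (\<integral>\<^sup>+u. emeasure (distr M ?P ?W) (Pair u -` S) \<partial>distr M borel U)"
    by (rule dW.emeasure_pair_measure_alt) (use Sm in \<open>simp cong: sets_pair_measure_cong\<close>)
  also have "\<dots> = (\<integral>\<^sup>+u. ennreal (steps.survive ?J u m) \<partial>distr M borel U)"
  proof (rule nn_integral_cong)
    fix u :: real
    have Su: "Pair u -` S = {w \<in> space ?P. \<forall>j\<in>{1..m}. \<not> \<bar>u + w j\<bar> < \<epsilon>}" by (auto simp: S_def space_pair_measure)
    have "Pair u -` S \<in> sets ?P" unfolding Su by measurable
    then have "emeasure (distr M ?P ?W) (Pair u -` S) = emeasure M (?W -` (Pair u -` S) \<inter> space M)"
      by (intro emeasure_distr) auto
    also have "?W -` (Pair u -` S) \<inter> space M = {\<omega> \<in> space M. \<forall>j\<in>{1..m}. u + walk X j \<omega> \<notin> ?J}"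
      unfolding Su by (auto simp: space_PiM abs_less_iff)
    finally show "emeasure (distr M ?P ?W) (Pair u -` S) = ennreal (steps.survive ?J u m)"
      using prob_walk_avoids[of ?J m u] by (simp add: emeasure_eq_measure)
  qed
  also have "\<dots> = (\<integral>\<^sup>+u. ennreal (steps.survive ?J u m) \<partial>distr M lborel U)"
  proof -
    have "distr M borel U = distr M lborel U" by (intro distr_cong) auto
    then show ?thesis by simp
  qed
  also have "\<dots> = (\<integral>\<^sup>+u. ennreal (steps.survive ?J u m) * indicator ?J u \<partial>lborel) / emeasure lborel ?J"
    unfolding unif by (rule nn_integral_uniform_measure) auto
  also have "(\<integral>\<^sup>+u. ennreal (steps.survive ?J u m) * indicator ?J u \<partial>lborel) = (\<integral>\<^sup>+u. ennreal (indicator ?J u * steps.survive ?J u m) \<partial>lborel)"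
    by (intro nn_integral_cong) (auto simp: indicator_def)
  also have "\<dots> = ennreal (LBINT u. indicator ?J u * steps.survive ?J u m)"
    by (rule nn_integral_eq_integral[OF steps.integrable_survive]) (auto simp: steps.survive_bounds)
  also have "emeasure lborel ?J = ennreal (2 * \<epsilon>)" using \<epsilon> by simp
  also have "ennreal (LBINT u. indicator ?J u * steps.survive ?J u m) / ennreal (2 * \<epsilon>) = ennreal (steps.uniform_survive \<epsilon> m)"
    unfolding steps.uniform_survive_def using \<epsilon>
    by (intro divide_ennreal integral_nonneg_AE) (auto simp: steps.survive_bounds)
  finally show ?thesis using steps.uniform_survive_bounds(1)[OF \<epsilon>] by (simp add: emeasure_eq_measure)
qed

end

section \<open>The law of E powr \<beta> * Gs\<close>

locale exp_stable_product = prob_space N for N :: "'b measure" +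
  fixes E Gs :: "'b \<Rightarrow> real" and \<beta> :: real
  assumes E_exp: "distributed N lborel E (exponential_density 1)"
    and Gs_rv [measurable]: "Gs \<in> borel_measurable N"
    and Gs_nonneg: "AE \<omega> in N. 0 \<le> Gs \<omega>"
    and Gs_laplace: "\<And>s. 0 < s \<Longrightarrow>
        (\<integral>\<^sup>+\<omega>. ennreal (exp (- s * Gs \<omega>)) \<partial>N) = ennreal (exp (- (s powr (1 / \<beta>))))"
    and EG_indep: "indep_var borel E borel Gs"
    and \<beta>: "0 < \<beta>"
begin

lemma E_rv [measurable]: "E \<in> borel_measurable N"
  using distributed_measurable[OF E_exp] by simp

lemma E_law: "distr N borel E = density lborel (exponential_density 1)"
proof -
  have "distr N borel E = distr N lborel E" by (intro distr_cong) auto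
  then show ?thesis using distributed_distr_eq_density[OF E_exp] by simp
qed

text \<open>Both orders of integration: for a fixed value of E the Laplace transform of Gs applies,
  for a fixed value of Gs the law of E has a density.\<close>

lemma nn_integral_product:
  assumes f: "f \<in> borel_measurable (borel \<Otimes>\<^sub>M borel)"
  shows "(\<integral>\<^sup>+\<omega>. f (E \<omega>, Gs \<omega>) \<partial>N)
      = (\<integral>\<^sup>+x. ennreal (exponential_density 1 x) * (\<integral>\<^sup>+\<omega>. f (x, Gs \<omega>) \<partial>N) \<partial>lborel)"
    and "(\<integral>\<^sup>+\<omega>. f (E \<omega>, Gs \<omega>) \<partial>N)
      = (\<integral>\<^sup>+g. (\<integral>\<^sup>+x. ennreal (exponential_density 1 x) * f (x, g) \<partial>lborel) \<partial>distr N borel Gs)"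
proof -
  let ?E = "distr N borel E" and ?G = "distr N borel Gs"
  interpret dE: prob_space ?E by (rule prob_space_distr) simp
  interpret dG: prob_space ?G by (rule prob_space_distr) simp
  interpret P: pair_prob_space ?E ?G ..
  have joint: "?E \<Otimes>\<^sub>M ?G = distr N (borel \<Otimes>\<^sub>M borel) (\<lambda>\<omega>. (E \<omega>, Gs \<omega>))"
    using EG_indep unfolding indep_var_distribution_eq by simp
  have fm: "f \<in> borel_measurable (?E \<Otimes>\<^sub>M ?G)" using f by (simp cong: measurable_cong_sets)
  have e1: "(\<integral>\<^sup>+\<omega>. f (E \<omega>, Gs \<omega>) \<partial>N) = (\<integral>\<^sup>+p. f p \<partial>(?E \<Otimes>\<^sub>M ?G))"
    unfolding joint using f by (subst nn_integral_distr) auto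
  have sec [measurable]: "(\<lambda>g. f (x, g)) \<in> borel_measurable borel" "(\<lambda>x. f (x, g)) \<in> borel_measurable borel" for x g
    using f by measurable
  have inner [measurable]: "(\<lambda>x. \<integral>\<^sup>+g. f (x, g) \<partial>?G) \<in> borel_measurable borel"
    using dG.borel_measurable_nn_integral_fst[of f borel] f by (simp cong: measurable_cong_sets)
  have "(\<integral>\<^sup>+p. f p \<partial>(?E \<Otimes>\<^sub>M ?G)) = (\<integral>\<^sup>+x. (\<integral>\<^sup>+g. f (x, g) \<partial>?G) \<partial>?E)"
    using fm by (rule dG.nn_integral_fst[symmetric])
  also have "\<dots> = (\<integral>\<^sup>+x. ennreal (exponential_density 1 x) * (\<integral>\<^sup>+g. f (x, g) \<partial>?G) \<partial>lborel)"
    unfolding E_law by (subst nn_integral_density) auto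
  also have "\<dots> = (\<integral>\<^sup>+x. ennreal (exponential_density 1 x) * (\<integral>\<^sup>+\<omega>. f (x, Gs \<omega>) \<partial>N) \<partial>lborel)"
    by (subst nn_integral_distr) auto
  finally show "(\<integral>\<^sup>+\<omega>. f (E \<omega>, Gs \<omega>) \<partial>N)
      = (\<integral>\<^sup>+x. ennreal (exponential_density 1 x) * (\<integral>\<^sup>+\<omega>. f (x, Gs \<omega>) \<partial>N) \<partial>lborel)" using e1 by simp
  have "(\<integral>\<^sup>+p. f p \<partial>(?E \<Otimes>\<^sub>M ?G)) = (\<integral>\<^sup>+g. (\<integral>\<^sup>+x. f (x, g) \<partial>?E) \<partial>?G)"
    using P.nn_integral_snd[OF fm] by simp
  also have "\<dots> = (\<integral>\<^sup>+g. (\<integral>\<^sup>+x. ennreal (exponential_density 1 x) * f (x, g) \<partial>lborel) \<partial>?G)"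
    unfolding E_law by (subst nn_integral_density) auto
  finally show "(\<integral>\<^sup>+\<omega>. f (E \<omega>, Gs \<omega>) \<partial>N)
      = (\<integral>\<^sup>+g. (\<integral>\<^sup>+x. ennreal (exponential_density 1 x) * f (x, g) \<partial>lborel) \<partial>?G)" using e1 by simp
qed

lemma E_pos: "AE \<omega> in N. 0 < E \<omega>"
proof -
  have "(\<integral>\<^sup>+\<omega>. (\<lambda>p. indicator {..0} (fst p)) (E \<omega>, Gs \<omega>) \<partial>N)
     = (\<integral>\<^sup>+x. ennreal (exponential_density 1 x) * (\<integral>\<^sup>+\<omega>. (\<lambda>p. indicator {..0} (fst p)) (x, Gs \<omega>) \<partial>N) \<partial>lborel)"
    by (rule nn_integral_product) measurable
  also have "\<dots> = 0"
  proof (subst nn_integral_0_iff_AE)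
    show "AE x in lborel. ennreal (exponential_density 1 x) * (\<integral>\<^sup>+\<omega>. (\<lambda>p. indicator {..0} (fst p)) (x, Gs \<omega>) \<partial>N) = 0"
      using AE_lborel_singleton[of 0] by eventually_elim (auto simp: exponential_density_def indicator_def)
  qed (simp add: emeasure_space_1)
  finally have "(\<integral>\<^sup>+\<omega>. indicator {..0} (E \<omega>) \<partial>N) = 0" by simp
  then have "AE \<omega> in N. (indicator {..0} (E \<omega>) :: ennreal) = 0" by (subst (asm) nn_integral_0_iff_AE) auto
  then show ?thesis by eventually_elim (auto simp: indicator_def split: if_splits)
qed

text \<open>For a fixed value g of Gs at most one positive x solves x powr \<beta> * g = t, a null
  set for E; t > 0 excludes g = 0. Hence every positive level is a continuity point of the limit
  law.\<close>

lemma no_atom: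
  assumes t: "0 < t"
  shows "AE \<omega> in N. E \<omega> powr \<beta> * Gs \<omega> \<noteq> t"
proof -
  let ?f = "\<lambda>p. indicator {p. 0 < fst p \<and> fst p powr \<beta> * snd p = t} p :: ennreal"
  have fm: "?f \<in> borel_measurable (borel \<Otimes>\<^sub>M borel)" by measurable
  have "(\<integral>\<^sup>+\<omega>. ?f (E \<omega>, Gs \<omega>) \<partial>N) = (\<integral>\<^sup>+g. (\<integral>\<^sup>+x. ennreal (exponential_density 1 x) * ?f (x, g) \<partial>lborel) \<partial>distr N borel Gs)"
    by (rule nn_integral_product(2)[OF fm])
  also have "\<dots> = (\<integral>\<^sup>+g. 0 \<partial>distr N borel Gs)"
  proof (rule nn_integral_cong)
    fix g :: real
    have "AE x in lborel. ennreal (exponential_density 1 x) * ?f (x, g) = 0"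
      using AE_lborel_singleton[of "(t / g) powr (1 / \<beta>)"]
    proof eventually_elim
      case (elim x)
      have "\<not> (0 < x \<and> x powr \<beta> * g = t)"
      proof
        assume a: "0 < x \<and> x powr \<beta> * g = t"
        then have "g \<noteq> 0" using t by auto
        then have "t / g = x powr \<beta>" using a by (simp add: field_simps)
        then have "(t / g) powr (1 / \<beta>) = x" using a \<beta> by (simp add: powr_powr)
        then show False using elim by simp
      qed
      then show ?case by (auto simp: indicator_def)
    qed
    moreover have "(\<lambda>x. ennreal (exponential_density 1 x) * ?f (x, g)) \<in> borel_measurable lborel"
      using fm by measurable
    ultimately show "(\<integral>\<^sup>+x. ennreal (exponential_density 1 x) * ?f (x, g) \<partial>lborel) = 0"
      by (subst nn_integral_0_iff_AE)
  qed
  finally have "(\<integral>\<^sup>+\<omega>. ?f (E \<omega>, Gs \<omega>) \<partial>N) = 0" by simp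
  moreover have "(\<lambda>\<omega>. ?f (E \<omega>, Gs \<omega>)) \<in> borel_measurable N" using fm by measurable
  ultimately have "AE \<omega> in N. ?f (E \<omega>, Gs \<omega>) = 0" by (subst (asm) nn_integral_0_iff_AE)
  then show ?thesis using E_pos by eventually_elim (auto simp: indicator_def split: if_splits)
qed

text \<open>Given E = x the inner transform is exp (- a x), because (s * x powr \<beta>) powr (1 /
  \<beta>) is linear in x with slope a = s powr (1 / \<beta>). The exponential density then
  integrates to 1 / (1 + a).\<close>

lemma laplace_transform:
  assumes s: "0 < s"
  shows "expectation (\<lambda>\<omega>. exp (- s * (E \<omega> powr \<beta> * Gs \<omega>))) = 1 / (1 + s powr (1 / \<beta>))"
proof -
  define a where "a = s powr (1 / \<beta>)"
  have a: "0 < a" using s by (simp add: a_def)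
  let ?f = "\<lambda>p::real\<times>real. ennreal (exp (- s * (fst p powr \<beta> * snd p)))"
  have fm: "?f \<in> borel_measurable (borel \<Otimes>\<^sub>M borel)" by measurable
  have "(\<integral>\<^sup>+\<omega>. ?f (E \<omega>, Gs \<omega>) \<partial>N) = (\<integral>\<^sup>+x. ennreal (exponential_density 1 x) * (\<integral>\<^sup>+\<omega>. ?f (x, Gs \<omega>) \<partial>N) \<partial>lborel)"
    by (rule nn_integral_product(1)[OF fm])
  also have "\<dots> = (\<integral>\<^sup>+x. ennreal (indicator {0<..} x * (exp (- (1 + a) * x) * x powr (1 - 1))) \<partial>lborel)"
  proof (rule nn_integral_cong_AE)
    show "AE x in lborel. ennreal (exponential_density 1 x) * (\<integral>\<^sup>+\<omega>. ?f (x, Gs \<omega>) \<partial>N) = ennreal (indicator {0<..} x * (exp (- (1 + a) * x) * x powr (1 - 1)))"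
      using AE_lborel_singleton[of 0]
    proof eventually_elim
      case (elim x)
      show ?case
      proof (cases "0 < x")
        case True
        have sx: "0 < s * x powr \<beta>" using s True by simp
        have "(\<integral>\<^sup>+\<omega>. ?f (x, Gs \<omega>) \<partial>N) = (\<integral>\<^sup>+\<omega>. ennreal (exp (- (s * x powr \<beta>) * Gs \<omega>)) \<partial>N)"
          by (simp add: mult.assoc)
        also have "\<dots> = ennreal (exp (- ((s * x powr \<beta>) powr (1 / \<beta>))))" by (rule Gs_laplace[OF sx])
        also have "(s * x powr \<beta>) powr (1 / \<beta>) = a * x" using s True \<beta> by (simp add: powr_mult powr_powr a_def)
        finally have "(\<integral>\<^sup>+\<omega>. ?f (x, Gs \<omega>) \<partial>N) = ennreal (exp (- (a * x)))" .
        then show ?thesis using True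
          by (simp add: exponential_density_def ennreal_mult'[symmetric] exp_add[symmetric] algebra_simps)
      next
        case False
        then show ?thesis using elim by (simp add: exponential_density_def)
      qed
    qed
  qed
  also have "\<dots> = ennreal (Gamma 1 * (1 + a) powr (- 1))"
  proof -
    have hb: "has_bochner_integral lborel (\<lambda>x. indicator {0<..} x * (exp (- (1 + a) * x) * x powr (1 - 1))) (Gamma 1 * (1 + a) powr (- 1))"
      by (rule has_bochner_integral_Gamma_scaled) (use a in auto)
    then have "(LBINT x. indicator {0<..} x * (exp (- (1 + a) * x) * x powr (1 - 1))) = Gamma 1 * (1 + a) powr (- 1)"
      by (rule has_bochner_integral_integral_eq)
    moreover have "(\<integral>\<^sup>+x. ennreal (indicator {0<..} x * (exp (- (1 + a) * x) * x powr (1 - 1))) \<partial>lborel)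
       = ennreal (LBINT x. indicator {0<..} x * (exp (- (1 + a) * x) * x powr (1 - 1)))"
      by (rule nn_integral_eq_integral[OF integrable.intros[OF hb]]) auto
    ultimately show ?thesis by simp
  qed
  also have "Gamma 1 * (1 + a) powr (- 1) = 1 / (1 + a)" using a by (simp add: powr_minus_divide)
  finally have "(\<integral>\<^sup>+\<omega>. ennreal (exp (- s * (E \<omega> powr \<beta> * Gs \<omega>))) \<partial>N) = ennreal (1 / (1 + a))" by simp
  then have "has_bochner_integral N (\<lambda>\<omega>. exp (- s * (E \<omega> powr \<beta> * Gs \<omega>))) (1 / (1 + a))"
    using a by (intro has_bochner_integral_nn_integral) auto
  then show ?thesis by (simp add: has_bochner_integral_integral_eq a_def)
qed

text \<open>Links the two forms of the limit: raising to the power \<beta> is strictly increasing on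
  the nonnegative reals, and almost surely E > 0 and Gs \<ge> 0.\<close>

lemma powr_form:
  assumes t: "0 < t"
  shows "prob {\<omega> \<in> space N. E \<omega> * Gs \<omega> powr (1 / \<beta>) \<le> t} = prob {\<omega> \<in> space N. E \<omega> powr \<beta> * Gs \<omega> \<le> t powr \<beta>}"
proof (rule finite_measure_eq_AE)
  show "AE \<omega> in N. \<omega> \<in> {\<omega> \<in> space N. E \<omega> * Gs \<omega> powr (1 / \<beta>) \<le> t} \<longleftrightarrow> \<omega> \<in> {\<omega> \<in> space N. E \<omega> powr \<beta> * Gs \<omega> \<le> t powr \<beta>}"
    using E_pos Gs_nonneg
  proof eventually_elim
    case (elim \<omega>)
    define x where "x = E \<omega> * Gs \<omega> powr (1 / \<beta>)"
    have x: "0 \<le> x" using elim by (simp add: x_def)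
    have "x powr \<beta> = E \<omega> powr \<beta> * Gs \<omega>"
      using elim \<beta> by (simp add: x_def powr_mult powr_powr)
    moreover have "x \<le> t \<longleftrightarrow> x powr \<beta> \<le> t powr \<beta>"
    proof
      show "x \<le> t \<Longrightarrow> x powr \<beta> \<le> t powr \<beta>" using x \<beta> by (intro powr_mono2) auto
      show "x powr \<beta> \<le> t powr \<beta> \<Longrightarrow> x \<le> t" using x \<beta> t powr_less_mono2[of \<beta> t x] by fastforce
    qed
    ultimately show ?case by (simp add: x_def)
  qed
qed measurable

end

section \<open>Limit law of the hitting time\<close>

lemma less_first_hit_iff: "enat m < first_hit P \<longleftrightarrow> (\<forall>j\<in>{1..m}. \<not> P j)"
proof (cases "\<exists>n\<ge>1. P n")
  case True
  define l where "l = (LEAST n. 1 \<le> n \<and> P n)"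
  have l: "1 \<le> l \<and> P l" unfolding l_def by (rule LeastI_ex[of "\<lambda>n. 1 \<le> n \<and> P n"]) (use True in blast)
  have least: "l \<le> j" if "1 \<le> j" "P j" for j
    unfolding l_def by (rule Least_le[of "\<lambda>n. 1 \<le> n \<and> P n"]) (use that in blast)
  have "first_hit P = enat l" using True by (simp add: first_hit_def l_def)
  moreover have "m < l \<longleftrightarrow> (\<forall>j\<in>{1..m}. \<not> P j)"
  proof
    show "\<forall>j\<in>{1..m}. \<not> P j" if "m < l" using that least by fastforce
    show "m < l" if "\<forall>j\<in>{1..m}. \<not> P j" using that l by (meson atLeastAtMost_iff not_le)
  qed
  ultimately show ?thesis by simp
next
  case False
  then show ?thesis by (auto simp: first_hit_def)
qed

section \<open>Discrete and continuous inverses of G\<close>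

context regular_scale
begin

lemma Gsum_Suc: "Gsum A (Suc n) = Gsum A n + 1 / A (Suc n)"
  by (simp add: Gsum_def)

lemma Gsum_0: "Gsum A 0 = 0" by (simp add: Gsum_def)

lemma Gsum_strict_mono: "strict_mono (Gsum A)"
proof (rule strict_monoI_Suc)
  show "Gsum A n < Gsum A (Suc n)" for n unfolding Gsum_Suc using A_pos[of "Suc n"] by simp
qed

lemma Gfun_nat: "Gfun A (real n) = Gsum A n"
  by (simp add: Gfun_def)

text \<open>The adjoint of Gsum in the sense of \<open>le_level_iff\<close>. For y < 0 the set is
  empty and \<open>Max\<close> says nothing, hence the premise 0 \<le> y there.\<close>

definition level :: "real \<Rightarrow> nat" where "level y = Max {n. Gsum A n \<le> y}"

lemma le_level_iff: "0 \<le> y \<Longrightarrow> n \<le> level y \<longleftrightarrow> Gsum A n \<le> y"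
proof -
  assume y: "0 \<le> y"
  have "\<forall>\<^sub>F n in sequentially. y + 1 \<le> Gsum A n" using Gsum_at_top unfolding filterlim_at_top by (rule spec)
  then obtain K where "y + 1 \<le> Gsum A K" unfolding eventually_sequentially by (meson order_refl)
  then have K: "y < Gsum A K" by linarith
  have "n < K" if "Gsum A n \<le> y" for n
    using that K strict_mono_less[OF Gsum_strict_mono, of n K] by linarith
  then have "{n. Gsum A n \<le> y} \<subseteq> {..<K}" by auto
  then have fin: "finite {n. Gsum A n \<le> y}" by (rule finite_subset) simp
  have "0 \<in> {n. Gsum A n \<le> y}" using y by (simp add: Gsum_0)
  then have mem: "level y \<in> {n. Gsum A n \<le> y}" unfolding level_def using fin by (intro Max_in) auto
  show ?thesis
  proof
    assume "n \<le> level y"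
    then have "Gsum A n \<le> Gsum A (level y)" using strict_mono_less_eq[OF Gsum_strict_mono] by blast
    then show "Gsum A n \<le> y" using mem by simp
  next
    assume "Gsum A n \<le> y"
    then show "n \<le> level y" unfolding level_def using fin by (intro Max_ge) auto
  qed
qed

lemma level_at_top: "filterlim level at_top at_top"
  unfolding filterlim_at_top
proof
  fix K
  show "\<forall>\<^sub>F y in at_top. K \<le> level y"
    using eventually_ge_at_top[of "max 0 (Gsum A K)"] by eventually_elim (simp add: le_level_iff)
qed

text \<open>y lies between two consecutive values of Gsum A, whose ratio tends to 1 by regular
  variation.\<close>

lemma Gsum_level_tendsto: "((\<lambda>y. Gsum A (level y) / y) \<longlongrightarrow> 1) at_top"
proof (rule tendsto_sandwich)
  have "(\<lambda>n. real (Suc n) / real n) \<longlonglongrightarrow> 1" by real_asymp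
  then have "(\<lambda>n. Gsum A (Suc n) / Gsum A n) \<longlonglongrightarrow> 1 powr (1 - 1 / \<alpha>)"
    by (rule Gsum_ratio_tendsto) (auto simp: filterlim_Suc)
  then have "(\<lambda>n. inverse (Gsum A (Suc n) / Gsum A n)) \<longlonglongrightarrow> inverse 1" by (intro tendsto_inverse) auto
  then have "(\<lambda>n. Gsum A n / Gsum A (Suc n)) \<longlonglongrightarrow> 1" by simp
  then show "((\<lambda>y. Gsum A (level y) / Gsum A (Suc (level y))) \<longlongrightarrow> 1) at_top"
    using level_at_top by (rule filterlim_compose)
  show "\<forall>\<^sub>F y in at_top. Gsum A (level y) / Gsum A (Suc (level y)) \<le> Gsum A (level y) / y"
    using eventually_gt_at_top[of 0]
  proof eventually_elim
    case (elim y)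
    have "\<not> Suc (level y) \<le> level y" by simp
    then have "y < Gsum A (Suc (level y))" using le_level_iff[of y "Suc (level y)"] elim by simp
    moreover have "0 \<le> Gsum A (level y)" using strict_mono_less_eq[OF Gsum_strict_mono, of 0] by (simp add: Gsum_0)
    ultimately show ?case using elim by (intro divide_left_mono mult_pos_pos) auto
  qed
  show "\<forall>\<^sub>F y in at_top. Gsum A (level y) / y \<le> 1"
    using eventually_gt_at_top[of 0]
  proof eventually_elim
    case (elim y)
    then show ?case using le_level_iff[of y "level y"] by simp
  qed
qed simp

text \<open>\<open>Ginv\<close> is a chosen preimage, so a preimage is exhibited first, by linear
  interpolation in the cell that starts at level y; any preimage in the half-line is then shown to
  lie in that cell.\<close>

lemma Ginv_bounds:
  assumes y: "0 \<le> y"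
  shows "real (level y) \<le> Ginv A y" "Ginv A y < real (level y) + 1"
proof -
  define l where "l = level y"
  have l: "Gsum A l \<le> y" "y < Gsum A (Suc l)"
    using le_level_iff[OF y, of l] le_level_iff[OF y, of "Suc l"] by (auto simp: l_def)
  define f where "f = (y - Gsum A l) * A (Suc l)"
  have Al: "0 < A (Suc l)" using A_pos by simp
  have f: "0 \<le> f" "f < 1" using l Al by (auto simp: f_def Gsum_Suc field_simps)
  have fl: "\<lfloor>real l + f\<rfloor> = int l" using f by (simp add: floor_eq_iff)
  have "Gfun A (real l + f) = y" unfolding Gfun_def fl using Al by (simp add: f_def)
  then have "y \<in> Gfun A ` {0..}" using f by (intro image_eqI[of _ _ "real l + f"]) auto
  then have inv: "Gfun A (Ginv A y) = y" "Ginv A y \<in> {0..}"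
    unfolding Ginv_def by (rule f_inv_into_f, rule inv_into_into)
  define x where "x = Ginv A y"
  define m where "m = nat \<lfloor>x\<rfloor>"
  have x0: "0 \<le> x" using inv by (simp add: x_def)
  have mx: "real m \<le> x" "x < real m + 1" using x0 by (auto simp: m_def)
  have fm: "of_int \<lfloor>x\<rfloor> = real m" using x0 by (simp add: m_def)
  have Am: "0 < A (Suc m)" using A_pos by simp
  have Gx: "y = Gsum A m + (x - real m) / A (Suc m)"
    using inv(1) unfolding x_def[symmetric] Gfun_def fm m_def[symmetric] by simp
  have "Gsum A m \<le> y" using Gx mx Am by simp
  then have "m \<le> l" using le_level_iff[OF y] by (simp add: l_def)
  moreover have "y < Gsum A (Suc m)"
    unfolding Gx Gsum_Suc using mx Am by (simp add: divide_strict_right_mono)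
  then have "\<not> Suc m \<le> l" using le_level_iff[OF y, of "Suc m"] by (simp add: l_def)
  ultimately have "m = l" by simp
  then show "real (level y) \<le> Ginv A y" "Ginv A y < real (level y) + 1"
    using mx by (auto simp: l_def x_def)
qed

text \<open>\<open>Ginv\<close> is within 1 of \<open>level\<close>, so r * Ginv A y is squeezed
  between two multiples of it, along which Gsum varies regularly with index 1 - 1 /
  \<alpha>.\<close>

lemma Gsum_Ginv_tendsto:
  assumes r: "0 < r"
  shows "((\<lambda>y. Gsum A (nat \<lfloor>r * Ginv A y\<rfloor>) / y) \<longlongrightarrow> r powr (1 - 1 / \<alpha>)) at_top"
    and "filterlim (\<lambda>y. nat \<lfloor>r * Ginv A y\<rfloor>) at_top at_top"
proof -
  let ?k1 = "\<lambda>m::nat. nat \<lfloor>r * real m\<rfloor>" and ?k2 = "\<lambda>m::nat. nat \<lfloor>r * (real m + 1)\<rfloor>"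
  have rk: "real (?k1 m) = of_int \<lfloor>r * real m\<rfloor>" "real (?k2 m) = of_int \<lfloor>r * (real m + 1)\<rfloor>" for m
    using r by auto
  have k1: "(\<lambda>m. real (?k1 m) / real m) \<longlonglongrightarrow> r" "filterlim ?k1 at_top sequentially"
  proof -
    show "(\<lambda>m. real (?k1 m) / real m) \<longlonglongrightarrow> r" unfolding rk by real_asymp
    have "filterlim (\<lambda>m. real (?k1 m)) at_top sequentially" unfolding rk using r by real_asymp
    then show "filterlim ?k1 at_top sequentially" by (simp add: filterlim_sequentially_iff_filterlim_real)
  qed
  have k2: "(\<lambda>m. real (?k2 m) / real m) \<longlonglongrightarrow> r" "filterlim ?k2 at_top sequentially"
  proof -
    show "(\<lambda>m. real (?k2 m) / real m) \<longlonglongrightarrow> r" unfolding rk by real_asymp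
    have "filterlim (\<lambda>m. real (?k2 m)) at_top sequentially" unfolding rk using r by real_asymp
    then show "filterlim ?k2 at_top sequentially" by (simp add: filterlim_sequentially_iff_filterlim_real)
  qed
  have between: "?k1 (level y) \<le> nat \<lfloor>r * Ginv A y\<rfloor>" "nat \<lfloor>r * Ginv A y\<rfloor> \<le> ?k2 (level y)" if "0 \<le> y" for y
  proof -
    note b = Ginv_bounds[OF that]
    show "?k1 (level y) \<le> nat \<lfloor>r * Ginv A y\<rfloor>" using b(1) r by (intro nat_mono floor_mono mult_left_mono) auto
    show "nat \<lfloor>r * Ginv A y\<rfloor> \<le> ?k2 (level y)" using b(2) r by (intro nat_mono floor_mono mult_left_mono) auto
  qed
  have Gmono: "Gsum A i \<le> Gsum A j" if "i \<le> j" for i j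
    using that strict_mono_less_eq[OF Gsum_strict_mono] by blast
  have lim: "((\<lambda>y. Gsum A (k (level y)) / y) \<longlongrightarrow> r powr (1 - 1 / \<alpha>)) at_top"
    if k: "(\<lambda>m. real (k m) / real m) \<longlonglongrightarrow> r" "filterlim k at_top sequentially" for k
  proof -
    have 1: "((\<lambda>y. Gsum A (k (level y)) / Gsum A (level y)) \<longlongrightarrow> r powr (1 - 1 / \<alpha>)) at_top"
      using filterlim_compose[OF Gsum_ratio_tendsto[OF k(1) r k(2)] level_at_top] .
    have 2: "((\<lambda>y. Gsum A (k (level y)) / Gsum A (level y) * (Gsum A (level y) / y)) \<longlongrightarrow> r powr (1 - 1 / \<alpha>) * 1) at_top"
      by (intro tendsto_mult 1 Gsum_level_tendsto)
    have "\<forall>\<^sub>F y in at_top. 1 \<le> level y" using level_at_top by (simp add: filterlim_at_top)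
    then have "\<forall>\<^sub>F y in at_top. Gsum A (k (level y)) / Gsum A (level y) * (Gsum A (level y) / y) = Gsum A (k (level y)) / y"
    proof eventually_elim
      case (elim y)
      then have "0 < Gsum A (level y)" using strict_mono_less[OF Gsum_strict_mono, of 0 "level y"] by (simp add: Gsum_0)
      then show ?case by simp
    qed
    then show ?thesis using Lim_transform_eventually[OF 2] by simp
  qed
  show "((\<lambda>y. Gsum A (nat \<lfloor>r * Ginv A y\<rfloor>) / y) \<longlongrightarrow> r powr (1 - 1 / \<alpha>)) at_top"
  proof (rule tendsto_sandwich[OF _ _ lim[OF k1] lim[OF k2]])
    show "\<forall>\<^sub>F y in at_top. Gsum A (?k1 (level y)) / y \<le> Gsum A (nat \<lfloor>r * Ginv A y\<rfloor>) / y"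
      using eventually_gt_at_top[of 0] by eventually_elim (intro divide_right_mono Gmono between, auto)
    show "\<forall>\<^sub>F y in at_top. Gsum A (nat \<lfloor>r * Ginv A y\<rfloor>) / y \<le> Gsum A (?k2 (level y)) / y"
      using eventually_gt_at_top[of 0] by eventually_elim (intro divide_right_mono Gmono between, auto)
  qed
  show "filterlim (\<lambda>y. nat \<lfloor>r * Ginv A y\<rfloor>) at_top at_top"
  proof (rule filterlim_at_top_mono)
    show "filterlim (\<lambda>y. ?k1 (level y)) at_top at_top" using k1(2) level_at_top by (rule filterlim_compose)
    show "\<forall>\<^sub>F y in at_top. ?k1 (level y) \<le> nat \<lfloor>r * Ginv A y\<rfloor>"
      using eventually_ge_at_top[of 0] by eventually_elim (rule between)
  qed
qed

end

lemma (in prob_space) integral_uniform_measure: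
  fixes f :: "'a \<Rightarrow> real"
  assumes S: "S \<in> sets M" "0 < prob S" and f: "f \<in> borel_measurable M"
  shows "(\<integral>\<omega>. f \<omega> \<partial>uniform_measure M S) = (\<integral>\<omega>. f \<omega> * indicator S \<omega> \<partial>M) / prob S"
proof -
  have "uniform_measure M S = density M (\<lambda>\<omega>. ennreal (indicator S \<omega> / prob S))"
    unfolding uniform_measure_def emeasure_eq_measure using S(2)
    by (intro density_cong AE_I2) (use S in \<open>auto simp: indicator_def divide_ennreal ennreal_1[symmetric] simp del: ennreal_1\<close>)
  then have "(\<integral>\<omega>. f \<omega> \<partial>uniform_measure M S) = (\<integral>\<omega>. (indicator S \<omega> / prob S) * f \<omega> \<partial>M)"
    using S f by (simp add: integral_density)
  also have "\<dots> = (\<integral>\<omega>. f \<omega> * indicator S \<omega> / prob S \<partial>M)" by (simp add: mult.commute)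
  finally show ?thesis by simp
qed

section \<open>The limit theorem for the hitting time\<close>

locale hitting = iid_walk M X + W: attracted_steps "distr M borel (X 0)" A \<mu>X c \<alpha> fX
    + L: exp_stable_product N E Gs \<beta>
  for M :: "'a measure" and X A \<mu>X c \<alpha> fX and N :: "'b measure" and E Gs \<beta> +
  fixes U :: "real \<Rightarrow> 'a \<Rightarrow> real"
  assumes beta_eq: "1 / \<beta> = 1 - 1 / \<alpha>"
    and U_rv: "\<And>\<epsilon>. 0 < \<epsilon> \<Longrightarrow> U \<epsilon> \<in> borel_measurable M"
    and U_unif: "\<And>\<epsilon>. 0 < \<epsilon> \<Longrightarrow>
        distr M lborel (U \<epsilon>) = uniform_measure lborel {-\<epsilon><..<\<epsilon>}"
    and U_indep: "\<And>\<epsilon>. 0 < \<epsilon> \<Longrightarrow>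
        indep_set (sets (vimage_algebra (space M) (U \<epsilon>) borel))
           (sets (vimage_algebra (space M) (\<lambda>\<omega> n. walk X n \<omega>) (Pi\<^sub>M UNIV (\<lambda>_. borel))))"
begin

definition \<tau> :: "real \<Rightarrow> 'a \<Rightarrow> enat" where
  "\<tau> \<epsilon> \<omega> = first_hit (\<lambda>n. \<bar>U \<epsilon> \<omega> + walk X n \<omega>\<bar> < \<epsilon>)"

text \<open>As Pstar is the probability of never returning to 0, this is the constant Gamma (1 /
  \<beta>) * \<gamma> / \<beta>.\<close>

definition C0 :: real where "C0 = Gamma (1 / \<beta>) * (2 * fX 0 * W.Pstar) / \<beta>"

lemma C0_pos: "0 < C0"
  unfolding C0_def using W.fX_0_pos W.Pstar_pos L.\<beta> Gamma_real_pos[of "1 / \<beta>"] by simp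

lemma prob_escape: "prob {\<omega> \<in> space M. \<forall>n\<ge>1. walk X n \<omega> \<noteq> 0} = W.Pstar"
  by (simp only: prob_never_zero W.Pstar_def)

lemma \<tau>_tail_sets: "0 < \<epsilon> \<Longrightarrow> {\<omega> \<in> space M. enat m < \<tau> \<epsilon> \<omega>} \<in> sets M"
proof -
  assume "0 < \<epsilon>"
  then have [measurable]: "U \<epsilon> \<in> borel_measurable M" by (rule U_rv)
  show ?thesis unfolding \<tau>_def less_first_hit_iff by measurable
qed

lemma \<tau>_tail: "0 < \<epsilon> \<Longrightarrow> prob {\<omega> \<in> space M. enat m < \<tau> \<epsilon> \<omega>} = steps.uniform_survive \<epsilon> m"
  unfolding \<tau>_def less_first_hit_iff by (rule prob_uniform_walk_avoids) (auto intro: U_rv U_unif U_indep)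

lemma U_range: "0 < \<epsilon> \<Longrightarrow> AE \<omega> in M. \<bar>U \<epsilon> \<omega>\<bar> < \<epsilon>"
proof -
  assume \<epsilon>: "0 < \<epsilon>"
  then have [measurable]: "U \<epsilon> \<in> borel_measurable M" by (rule U_rv)
  have "AE u in uniform_measure lborel {-\<epsilon><..<\<epsilon>}. \<bar>u\<bar> < \<epsilon>"
    by (rule AE_uniform_measureI) auto
  then have "AE u in distr M lborel (U \<epsilon>). \<bar>u\<bar> < \<epsilon>" by (simp only: U_unif[OF \<epsilon>])
  then show ?thesis by (subst (asm) AE_distr_iff) auto
qed

text \<open>V = exp (- \<tau> / n) lies in [0, 1], the event \<tau> \<le> n is V \<ge> exp (- 1),
  and the k-th moment of V is the Laplace transform of \<tau> at k / n. Conditional moments arise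
  from the total ones by removing the part off the conditioning event; their limits are the moments
  of Y.\<close>

lemma hitting_limit_sequence:
  fixes \<epsilon> :: "nat \<Rightarrow> real" and n :: "nat \<Rightarrow> nat"
  assumes \<epsilon>: "\<And>i. 0 < \<epsilon> i" "\<epsilon> \<longlonglongrightarrow> 0" and n: "filterlim n at_top sequentially" "\<And>i. 1 \<le> n i"
    and G: "(\<lambda>i. \<epsilon> i * Gsum A (n i)) \<longlonglongrightarrow> \<theta>" and \<theta>: "0 < \<theta>"
  shows "(\<lambda>i. \<P>(\<omega> in M. \<tau> (\<epsilon> i) \<omega> \<le> enat (n i) \<bar> \<forall>n\<ge>1. walk X n \<omega> \<noteq> 0))
     \<longlonglongrightarrow> \<P>(\<omega> in N. E \<omega> powr \<beta> * Gs \<omega> \<le> (C0 * \<theta>) powr \<beta>)"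
proof -
  define t where "t = C0 * \<theta>"
  have t: "0 < t" using C0_pos \<theta> by (simp add: t_def)
  have \<beta>: "0 < \<beta>" by (rule L.\<beta>)
  define Os where "Os = {\<omega> \<in> space M. \<forall>n\<ge>1. walk X n \<omega> \<noteq> 0}"
  have Os [measurable]: "Os \<in> sets M" unfolding Os_def by measurable
  have PO: "prob Os = W.Pstar" "0 < prob Os" using prob_escape W.Pstar_pos by (auto simp: Os_def)
  define M' where "M' = uniform_measure M Os"
  have sets_M' [measurable_cong]: "sets M' = sets M" by (simp add: M'_def)
  interpret M': prob_space M' unfolding M'_def using PO(2) by (intro prob_space_uniform_measure) (auto simp: emeasure_eq_measure)
  have z01: "0 < exp (- s / real (n i))" "exp (- s / real (n i)) < 1" if "0 < s" for s i
    using that n(2)[of i] by auto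
  define V where "V i \<omega> = enat_power (exp (- 1 / real (n i))) (\<tau> (\<epsilon> i) \<omega>)" for i \<omega>
  have V01: "0 \<le> V i \<omega>" "V i \<omega> \<le> 1" for i \<omega>
    unfolding V_def using z01[of 1 i] by (auto intro!: enat_power_bounds)
  have Vm [measurable]: "V i \<in> borel_measurable M" for i
    unfolding V_def[abs_def] by (rule expectation_enat_power(2)[OF z01[of 1 i] \<tau>_tail_sets[OF \<epsilon>(1)]]) auto
  have Vm' [measurable]: "V i \<in> borel_measurable M'" for i using Vm[of i] by (simp add: M'_def)
  define \<mu> where "\<mu> i = distr M' borel (V i)" for i
  \<comment> \<open>The factor t powr (- \<beta>) brings the target event E powr \<beta> * Gs \<le>
    t powr \<beta> to the form Y \<ge> exp (- 1).\<close>
  define Y where "Y \<omega> = exp (- (t powr (- \<beta>)) * (E \<omega> powr \<beta> * Gs \<omega>))" for \<omega>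
  have Ym [measurable]: "Y \<in> borel_measurable N" unfolding Y_def[abs_def] by measurable
  define \<nu> where "\<nu> = distr N borel Y"
  have rd: "real_distribution (\<mu> i)" "real_distribution \<nu>" for i
    unfolding \<mu>_def \<nu>_def by (auto intro!: M'.real_distribution_distr L.real_distribution_distr)
  have Y01: "AE \<omega> in N. Y \<omega> \<in> {0..1}"
    using L.Gs_nonneg by eventually_elim (auto simp: Y_def)
  have Vk: "V i \<omega> ^ k = enat_power (exp (- real k / real (n i))) (\<tau> (\<epsilon> i) \<omega>)" if "1 \<le> k" for i \<omega> k
    unfolding V_def enat_power_power[OF that] by (simp add: exp_of_nat_mult[symmetric])
  \<comment> \<open>Off \<open>Os\<close> the walk is at 0 at some time m. As the start satisfies
    \<bar>U\<bar> < \<epsilon>, this gives \<tau> \<le> m for every i, and V tends to 1.\<close>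
  have outside: "(\<lambda>i. \<integral>\<omega>. V i \<omega> ^ k * indicator (space M - Os) \<omega> \<partial>M) \<longlonglongrightarrow> 1 - W.Pstar" for k
  proof -
    have "(\<lambda>i. \<integral>\<omega>. V i \<omega> ^ k * indicator (space M - Os) \<omega> \<partial>M) \<longlonglongrightarrow> (\<integral>\<omega>. indicator (space M - Os) \<omega> \<partial>M)"
    proof (rule integral_dominated_convergence[where w="\<lambda>_. 1"])
      have "AE \<omega> in M. \<forall>i. \<bar>U (\<epsilon> i) \<omega>\<bar> < \<epsilon> i" unfolding AE_all_countable using U_range[OF \<epsilon>(1)] by blast
      then show "AE \<omega> in M. (\<lambda>i. V i \<omega> ^ k * indicator (space M - Os) \<omega>) \<longlonglongrightarrow> indicator (space M - Os) \<omega>"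
        using AE_space
      proof eventually_elim
        case (elim \<omega>)
        show ?case
        proof (cases "\<omega> \<in> Os")
          case False
          then obtain m where m: "1 \<le> m" "walk X m \<omega> = 0" using elim(2) unfolding Os_def by blast
          have "\<tau> (\<epsilon> i) \<omega> \<le> enat m" for i
          proof -
            have "\<bar>U (\<epsilon> i) \<omega> + walk X m \<omega>\<bar> < \<epsilon> i" unfolding m(2) add_0_right using elim(1) by (rule spec)
            moreover have "m \<in> {1..m}" using m(1) by simp
            ultimately have "\<not> enat m < \<tau> (\<epsilon> i) \<omega>" unfolding \<tau>_def less_first_hit_iff by blast
            then show ?thesis by simp
          qed
          then have lb: "exp (- 1 / real (n i)) ^ m \<le> V i \<omega>" for i
          proof -
            obtain j where j: "\<tau> (\<epsilon> i) \<omega> = enat j" "j \<le> m" using \<open>\<tau> (\<epsilon> i) \<omega> \<le> enat m\<close> by (cases "\<tau> (\<epsilon> i) \<omega>") auto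
            then show ?thesis using power_decreasing[OF j(2), of "exp (- 1 / real (n i))"] z01[of 1 i] by (simp add: V_def enat_power_def)
          qed
          have "(\<lambda>j. - 1 / real j) \<longlonglongrightarrow> 0" by real_asymp
          then have "(\<lambda>j. exp (- 1 / real j) ^ m) \<longlonglongrightarrow> exp 0 ^ m" by (intro tendsto_power tendsto_exp)
          from filterlim_compose[OF this n(1)] have "(\<lambda>i. exp (- 1 / real (n i)) ^ m) \<longlonglongrightarrow> 1" by simp
          then have "(\<lambda>i. V i \<omega>) \<longlonglongrightarrow> 1"
            by (rule tendsto_sandwich[OF always_eventually always_eventually _ tendsto_const, rotated 2])
               (intro allI lb V01)+
          then have "(\<lambda>i. V i \<omega> ^ k * indicator (space M - Os) \<omega>) \<longlonglongrightarrow> 1 ^ k * indicator (space M - Os) \<omega>"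
            by (rule tendsto_mult[OF tendsto_power tendsto_const])
          then show ?thesis by simp
        qed simp
      qed
      show "AE \<omega> in M. norm (V i \<omega> ^ k * indicator (space M - Os) \<omega>) \<le> 1" for i
        using V01 by (intro AE_I2) (auto simp: indicator_def power_le_one)
    qed auto
    moreover have "(\<integral>\<omega>. indicator (space M - Os) \<omega> \<partial>M) = 1 - W.Pstar"
    proof -
      have "(\<integral>\<omega>. indicator (space M - Os) \<omega> \<partial>M) = prob ((space M - Os) \<inter> space M)" by (rule Bochner_Integration.integral_indicator)
      also have "(space M - Os) \<inter> space M = space M - Os" by blast
      finally show ?thesis by (simp only: prob_compl[OF Os] PO)
    qed
    ultimately show ?thesis by simp
  qed
  have total: "(\<lambda>i. \<integral>\<omega>. V i \<omega> ^ k \<partial>M) \<longlonglongrightarrow> 1 - W.Pstar / (1 + t * real k powr (- (1 / \<beta>)))" if k: "1 \<le> k" for k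
  proof -
    have kp: "0 < real k" using k by simp
    have "(\<integral>\<omega>. V i \<omega> ^ k \<partial>M) = 1 - (1 - exp (- real k / real (n i))) * (\<Sum>m. exp (- real k / real (n i)) ^ m * steps.uniform_survive (\<epsilon> i) m)" for i
      unfolding Vk[OF k] using expectation_enat_power(1)[OF z01[OF kp, of i] \<tau>_tail_sets[OF \<epsilon>(1)[of i]]]
      by (simp only: \<tau>_tail[OF \<epsilon>(1)])
    moreover have "(\<lambda>i. 1 - (1 - exp (- real k / real (n i))) * (\<Sum>m. exp (- real k / real (n i)) ^ m * steps.uniform_survive (\<epsilon> i) m))
      \<longlonglongrightarrow> 1 - W.Pstar / (1 + Gamma (1 - 1 / \<alpha>) * (2 * fX 0 * W.Pstar) * (1 - 1 / \<alpha>) * \<theta> * real k powr (- (1 - 1 / \<alpha>)))"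
      by (intro tendsto_diff tendsto_const W.survive_generating_function_tendsto[OF \<epsilon> n G \<theta> kp])
    moreover have "Gamma (1 - 1 / \<alpha>) * (2 * fX 0 * W.Pstar) * (1 - 1 / \<alpha>) * \<theta> = t"
      unfolding beta_eq[symmetric] t_def C0_def by simp
    ultimately show ?thesis unfolding beta_eq by simp
  qed
  have moments: "(\<lambda>i. \<integral>x. x ^ k \<partial>\<mu> i) \<longlonglongrightarrow> (\<integral>x. x ^ k \<partial>\<nu>)" for k
  proof (cases "k = 0")
    case True
    interpret R: real_distribution "\<mu> i" for i by (rule rd)
    interpret R': real_distribution \<nu> by (rule rd)
    show ?thesis using True R.prob_space R'.prob_space by simp
  next
    case False
    then have k: "1 \<le> k" by simp
    define s where "s = real k * t powr (- \<beta>)"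
    have s: "0 < s" using k t by (simp add: s_def)
    have sp: "s powr (1 / \<beta>) = real k powr (1 / \<beta>) / t"
    proof -
      have "(t powr (- \<beta>)) powr (1 / \<beta>) = t powr (- 1)" using \<beta> by (simp add: powr_powr)
      also have "\<dots> = 1 / t" using t by (simp add: powr_minus_divide)
      finally show ?thesis unfolding s_def by (subst powr_mult) simp_all
    qed
    have "(\<integral>x. x ^ k \<partial>\<mu> i) = ((\<integral>\<omega>. V i \<omega> ^ k \<partial>M) - (\<integral>\<omega>. V i \<omega> ^ k * indicator (space M - Os) \<omega> \<partial>M)) / W.Pstar" for i
    proof -
      have int: "integrable M (\<lambda>\<omega>. V i \<omega> ^ k)"
        by (rule integrable_const_bound[where B=1]) (use V01 in \<open>auto simp: power_le_one\<close>)
      have int': "integrable M (\<lambda>\<omega>. V i \<omega> ^ k * indicator (space M - Os) \<omega>)"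
        by (rule integrable_const_bound[where B=1]) (use V01 in \<open>auto simp: power_le_one indicator_def\<close>)
      have "(\<integral>x. x ^ k \<partial>\<mu> i) = (\<integral>\<omega>. V i \<omega> ^ k \<partial>M')" unfolding \<mu>_def by (rule integral_distr) auto
      also have "\<dots> = (\<integral>\<omega>. V i \<omega> ^ k * indicator Os \<omega> \<partial>M) / prob Os"
        unfolding M'_def by (rule integral_uniform_measure[OF Os PO(2)]) measurable
      also have "(\<integral>\<omega>. V i \<omega> ^ k * indicator Os \<omega> \<partial>M) = (\<integral>\<omega>. V i \<omega> ^ k - V i \<omega> ^ k * indicator (space M - Os) \<omega> \<partial>M)"
        by (intro Bochner_Integration.integral_cong) (auto simp: indicator_def)
      also have "\<dots> = (\<integral>\<omega>. V i \<omega> ^ k \<partial>M) - (\<integral>\<omega>. V i \<omega> ^ k * indicator (space M - Os) \<omega> \<partial>M)"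
        using int int' by simp
      finally show ?thesis by (simp only: PO)
    qed
    moreover have "(\<lambda>i. ((\<integral>\<omega>. V i \<omega> ^ k \<partial>M) - (\<integral>\<omega>. V i \<omega> ^ k * indicator (space M - Os) \<omega> \<partial>M)) / W.Pstar)
       \<longlonglongrightarrow> ((1 - W.Pstar / (1 + t * real k powr (- (1 / \<beta>)))) - (1 - W.Pstar)) / W.Pstar"
      using W.Pstar_pos by (intro tendsto_divide tendsto_diff total[OF k] outside tendsto_const) auto
    \<comment> \<open>With K = k powr (1 / \<beta>), removing the part off \<open>Os\<close> leaves
      Pstar * t / (K + t), so Pstar cancels in the conditional moment.\<close>
    moreover have "((1 - W.Pstar / (1 + t * real k powr (- (1 / \<beta>)))) - (1 - W.Pstar)) / W.Pstar = 1 / (1 + s powr (1 / \<beta>))"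
    proof -
      define K where "K = real k powr (1 / \<beta>)"
      have K: "0 < K" using k by (simp add: K_def)
      have Kinv: "real k powr (- (1 / \<beta>)) = 1 / K" by (simp add: K_def powr_minus_divide)
      have "((1 - p / (1 + t * (1 / K))) - (1 - p)) / p = 1 / (1 + K / t)" if "0 < p" for p :: real
      proof -
        have "1 + t * (1 / K) = (K + t) / K" "1 + K / t = (K + t) / t" using K t by (simp_all add: add_divide_distrib)
        moreover have "(1 - p * (K / (K + t))) - (1 - p) = p * (t / (K + t))"
        proof -
          have "1 - K / (K + t) = t / (K + t)" using K t by (simp add: diff_divide_eq_iff)
          then have "p * (1 - K / (K + t)) = p * (t / (K + t))" by simp
          then show ?thesis unfolding right_diff_distrib mult_1_right by linarith
        qed
        ultimately show ?thesis using that by simp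
      qed
      from this[OF W.Pstar_pos] show ?thesis unfolding Kinv sp K_def[symmetric] .
    qed
    moreover have "(\<integral>x. x ^ k \<partial>\<nu>) = 1 / (1 + s powr (1 / \<beta>))"
    proof -
      have "(\<integral>x. x ^ k \<partial>\<nu>) = (\<integral>\<omega>. Y \<omega> ^ k \<partial>N)" unfolding \<nu>_def by (rule integral_distr) auto
      also have "\<dots> = (\<integral>\<omega>. exp (- s * (E \<omega> powr \<beta> * Gs \<omega>)) \<partial>N)"
        unfolding Y_def exp_of_nat_mult[symmetric] s_def by (simp add: mult_ac)
      also have "\<dots> = 1 / (1 + s powr (1 / \<beta>))" by (rule L.laplace_transform[OF s])
      finally show ?thesis .
    qed
    ultimately show ?thesis by simp
  qed
  have wc: "weak_conv_m \<mu> \<nu>"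
  proof (rule moments_imp_weak_conv[OF rd _ _ moments])
    show "AE x in \<mu> i. x \<in> {0..1}" for i
      unfolding \<mu>_def using V01 by (subst AE_distr_iff) auto
    show "AE x in \<nu>. x \<in> {0..1}" unfolding \<nu>_def using Y01 by (subst AE_distr_iff) auto
  qed
  have Y_iff: "exp (- 1) \<le> Y \<omega> \<longleftrightarrow> E \<omega> powr \<beta> * Gs \<omega> \<le> t powr \<beta>" "Y \<omega> = exp (- 1) \<longleftrightarrow> E \<omega> powr \<beta> * Gs \<omega> = t powr \<beta>" for \<omega>
  proof -
    define x where "x = E \<omega> powr \<beta> * Gs \<omega>"
    define T where "T = t powr \<beta>"
    have T: "0 < T" using t by (simp add: T_def)
    have Y: "Y \<omega> = exp (- (x / T))" unfolding Y_def x_def T_def powr_minus_divide by simp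
    have "exp (- 1) \<le> Y \<omega> \<longleftrightarrow> x \<le> T" "Y \<omega> = exp (- 1) \<longleftrightarrow> x = T" unfolding Y using T by auto
    then show "exp (- 1) \<le> Y \<omega> \<longleftrightarrow> E \<omega> powr \<beta> * Gs \<omega> \<le> t powr \<beta>" "Y \<omega> = exp (- 1) \<longleftrightarrow> E \<omega> powr \<beta> * Gs \<omega> = t powr \<beta>"
      by (simp_all only: x_def T_def)
  qed
  \<comment> \<open>The threshold exp (- 1) carries no mass in the limit by \<open>no_atom\<close>,
    so weak convergence yields convergence of the probabilities themselves.\<close>
  have null: "emeasure \<nu> (frontier {exp (- 1)..}) = 0"
  proof -
    have "emeasure \<nu> {exp (- 1)} = emeasure N {\<omega> \<in> space N. E \<omega> powr \<beta> * Gs \<omega> = t powr \<beta>}"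
      unfolding \<nu>_def by (subst emeasure_distr) (auto simp: Y_iff intro!: arg_cong[where f="emeasure N"])
    also have "\<dots> = 0"
      by (rule emeasure_eq_0_AE) (use L.no_atom[of "t powr \<beta>"] t in auto)
    finally show ?thesis by (simp add: frontier_real_atLeast)
  qed
  have "(\<lambda>i. measure (\<mu> i) {exp (- 1)..}) \<longlonglongrightarrow> measure \<nu> {exp (- 1)..}"
    by (rule weak_conv_imp_continuity_set_conv[OF rd wc _ null]) simp
  moreover have "measure \<nu> {exp (- 1)..} = \<P>(\<omega> in N. E \<omega> powr \<beta> * Gs \<omega> \<le> t powr \<beta>)"
    unfolding \<nu>_def by (subst measure_distr) (auto simp: Y_iff intro!: arg_cong[where f="measure N"])
  moreover have "measure (\<mu> i) {exp (- 1)..} = \<P>(\<omega> in M. \<tau> (\<epsilon> i) \<omega> \<le> enat (n i) \<bar> \<forall>n\<ge>1. walk X n \<omega> \<noteq> 0)" for i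
  proof -
    have V_iff: "exp (- 1) \<le> V i \<omega> \<longleftrightarrow> \<tau> (\<epsilon> i) \<omega> \<le> enat (n i)" for \<omega>
    proof (cases "\<tau> (\<epsilon> i) \<omega>")
      case (enat m)
      have "V i \<omega> = exp (- (real m / real (n i)))" by (simp add: V_def enat_power_def enat exp_of_nat_mult[symmetric])
      then have "exp (- 1) \<le> V i \<omega> \<longleftrightarrow> real m / real (n i) \<le> 1" by simp
      also have "\<dots> \<longleftrightarrow> m \<le> n i" using n(2)[of i] by (simp add: divide_le_eq_1)
      finally show ?thesis by (simp add: enat)
    next
      case infinity
      then show ?thesis by (simp add: V_def enat_power_def)
    qed
    have "measure (\<mu> i) {exp (- 1)..} = measure M' {\<omega> \<in> space M'. \<tau> (\<epsilon> i) \<omega> \<le> enat (n i)}"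
      unfolding \<mu>_def by (subst measure_distr) (auto simp: V_iff intro!: arg_cong[where f="measure M'"])
    also have "\<dots> = \<P>(\<omega> in M. \<tau> (\<epsilon> i) \<omega> \<le> enat (n i) \<bar> \<forall>n\<ge>1. walk X n \<omega> \<noteq> 0)"
      unfolding M'_def Os_def
    proof (rule measure_uniform_measure_eq_cond_prob)
      have "Measurable.pred M (\<lambda>\<omega>. exp (- 1) \<le> V i \<omega>)" by measurable
      then show "Measurable.pred M (\<lambda>\<omega>. \<tau> (\<epsilon> i) \<omega> \<le> enat (n i))" by (simp only: V_iff)
    qed measurable
    finally show ?thesis .
  qed
  ultimately show ?thesis by (simp add: t_def)
qed

lemma hitting_limit:
  fixes k :: "real \<Rightarrow> nat"
  assumes k: "filterlim k at_top (at_right 0)"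
    and G: "((\<lambda>\<epsilon>. \<epsilon> * Gsum A (k \<epsilon>)) \<longlongrightarrow> \<theta>) (at_right 0)" and \<theta>: "0 < \<theta>"
  shows "((\<lambda>\<epsilon>. \<P>(\<omega> in M. \<tau> \<epsilon> \<omega> \<le> enat (k \<epsilon>) \<bar> \<forall>n\<ge>1. walk X n \<omega> \<noteq> 0))
     \<longlongrightarrow> \<P>(\<omega> in N. E \<omega> powr \<beta> * Gs \<omega> \<le> (C0 * \<theta>) powr \<beta>)) (at_right 0)"
  unfolding tendsto_at_iff_sequentially
proof (intro allI impI)
  fix \<epsilon> :: "nat \<Rightarrow> real" assume e: "\<forall>i. \<epsilon> i \<in> {0<..} - {0}" and lim: "\<epsilon> \<longlonglongrightarrow> 0"
  have pos: "0 < \<epsilon> i" for i using e by auto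
  have fl: "filterlim \<epsilon> (at_right 0) sequentially"
    unfolding filterlim_at using lim pos by (simp add: order.strict_implies_not_eq[OF pos, symmetric])
  \<comment> \<open>\<open>max 1\<close> enforces n i \<ge> 1 and changes only finitely many terms,
    since k diverges.\<close>
  define n where "n i = max 1 (k (\<epsilon> i))" for i
  have kt: "filterlim (\<lambda>i. k (\<epsilon> i)) at_top sequentially" using k fl by (rule filterlim_compose)
  then have ev: "\<forall>\<^sub>F i in sequentially. k (\<epsilon> i) = n i"
    unfolding filterlim_at_top n_def by (auto elim!: eventually_mono dest!: spec[of _ 1])
  have nt: "filterlim n at_top sequentially"
    by (rule filterlim_at_top_mono[OF kt]) (simp add: n_def)
  have "(\<lambda>i. \<epsilon> i * Gsum A (k (\<epsilon> i))) \<longlonglongrightarrow> \<theta>" using G fl by (rule filterlim_compose)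
  moreover have "\<forall>\<^sub>F i in sequentially. \<epsilon> i * Gsum A (k (\<epsilon> i)) = \<epsilon> i * Gsum A (n i)"
    using ev by eventually_elim simp
  ultimately have "(\<lambda>i. \<epsilon> i * Gsum A (n i)) \<longlonglongrightarrow> \<theta>" by (rule Lim_transform_eventually)
  from hitting_limit_sequence[OF pos lim nt _ this \<theta>]
  have "(\<lambda>i. \<P>(\<omega> in M. \<tau> (\<epsilon> i) \<omega> \<le> enat (n i) \<bar> \<forall>n\<ge>1. walk X n \<omega> \<noteq> 0))
     \<longlonglongrightarrow> \<P>(\<omega> in N. E \<omega> powr \<beta> * Gs \<omega> \<le> (C0 * \<theta>) powr \<beta>)" by (simp add: n_def)
  moreover have "\<forall>\<^sub>F i in sequentially. \<P>(\<omega> in M. \<tau> (\<epsilon> i) \<omega> \<le> enat (n i) \<bar> \<forall>n\<ge>1. walk X n \<omega> \<noteq> 0)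
     = ((\<lambda>\<epsilon>. \<P>(\<omega> in M. \<tau> \<epsilon> \<omega> \<le> enat (k \<epsilon>) \<bar> \<forall>n\<ge>1. walk X n \<omega> \<noteq> 0)) \<circ> \<epsilon>) i"
    using ev by eventually_elim simp
  ultimately show "((\<lambda>\<epsilon>. \<P>(\<omega> in M. \<tau> \<epsilon> \<omega> \<le> enat (k \<epsilon>) \<bar> \<forall>n\<ge>1. walk X n \<omega> \<noteq> 0)) \<circ> \<epsilon>)
     \<longlonglongrightarrow> \<P>(\<omega> in N. E \<omega> powr \<beta> * Gs \<omega> \<le> (C0 * \<theta>) powr \<beta>)" by (rule Lim_transform_eventually)
qed

lemma inverse_at_top: "0 < r \<Longrightarrow> filterlim (\<lambda>\<epsilon>::real. r / \<epsilon>) at_top (at_right 0)"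
  by real_asymp

text \<open>Gfun agrees with Gsum at integers, so the event is \<tau> \<le> level (r / \<epsilon>)
  with r = t / C0; for this time scale \<epsilon> * Gsum tends to \<theta> = r.\<close>

lemma hitting_limit_Gfun:
  assumes t: "0 < t"
  shows "((\<lambda>\<epsilon>. \<P>(\<omega> in M. (\<exists>n. \<tau> \<epsilon> \<omega> = enat n \<and> C0 * \<epsilon> * Gfun A (real n) \<le> t) \<bar> \<forall>n\<ge>1. walk X n \<omega> \<noteq> 0))
     \<longlongrightarrow> \<P>(\<omega> in N. E \<omega> * Gs \<omega> powr (1 / \<beta>) \<le> t)) (at_right 0)"
proof -
  define r where "r = t / C0"
  have r: "0 < r" using t C0_pos by (simp add: r_def)
  define k where "k \<epsilon> = W.level (r / \<epsilon>)" for \<epsilon>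
  have kt: "filterlim k at_top (at_right 0)"
    unfolding k_def using W.level_at_top inverse_at_top[OF r] by (rule filterlim_compose)
  have "((\<lambda>\<epsilon>. r * (Gsum A (k \<epsilon>) / (r / \<epsilon>))) \<longlongrightarrow> r * 1) (at_right 0)"
    unfolding k_def by (intro tendsto_mult tendsto_const filterlim_compose[OF W.Gsum_level_tendsto inverse_at_top[OF r]])
  then have G: "((\<lambda>\<epsilon>. \<epsilon> * Gsum A (k \<epsilon>)) \<longlongrightarrow> r) (at_right 0)" using r by (simp add: mult.commute)
  have eq: "\<forall>\<^sub>F \<epsilon> in at_right 0. \<P>(\<omega> in M. \<tau> \<epsilon> \<omega> \<le> enat (k \<epsilon>) \<bar> \<forall>n\<ge>1. walk X n \<omega> \<noteq> 0)
     = \<P>(\<omega> in M. (\<exists>n. \<tau> \<epsilon> \<omega> = enat n \<and> C0 * \<epsilon> * Gfun A (real n) \<le> t) \<bar> \<forall>n\<ge>1. walk X n \<omega> \<noteq> 0)"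
    using eventually_at_right_less[of 0]
  proof eventually_elim
    case (elim \<epsilon>)
    have "C0 * \<epsilon> * Gfun A (real n) \<le> t \<longleftrightarrow> n \<le> k \<epsilon>" for n
    proof -
      have "n \<le> k \<epsilon> \<longleftrightarrow> Gsum A n \<le> r / \<epsilon>" unfolding k_def using r elim by (intro W.le_level_iff) auto
      also have "\<dots> \<longleftrightarrow> C0 * \<epsilon> * Gsum A n \<le> t" using elim C0_pos by (simp add: r_def field_simps)
      finally show ?thesis by (simp add: W.Gfun_nat)
    qed
    then have "(\<exists>n. \<tau> \<epsilon> \<omega> = enat n \<and> C0 * \<epsilon> * Gfun A (real n) \<le> t) \<longleftrightarrow> \<tau> \<epsilon> \<omega> \<le> enat (k \<epsilon>)" for \<omega>
      by (cases "\<tau> \<epsilon> \<omega>") auto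
    then show ?case by simp
  qed
  have "C0 * r = t" using C0_pos by (simp add: r_def)
  then show ?thesis
    using Lim_transform_eventually[OF hitting_limit[OF kt G r] eq] L.powr_form[OF t] by simp
qed

text \<open>The time scale is r * Ginv A (1 / \<epsilon>) rounded down. Regular variation of G gives
  \<theta> = r powr (1 / \<beta>), and r is fixed so that (C0 * \<theta>) powr \<beta> = t.\<close>

lemma hitting_limit_Ginv:
  assumes t: "0 < t"
  shows "((\<lambda>\<epsilon>. \<P>(\<omega> in M. (\<exists>n. \<tau> \<epsilon> \<omega> = enat n \<and> C0 powr \<beta> * real n / Ginv A (1 / \<epsilon>) \<le> t) \<bar> \<forall>n\<ge>1. walk X n \<omega> \<noteq> 0))
     \<longlongrightarrow> \<P>(\<omega> in N. E \<omega> powr \<beta> * Gs \<omega> \<le> t)) (at_right 0)"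
proof -
  define r where "r = t / C0 powr \<beta>"
  have r: "0 < r" using t C0_pos by (simp add: r_def)
  define k where "k \<epsilon> = nat \<lfloor>r * Ginv A (1 / \<epsilon>)\<rfloor>" for \<epsilon>
  have it: "filterlim (\<lambda>\<epsilon>::real. 1 / \<epsilon>) at_top (at_right 0)" by (rule inverse_at_top) simp
  have kt: "filterlim k at_top (at_right 0)"
    unfolding k_def using W.Gsum_Ginv_tendsto(2)[OF r] it by (rule filterlim_compose)
  have "((\<lambda>\<epsilon>. Gsum A (k \<epsilon>) / (1 / \<epsilon>)) \<longlongrightarrow> r powr (1 - 1 / \<alpha>)) (at_right 0)"
    unfolding k_def using W.Gsum_Ginv_tendsto(1)[OF r] it by (rule filterlim_compose)
  then have G: "((\<lambda>\<epsilon>. \<epsilon> * Gsum A (k \<epsilon>)) \<longlongrightarrow> r powr (1 / \<beta>)) (at_right 0)"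
    unfolding beta_eq by (simp add: mult.commute)
  have "filterlim (\<lambda>\<epsilon>. W.level (1 / \<epsilon>)) at_top (at_right 0)" using W.level_at_top it by (rule filterlim_compose)
  then have lev: "\<forall>\<^sub>F \<epsilon> in at_right 0. 1 \<le> W.level (1 / \<epsilon>)" by (simp add: filterlim_at_top)
  have eq: "\<forall>\<^sub>F \<epsilon> in at_right 0. \<P>(\<omega> in M. \<tau> \<epsilon> \<omega> \<le> enat (k \<epsilon>) \<bar> \<forall>n\<ge>1. walk X n \<omega> \<noteq> 0)
     = \<P>(\<omega> in M. (\<exists>n. \<tau> \<epsilon> \<omega> = enat n \<and> C0 powr \<beta> * real n / Ginv A (1 / \<epsilon>) \<le> t) \<bar> \<forall>n\<ge>1. walk X n \<omega> \<noteq> 0)"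
    using eventually_at_right_less[of 0] lev
  proof eventually_elim
    case (elim \<epsilon>)
    \<comment> \<open>Positivity is needed to clear the denominator: a quotient by 0 would count as
      0.\<close>
    have "1 \<le> Ginv A (1 / \<epsilon>)"
      using W.Ginv_bounds(1)[of "1 / \<epsilon>"] elim by simp
    then have gp: "0 < Ginv A (1 / \<epsilon>)" by simp
    have "C0 powr \<beta> * real n / Ginv A (1 / \<epsilon>) \<le> t \<longleftrightarrow> n \<le> k \<epsilon>" for n
    proof -
      have c: "0 < C0 powr \<beta>" using C0_pos by simp
      have "n \<le> k \<epsilon> \<longleftrightarrow> real n \<le> r * Ginv A (1 / \<epsilon>)"
      proof -
        have "0 \<le> r * Ginv A (1 / \<epsilon>)" using r gp by simp
        then show ?thesis unfolding k_def by (simp add: le_nat_iff le_floor_iff)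
      qed
      also have "\<dots> \<longleftrightarrow> C0 powr \<beta> * real n / Ginv A (1 / \<epsilon>) \<le> t" unfolding r_def using gp c by (simp add: field_simps)
      finally show ?thesis by simp
    qed
    then have "(\<exists>n. \<tau> \<epsilon> \<omega> = enat n \<and> C0 powr \<beta> * real n / Ginv A (1 / \<epsilon>) \<le> t) \<longleftrightarrow> \<tau> \<epsilon> \<omega> \<le> enat (k \<epsilon>)" for \<omega>
      by (cases "\<tau> \<epsilon> \<omega>") auto
    then show ?case by simp
  qed
  have "(C0 * r powr (1 / \<beta>)) powr \<beta> = t"
    using C0_pos r t L.\<beta> by (simp add: powr_mult powr_powr) (simp add: r_def)
  then show ?thesis
    using Lim_transform_eventually[OF hitting_limit[OF kt G] eq] r by simp
qed

end

theorem theorem3p2: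
  fixes M :: "'a measure" and X :: "nat \<Rightarrow> 'a \<Rightarrow> real"
    and A :: "nat \<Rightarrow> real" and \<mu>X :: "real measure" and fX :: "real \<Rightarrow> real"
    and \<alpha> \<beta> :: real
    and U :: "real \<Rightarrow> 'a \<Rightarrow> real"
    and N :: "'b measure" and E Gs :: "'b \<Rightarrow> real"
    and t :: real
  assumes M: "prob_space M"
    and indep: "prob_space.indep_vars M (\<lambda>_. borel) X UNIV"
    and ident: "\<And>i. distr M borel (X i) = distr M borel (X 0)"
    and recurrent: "recurrent_walk M (walk X)"
    and A_pos: "\<And>n. 1 \<le> n \<Longrightarrow> 0 < A n"
    and conv: "weak_conv_m (\<lambda>n. distr M borel (\<lambda>\<omega>. walk X n \<omega> / A n)) \<mu>X"
    and \<alpha>: "1 < \<alpha>" "\<alpha> \<le> 2"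
    and stable: "stable_law \<mu>X \<alpha>"
    and density: "\<mu>X = density lborel (\<lambda>x. ennreal (fX x))"
    and fX_nonneg: "\<And>x. 0 \<le> fX x" and fX_cont: "continuous_on UNIV fX"
    and cramer: "Limsup at_infinity (\<lambda>s::real. ereal (cmod (char (distr M borel (X 0)) s))) < 1"
    and \<beta>: "1 / \<alpha> + 1 / \<beta> = 1"
    and U_rv: "\<And>\<epsilon>. 0 < \<epsilon> \<Longrightarrow> U \<epsilon> \<in> borel_measurable M"
    and U_unif: "\<And>\<epsilon>. 0 < \<epsilon> \<Longrightarrow>
        distr M lborel (U \<epsilon>) = uniform_measure lborel {-\<epsilon><..<\<epsilon>}"
    and U_indep: "\<And>\<epsilon>. 0 < \<epsilon> \<Longrightarrow>
        prob_space.indep_set M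
           (sets (vimage_algebra (space M) (U \<epsilon>) borel))
           (sets (vimage_algebra (space M) (\<lambda>\<omega> n. walk X n \<omega>) (Pi\<^sub>M UNIV (\<lambda>_. borel))))"
    and N: "prob_space N"
    and E_exp: "distributed N lborel E (exponential_density 1)"
    and Gs_rv: "Gs \<in> borel_measurable N"
    and Gs_nonneg: "AE \<omega> in N. 0 \<le> Gs \<omega>"
    and Gs_laplace: "\<And>s. 0 < s \<Longrightarrow>
        (\<integral>\<^sup>+\<omega>. ennreal (exp (- s * Gs \<omega>)) \<partial>N) = ennreal (exp (- (s powr (1 / \<beta>))))"
    and EG_indep: "prob_space.indep_var N borel E borel Gs"
    and t: "0 < t"
  defines "\<Omega>s \<equiv> (\<lambda>\<omega>. \<forall>n\<ge>1. walk X n \<omega> \<noteq> 0)"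
    and "\<gamma> \<equiv> 2 * fX 0 * \<P>(\<omega> in M. \<forall>n\<ge>1. walk X n \<omega> \<noteq> 0)"
    and "\<tau> \<equiv> (\<lambda>\<epsilon> \<omega>. first_hit (\<lambda>n. \<bar>U \<epsilon> \<omega> + walk X n \<omega>\<bar> < \<epsilon>))"
  shows "((\<lambda>\<epsilon>. \<P>(\<omega> in M. (\<exists>n. \<tau> \<epsilon> \<omega> = enat n \<and>
              Gamma (1 / \<beta>) * \<gamma> / \<beta> * \<epsilon> * Gfun A (real n) \<le> t) \<bar> \<Omega>s \<omega>))
          \<longlongrightarrow> \<P>(\<omega> in N. E \<omega> * Gs \<omega> powr (1 / \<beta>) \<le> t)) (at_right 0)
       \<and> ((\<lambda>\<epsilon>. \<P>(\<omega> in M. (\<exists>n. \<tau> \<epsilon> \<omega> = enat n \<and>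
              (Gamma (1 / \<beta>) * \<gamma> / \<beta>) powr \<beta> * real n / Ginv A (1 / \<epsilon>) \<le> t) \<bar> \<Omega>s \<omega>))
          \<longlongrightarrow> \<P>(\<omega> in N. E \<omega> powr \<beta> * Gs \<omega> \<le> t)) (at_right 0)"
proof -
  interpret iw: iid_walk M X
    using M indep ident by (simp add: iid_walk_def iid_walk_axioms_def)
  obtain \<sigma> b m where \<sigma>: "0 < \<sigma>"
    and char_eq: "\<And>t. char \<mu>X t = exp (\<i> * of_real (m * t) - of_real (\<sigma> powr \<alpha> * \<bar>t\<bar> powr \<alpha>)
         * (1 - \<i> * of_real (b * sgn t * tan (pi * \<alpha> / 2))))"
    using stable unfolding stable_law_def by blast
  \<comment> \<open>The bracket in the exponent has real part 1 and the location term is imaginary,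
    so only \<sigma> powr \<alpha> survives in the modulus.\<close>
  define c where "c = \<sigma> powr \<alpha>"
  have cmod_eq: "cmod (char \<mu>X t) = exp (- c * \<bar>t\<bar> powr \<alpha>)" for t
    unfolding char_eq norm_exp_eq_Re by (simp add: c_def)
  have rd\<mu>: "real_distribution \<mu>X" using stable by (simp add: stable_law_def)
  have char_scaled: "char (distr M borel (\<lambda>\<omega>. walk X n \<omega> / A n)) s = char iw.D (s / A n) ^ n" for n s
  proof -
    have "char (distr M borel (\<lambda>\<omega>. walk X n \<omega> / A n)) s = char (distr M borel (walk X n)) (s / A n)"
      by (simp add: char_def integral_distr)
    then show ?thesis by (simp add: iw.char_walk)
  qed
  have ulim: "uniform_limit {-T..T} (\<lambda>n s. char iw.D (s / A n) ^ n) (char \<mu>X) sequentially" for T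
  proof -
    have "uniform_limit {-T..T} (\<lambda>n. char (distr M borel (\<lambda>\<omega>. walk X n \<omega> / A n))) (char \<mu>X) sequentially"
      by (rule weak_conv_imp_char_uniform_limit[OF _ rd\<mu> conv]) (rule iw.real_distribution_distr, measurable)
    moreover have "(\<lambda>n. char (distr M borel (\<lambda>\<omega>. walk X n \<omega> / A n))) = (\<lambda>n s. char iw.D (s / A n) ^ n)"
      by (intro ext char_scaled)
    ultimately show ?thesis by (simp only:)
  qed
  have \<beta>_eq: "1 / \<beta> = 1 - 1 / \<alpha>" using \<beta> by simp
  then have "0 < 1 / \<beta>" using \<alpha> by simp
  then have \<beta>_pos: "0 < \<beta>" by simp
  interpret h: hitting M X A \<mu>X c \<alpha> fX N E Gs \<beta> U
  proof (intro hitting.intro attracted_steps.intro attracted_walk_density.intro attracted_walk.intro)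
    show "iid_walk M X" by (rule iw.iid_walk_axioms)
    show "iid_steps iw.D" by (rule iw.steps.iid_steps_axioms)
    show "real_distribution iw.D" by (rule iw.steps.real_distribution_axioms)
    show "attracted_walk_axioms iw.D iw.steps.step_law A \<mu>X c \<alpha>"
      unfolding attracted_walk_axioms_def
      using iw.steps.real_distribution_step_law iw.char_walk A_pos rd\<mu> ulim cmod_eq \<sigma> \<alpha> cramer
      by (auto simp: iw.distr_walk[symmetric] c_def)
    show "attracted_walk_density_axioms \<mu>X fX"
      using density fX_nonneg fX_cont by (intro attracted_walk_density_axioms.intro)
    show "exp_stable_product N E Gs \<beta>"
      using N E_exp Gs_rv Gs_nonneg Gs_laplace EG_indep \<beta>_pos
      by (intro exp_stable_product.intro exp_stable_product_axioms.intro)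
    show "hitting_axioms M X \<alpha> \<beta> U"
      using \<beta>_eq U_rv U_unif U_indep by (intro hitting_axioms.intro)
  qed
  have C0: "h.C0 = Gamma (1 / \<beta>) * \<gamma> / \<beta>" by (simp only: h.C0_def \<gamma>_def h.prob_escape)
  have \<tau>: "h.\<tau> = \<tau>" by (simp add: h.\<tau>_def[abs_def] \<tau>_def)
  show ?thesis
    using h.hitting_limit_Gfun[OF t] h.hitting_limit_Ginv[OF t] unfolding C0 \<tau> \<Omega>s_def by (rule conjI)
qed

end
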